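(* Let $0<p,p_1,q,q_1\le\infty$, $s\in\mathbb{R}$. Then $M_{p_1,q_1}^s\hookrightarrow W_{p,q}$ if and only if $p_1\le p$ and one of the following conditions is satisfied: (1) $q_1\le\min\{p,q\}$, $s\ge0$; (2) $q_1>\min\{p,q\}$, $s+\dfrac{d}{q_1}>\dfrac{d}{\min\{p,q\}}$.
   Context: All function spaces are on $\mathbb{R}^d$, $d\ge 1$; $1/\infty=0$; $\hookrightarrow$ denotes continuous embedding (inclusion with $\|f\|_Y\le C\|f\|_X$ for all $f\in X$); $\langle x\rangle=(1+|x|^2)^{1/2}$; $\mathscr{F}$ is the Fourier transform on $\mathscr{S}'(\mathbb{R}^d)$. Let $\sigma$ be a smooth function adapted to $[-1/2,1/2]^d$, vanishing outside $[-3/4,3/4]^d$, with $\sum_{k\in\mathbb{Z}^d}\sigma(\xi-k)=1$ for all $\xi$, and put $\Box_k=\mathscr{F}^{-1}\sigma(\cdot-k)\mathscr{F}$. For $0<p,q\le\infty$, $s\in\mathbb{R}$, the modulation space $M_{p,q}^s$ and Wiener amalgam space $W_{p,q}^s$ consist of all $f\in\mathscr{S}'$ with finite (quasi-)norm $\|f\|_{M_{p,q}^s}=\big\|\langle k\rangle^s\|\Box_kf\|_{L^p}\big\|_{\ell^q_{k\in\mathbb{Z}^d}}$, respectively $\|f\|_{W_{p,q}^s}=\big\|\,\|\langle k\rangle^s\Box_kf(x)\|_{\ell^q_{k\in\mathbb{Z}^d}}\big\|_{L^p_x}$ (independent of $\sigma$ up to equivalent norms); $W_{p,q}=W_{p,q}^0$.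 *)

theory Defs
  imports "HOL-Analysis.Analysis" "HOL-Probability.Essential_Supremum"
begin

definition partial_deriv :: "'n \<Rightarrow> (real^'n \<Rightarrow> complex) \<Rightarrow> real^'n::finite \<Rightarrow> complex"
  where "partial_deriv i f x = frechet_derivative f (at x) (axis i 1)"

(* Multi-indices are encoded as lists of coordinates; the order of the list is immaterial for
   smooth functions. *)
definition iter_deriv :: "'n list \<Rightarrow> (real^'n \<Rightarrow> complex) \<Rightarrow> real^'n::finite \<Rightarrow> complex"
  where "iter_deriv is f = foldr partial_deriv is f"

definition smooth :: "(real^'n::finite \<Rightarrow> complex) \<Rightarrow> bool"
  where "smooth f \<longleftrightarrow> (\<forall>is x. iter_deriv is f differentiable (at x))"

definition schwartz :: "(real^'n::finite \<Rightarrow> complex) set"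
  where "schwartz = {\<phi>. smooth \<phi> \<and>
    (\<forall>is m. \<exists>C. \<forall>x. (1 + norm x) ^ m * norm (iter_deriv is \<phi> x) \<le> C)}"

(* Only meaningful on the Schwartz space, where the supremum is finite. *)
definition schwartz_norm :: "nat \<Rightarrow> (real^'n::finite \<Rightarrow> complex) \<Rightarrow> real"
  where "schwartz_norm N \<phi> =
    (SUP (is, x) \<in> {is. length is \<le> N} \<times> UNIV. (1 + norm x) ^ N * norm (iter_deriv is \<phi> x))"

type_synonym 'n distr = "(real^'n \<Rightarrow> complex) \<Rightarrow> complex"

(* Extensionality fixes the irrelevant values of a functional off the Schwartz space, so that
   equality of elements is equality of distributions. *)
definition tempered :: "'n::finite distr set"
  where "tempered = {u \<in> extensional schwartz.
    (\<forall>\<phi>\<in>schwartz. \<forall>\<psi>\<in>schwartz. u (\<lambda>x. \<phi> x + \<psi> x) = u \<phi> + u \<psi>) \<and>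
    (\<forall>c. \<forall>\<phi>\<in>schwartz. u (\<lambda>x. c * \<phi> x) = c * u \<phi>) \<and>
    (\<exists>C N. \<forall>\<phi>\<in>schwartz. norm (u \<phi>) \<le> C * schwartz_norm N \<phi>)}"

definition fourier :: "(real^'n::finite \<Rightarrow> complex) \<Rightarrow> real^'n \<Rightarrow> complex"
  where "fourier \<phi> \<xi> = (LINT x|lborel. cis (- 2 * pi * (x \<bullet> \<xi>)) * \<phi> x)"

definition inv_fourier :: "(real^'n::finite \<Rightarrow> complex) \<Rightarrow> real^'n \<Rightarrow> complex"
  where "inv_fourier \<phi> x = (LINT \<xi>|lborel. cis (2 * pi * (x \<bullet> \<xi>)) * \<phi> \<xi>)"

definition distr_fourier :: "'n::finite distr \<Rightarrow> 'n distr"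
  where "distr_fourier u = (\<lambda>\<phi>\<in>schwartz. u (fourier \<phi>))"

definition distr_inv_fourier :: "'n::finite distr \<Rightarrow> 'n distr"
  where "distr_inv_fourier u = (\<lambda>\<phi>\<in>schwartz. u (inv_fourier \<phi>))"

definition distr_mult :: "(real^'n \<Rightarrow> complex) \<Rightarrow> 'n::finite distr \<Rightarrow> 'n distr"
  where "distr_mult m u = (\<lambda>\<phi>\<in>schwartz. u (\<lambda>x. m x * \<phi> x))"

(* The continuous function that a regular tempered distribution is given by; there is at most
   one. It exists for distributions with compactly supported Fourier transform. *)
definition function_of :: "'n::finite distr \<Rightarrow> real^'n \<Rightarrow> complex"
  where "function_of u = (THE g. continuous_on UNIV g \<and>
    (\<forall>\<phi>\<in>schwartz. integrable lborel (\<lambda>x. g x * \<phi> x) \<and> u \<phi> = (LINT x|lborel. g x * \<phi> x)))"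

definition lattice_pt :: "int^'n \<Rightarrow> real^'n::finite"
  where "lattice_pt k = (\<chi> i. of_int (k $ i))"

(* Smooth bump adapted to the unit cube: "adapted" imposes nothing beyond the three conditions. *)
definition uniform_partition :: "(real^'n::finite \<Rightarrow> complex) \<Rightarrow> bool"
  where "uniform_partition \<sigma> \<longleftrightarrow> smooth \<sigma> \<and>
    (\<forall>\<xi>. (\<exists>i. \<bar>\<xi> $ i\<bar> > 3/4) \<longrightarrow> \<sigma> \<xi> = 0) \<and>
    (\<forall>\<xi>. ((\<lambda>k. \<sigma> (\<xi> - lattice_pt k)) has_sum 1) UNIV)"

definition box_op :: "(real^'n \<Rightarrow> complex) \<Rightarrow> int^'n \<Rightarrow> 'n::finite distr \<Rightarrow> 'n distr"
  where "box_op \<sigma> k f =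
    distr_inv_fourier (distr_mult (\<lambda>\<xi>. \<sigma> (\<xi> - lattice_pt k)) (distr_fourier f))"

(* Intended for r > 0. *)
definition ennreal_powr :: "ennreal \<Rightarrow> real \<Rightarrow> ennreal"
  where "ennreal_powr a r = (if a = top then top else ennreal (enn2real a powr r))"

(* Intended for 0 < p. With the counting measure as M this is the l^p quasi-norm. *)
definition Lp_norm :: "'a measure \<Rightarrow> ereal \<Rightarrow> ('a \<Rightarrow> ennreal) \<Rightarrow> ennreal"
  where "Lp_norm M p f =
    (if p = \<infinity> then esssup M f
     else ennreal_powr (\<integral>\<^sup>+ x. ennreal_powr (f x) (real_of_ereal p) \<partial>M) (1 / real_of_ereal p))"

definition japanese_bracket :: "'a::real_normed_vector \<Rightarrow> real"
  where "japanese_bracket x = sqrt (1 + (norm x)\<^sup>2)"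

definition modulation_norm ::
    "(real^'n \<Rightarrow> complex) \<Rightarrow> ereal \<Rightarrow> ereal \<Rightarrow> real \<Rightarrow> 'n::finite distr \<Rightarrow> ennreal"
  where "modulation_norm \<sigma> p q s f =
    Lp_norm (count_space UNIV) q (\<lambda>k. ennreal (japanese_bracket (lattice_pt k) powr s) *
      Lp_norm lborel p (\<lambda>x. ennreal (norm (function_of (box_op \<sigma> k f) x))))"

definition wiener_amalgam_norm ::
    "(real^'n \<Rightarrow> complex) \<Rightarrow> ereal \<Rightarrow> ereal \<Rightarrow> real \<Rightarrow> 'n::finite distr \<Rightarrow> ennreal"
  where "wiener_amalgam_norm \<sigma> p q s f =
    Lp_norm lborel p (\<lambda>x. Lp_norm (count_space UNIV) q
      (\<lambda>k. ennreal (japanese_bracket (lattice_pt k) powr s) *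
        ennreal (norm (function_of (box_op \<sigma> k f) x))))"

definition modulation_space ::
    "(real^'n \<Rightarrow> complex) \<Rightarrow> ereal \<Rightarrow> ereal \<Rightarrow> real \<Rightarrow> 'n::finite distr set"
  where "modulation_space \<sigma> p q s = {f \<in> tempered. modulation_norm \<sigma> p q s f < top}"

definition wiener_amalgam_space ::
    "(real^'n \<Rightarrow> complex) \<Rightarrow> ereal \<Rightarrow> ereal \<Rightarrow> real \<Rightarrow> 'n::finite distr set"
  where "wiener_amalgam_space \<sigma> p q s = {f \<in> tempered. wiener_amalgam_norm \<sigma> p q s f < top}"

definition continuously_embedded ::
    "'a set \<Rightarrow> ('a \<Rightarrow> ennreal) \<Rightarrow> 'a set \<Rightarrow> ('a \<Rightarrow> ennreal) \<Rightarrow> bool"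
  where "continuously_embedded X normX Y normY \<longleftrightarrow>
    X \<subseteq> Y \<and> (\<exists>C::real. \<forall>f\<in>X. normY f \<le> ennreal C * normX f)"

end

(* Sufficiency: every Box_k f is a continuous function reproduced by convolution with a kernel whose
   modulus does not depend on k. This gives a Bernstein inequality L^p1 -> L^p uniformly in k, so
   that M_{p1,q1}^s embeds into M_{p,r} with r = min(p, q) as soon as the weighted sequence space
   l^{q1}_s embeds into l^r; Tonelli and Minkowski then give M_{p,r} -> W_{p,q}.
   Necessity: sums of modulated bumps sum_k c_k e(k.x) phi(x - x_k), with phi^ supported where the
   partition is trivial, have M-norm comparable to the weighted l^{q1} norm of c, whereas the W-norm
   dominates the l^q norm of c if all x_k = 0 and the l^p norm of c if x_k = k. Hence l^{q1}_s embeds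
   into l^r, which is decided by the divergence of the lattice sum of <k>^{-a} for a <= d. Dilating a
   single bump shows p1 <= p. *)

theory Submission
  imports Defs "HOL-Probability.Characteristic_Functions"
begin

subsection \<open>Schwartz functions\<close>

text \<open>The main obstacle comes before any estimate. \<open>box_op\<close> acts on functionals
  and \<open>function_of\<close> is a definite description, so nothing can be said about |Box_k
  f(x)| until Box_k f is shown to be integration against x -> f(kernel centred at x). This means
  exchanging a tempered distribution, which respects finite sums only, with an integral of test
  functions. Riemann sums with an error of order 1/n in every Schwartz seminorm achieve the
  exchange. The second obstacle is the range of exponents. Below 1 there is neither a triangle
  inequality nor Young's inequality, and the exponent infinity is always a separate case. Norm
  inequalities are therefore reduced by homogeneity to normalised functions, where pointwise
  inequalities between powers replace Hoelder and Minkowski. Only the existence of constants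
  matters, so a factor such as 2 costs nothing. All auxiliary bumps and cut-offs are built from the
  given partition function itself.\<close>

lemma partial_deriv_eqI: "(f has_derivative D) (at x) \<Longrightarrow> partial_deriv i f x = D (axis i 1)"
  unfolding partial_deriv_def by (metis frechet_derivative_at)

lemma iter_deriv_Nil [simp]: "iter_deriv [] f = f"
  by (simp add: iter_deriv_def)

lemma iter_deriv_snoc: "iter_deriv (is @ [i]) f = iter_deriv is (partial_deriv i f)"
  by (simp add: iter_deriv_def)

lemma iter_deriv_Cons: "iter_deriv (i # is) f = partial_deriv i (iter_deriv is f)"
  by (simp add: iter_deriv_def)

text \<open>Membership quantifies over all iterated derivatives. It is enough to exhibit a class
  closed under first partial derivatives whose members are differentiable and rapidly decreasing, so
  each closure property below takes only a first-order computation.\<close>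

lemma schwartz_coinduct:
  assumes "f \<in> A"
    and "\<And>g x. g \<in> A \<Longrightarrow> g differentiable (at x)"
    and "\<And>g i. g \<in> A \<Longrightarrow> partial_deriv i g \<in> A"
    and "\<And>g m. g \<in> A \<Longrightarrow> \<exists>C. \<forall>x. (1 + norm x) ^ m * norm (g x) \<le> C"
  shows "f \<in> schwartz"
proof -
  have "iter_deriv is g \<in> A" if "g \<in> A" for "is" g
    using that
  \<comment> \<open>The last entry of the list is the innermost derivative, so peeling it off
    replaces \<open>g\<close> by another member of \<open>A\<close>.\<close>
  proof (induction "is" arbitrary: g rule: rev_induct)
    case (snoc i "is")
    then show ?case using assms(3) by (auto simp: iter_deriv_snoc)
  qed auto
  then show ?thesis using assms unfolding schwartz_def smooth_def by blast
qed

lemma schwartz_differentiable: "f \<in> schwartz \<Longrightarrow> f differentiable (at x)"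
  unfolding schwartz_def smooth_def by (metis (mono_tags, lifting) iter_deriv_Nil mem_Collect_eq)

lemma schwartz_partial_deriv: "f \<in> schwartz \<Longrightarrow> partial_deriv i f \<in> schwartz"
  unfolding schwartz_def smooth_def by (auto simp flip: iter_deriv_snoc)

lemma schwartz_iter_deriv: "f \<in> schwartz \<Longrightarrow> iter_deriv is f \<in> schwartz"
  by (induction "is") (auto simp: iter_deriv_Cons schwartz_partial_deriv)

lemma schwartz_bounded: "f \<in> schwartz \<Longrightarrow> \<exists>C. \<forall>x. (1 + norm x) ^ m * norm (f x) \<le> C"
  unfolding schwartz_def by (auto dest!: spec[of _ "[]"])

lemma schwartz_decay:
  assumes "f \<in> schwartz"
  obtains C where "C > 0" "\<And>x. norm (f x) \<le> C / (1 + norm x) ^ m"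
proof -
  obtain C where C: "\<And>x. (1 + norm x) ^ m * norm (f x) \<le> C"
    using schwartz_bounded[OF assms] by blast
  have "norm (f x) \<le> max C 1 / (1 + norm x) ^ m" for x
    using C[of x] by (subst pos_le_divide_eq) (auto simp: mult.commute add_pos_nonneg)
  then show ?thesis using that[of "max C 1"] by auto
qed

lemma schwartz_continuous: "f \<in> schwartz \<Longrightarrow> continuous_on S f"
  by (meson schwartz_differentiable continuous_at_imp_continuous_on differentiable_imp_continuous_within)

lemma schwartz_measurable: "f \<in> schwartz \<Longrightarrow> f \<in> borel_measurable borel"
  by (intro borel_measurable_continuous_onI schwartz_continuous)

lemma has_derivative_partial_deriv:
  fixes f :: "real^'n::finite \<Rightarrow> complex"
  assumes "f differentiable (at x)"
  shows "(f has_derivative (\<lambda>h. \<Sum>i\<in>UNIV. h $ i *\<^sub>R partial_deriv i f x)) (at x)"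
proof -
  let ?D = "frechet_derivative f (at x)"
  have D: "(f has_derivative ?D) (at x)"
    using assms frechet_derivative_works by blast
  interpret bounded_linear ?D by (rule has_derivative_bounded_linear[OF D])
  have "?D h = (\<Sum>i\<in>UNIV. h $ i *\<^sub>R partial_deriv i f x)" for h
  proof -
    have "?D h = ?D (\<Sum>i\<in>UNIV. h $ i *\<^sub>R axis i 1)"
      using basis_expansion[of h] by (simp add: scalar_mult_eq_scaleR)
    then show ?thesis by (simp add: sum scale partial_deriv_def)
  qed
  then have "?D = (\<lambda>h. \<Sum>i\<in>UNIV. h $ i *\<^sub>R partial_deriv i f x)" by (rule ext)
  then show ?thesis using D by simp
qed

text \<open>Submultiplicativity of the weight 1 + |x|. It is what later turns decay in a difference
  x - y into decay in y at the price of growth in x.\<close>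

lemma one_plus_norm_le_mult:
  fixes x y :: "'a::real_normed_vector"
  shows "1 + norm (x + y) \<le> (1 + norm x) * (1 + norm y)"
proof -
  have "0 \<le> norm x * norm y" by simp
  moreover have "(1 + norm x) * (1 + norm y) = 1 + (norm x + norm y) + norm x * norm y"
    by (simp add: algebra_simps)
  ultimately show ?thesis using norm_triangle_ineq[of x y] by linarith
qed

lemma one_plus_norm_diff_le:
  fixes x y :: "'a::real_normed_vector"
  shows "1 + norm x \<le> (1 + norm (x - y)) * (1 + norm y)"
  using one_plus_norm_le_mult[of "x - y" y] by simp

text \<open>Mean value inequality on the unit ball about \<open>x\<close>. For z in this ball 1 +
  |x| is at most 2 (1 + |z|), which is the source of \<open>2 ^ m\<close> in the constant. The
  retained decay makes difference quotients dominated and Riemann sums convergent.\<close>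

lemma schwartz_lipschitz:
  fixes f :: "real^'n::finite \<Rightarrow> complex"
  assumes "f \<in> schwartz"
  obtains C where "C > 0"
    "\<And>x y. norm (x - y) \<le> 1 \<Longrightarrow> norm (f x - f y) \<le> C * norm (x - y) / (1 + norm x) ^ m"
proof -
  have "\<forall>i. \<exists>C>0. \<forall>x. norm (partial_deriv i f x) \<le> C / (1 + norm x) ^ m"
    using schwartz_decay[OF schwartz_partial_deriv[OF assms]] by metis
  then obtain c where c: "\<And>i. c i > 0" "\<And>i x. norm (partial_deriv i f x) \<le> c i / (1 + norm x) ^ m"
    by metis
  let ?C = "(\<Sum>i\<in>UNIV. c i) * 2 ^ m"
  have "norm (f x - f y) \<le> ?C * norm (x - y) / (1 + norm x) ^ m" if "norm (x - y) \<le> 1" for x y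
  proof -
    have "norm (f x - f y) \<le> (?C / (1 + norm x) ^ m) * norm (x - y)"
    proof (rule differentiable_bound)
      show "convex (cball x 1)" by simp
      show "y \<in> cball x 1" "x \<in> cball x 1" using that by (auto simp: dist_norm)
      show "(f has_derivative (\<lambda>h. \<Sum>i\<in>UNIV. h $ i *\<^sub>R partial_deriv i f z)) (at z within cball x 1)" for z
        using has_derivative_partial_deriv[OF schwartz_differentiable[OF assms]] has_derivative_at_withinI by blast
      fix z assume "z \<in> cball x 1"
      then have "norm (x - z) \<le> 1" by (simp add: dist_norm)
      from this have nx: "norm x \<le> 1 + norm z" using norm_triangle_ineq2[of x z] by simp
      have z: "(1 + norm x) ^ m \<le> (2 * (1 + norm z)) ^ m"
      proof (rule power_mono)
        have "0 \<le> norm z" by (rule norm_ge_zero)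
        with nx show "1 + norm x \<le> 2 * (1 + norm z)" unfolding distrib_left by linarith
      qed simp
      show "onorm (\<lambda>h. \<Sum>i\<in>UNIV. h $ i *\<^sub>R partial_deriv i f z) \<le> ?C / (1 + norm x) ^ m"
      proof (rule onorm_bound)
        show "0 \<le> ?C / (1 + norm x) ^ m" by (intro divide_nonneg_nonneg mult_nonneg_nonneg sum_nonneg zero_le_power less_imp_le[OF c(1)]) auto
        fix h :: "real^'n"
        have "norm (\<Sum>i\<in>UNIV. h $ i *\<^sub>R partial_deriv i f z) \<le> (\<Sum>i\<in>UNIV. norm h * (c i * (2 ^ m / (1 + norm x) ^ m)))"
        proof (intro sum_norm_le)
          fix i
          have "norm (partial_deriv i f z) \<le> c i * (1 / (1 + norm z) ^ m)" using c(2)[of i z] by simp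
          also have "\<dots> \<le> c i * (2 ^ m / (1 + norm x) ^ m)"
          proof (rule mult_left_mono)
            have "0 < (1 + norm x) ^ m" "0 < (1 + norm z) ^ m" by (simp_all add: add_pos_nonneg)
            then show "1 / (1 + norm z) ^ m \<le> 2 ^ m / (1 + norm x) ^ m"
              using z unfolding power_mult_distrib by (simp add: field_simps)
          qed (use c(1)[of i] in simp)
          finally show "norm (h $ i *\<^sub>R partial_deriv i f z) \<le> norm h * (c i * (2 ^ m / (1 + norm x) ^ m))"
            unfolding norm_scaleR using component_le_norm_cart[of h i] by (intro mult_mono) auto
        qed
        also have "\<dots> = ?C / (1 + norm x) ^ m * norm h"
          by (simp add: sum_distrib_left sum_distrib_right mult_ac sum_divide_distrib)
        finally show "norm (\<Sum>i\<in>UNIV. h $ i *\<^sub>R partial_deriv i f z) \<le> ?C / (1 + norm x) ^ m * norm h" .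
      qed
    qed
    then show ?thesis by simp
  qed
  moreover have "?C > 0" using c(1) by (simp add: sum_pos)
  ultimately show ?thesis using that by blast
qed

section \<open>Closure properties of the Schwartz space\<close>

lemma schwartz_add:
  fixes f g :: "real^'n::finite \<Rightarrow> complex"
  assumes "f \<in> schwartz" "g \<in> schwartz"
  shows "(\<lambda>x. f x + g x) \<in> schwartz"
proof -
  let ?A = "{\<lambda>x. f x + g x | f g. f \<in> schwartz \<and> g \<in> schwartz}"
  show ?thesis
  proof (rule schwartz_coinduct[where A = ?A])
    show "(\<lambda>x. f x + g x) \<in> ?A"
      using assms by blast
  next
    fix h :: "real^'n \<Rightarrow> complex" and x
    assume "h \<in> ?A"
    then show "h differentiable at x" by (auto intro: differentiable_add schwartz_differentiable)
  next
    fix h :: "real^'n \<Rightarrow> complex" and i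
    assume "h \<in> ?A"
    then obtain f g where h: "h = (\<lambda>x. f x + g x)" and fg: "f \<in> schwartz" "g \<in> schwartz" by blast
    have "partial_deriv i h x = partial_deriv i f x + partial_deriv i g x" for x
      unfolding h
      using has_derivative_add[OF fg[THEN schwartz_differentiable, THEN frechet_derivative_works[THEN iffD1]]]
      by (subst partial_deriv_eqI) (auto simp: partial_deriv_def)
    then show "partial_deriv i h \<in> ?A"
      using fg schwartz_partial_deriv by blast
  next
    fix h :: "real^'n \<Rightarrow> complex" and m
    assume "h \<in> ?A"
    then obtain f g where h: "h = (\<lambda>x. f x + g x)" and fg: "f \<in> schwartz" "g \<in> schwartz" by blast
    obtain C D where "\<And>x. (1 + norm x) ^ m * norm (f x) \<le> C" "\<And>x. (1 + norm x) ^ m * norm (g x) \<le> D"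
      using fg schwartz_bounded by metis
    then have "(1 + norm x) ^ m * norm (h x) \<le> C + D" for x
      unfolding h using mult_left_mono[OF norm_triangle_ineq[of "f x" "g x"], of "(1 + norm x) ^ m"]
      by (simp add: distrib_left) (smt (verit, ccfv_threshold))
    then show "\<exists>C. \<forall>x. (1 + norm x) ^ m * norm (h x) \<le> C" by blast
  qed
qed

lemma schwartz_affine:
  fixes f :: "real^'n::finite \<Rightarrow> complex"
  assumes "f \<in> schwartz" "c \<noteq> 0"
  shows "(\<lambda>x. b * f (a + c *\<^sub>R x)) \<in> schwartz"
proof -
  \<comment> \<open>The factor \<open>b\<close> has to vary over the class because every derivative
    contributes a factor \<open>c\<close>.\<close>
  let ?A = "{\<lambda>x. b * f (a + c *\<^sub>R x) | b f. f \<in> schwartz}"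
  show ?thesis
  proof (rule schwartz_coinduct[where A = ?A])
    show "(\<lambda>x. b * f (a + c *\<^sub>R x)) \<in> ?A"
      using assms by blast
  next
    fix h :: "real^'n \<Rightarrow> complex"
    assume "h \<in> ?A"
    then obtain b f where h: "h = (\<lambda>x. b * f (a + c *\<^sub>R x))" and f: "f \<in> schwartz" by blast
    have D: "(h has_derivative (\<lambda>y. b * frechet_derivative f (at (a + c *\<^sub>R x)) (c *\<^sub>R y))) (at x)" for x
    proof -
      have "((\<lambda>x. a + c *\<^sub>R x) has_derivative (\<lambda>y. c *\<^sub>R y)) (at x)"
        by (auto intro!: derivative_eq_intros)
      from has_derivative_compose[OF this frechet_derivative_works[THEN iffD1, OF schwartz_differentiable[OF f]]]
      show ?thesis unfolding h by (intro has_derivative_mult_right)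
    qed
    show "h differentiable at x" for x using D differentiableI by blast
    have "partial_deriv i h x = (b * of_real c) * partial_deriv i f (a + c *\<^sub>R x)" for i x
      using linear_scale[OF linear_frechet_derivative[OF schwartz_differentiable[OF f]]]
      by (subst partial_deriv_eqI[OF D]) (simp add: partial_deriv_def scaleR_conv_of_real)
    then show "partial_deriv i h \<in> ?A" for i
      using f schwartz_partial_deriv by blast
    fix m
    obtain C where C: "\<And>x. (1 + norm x) ^ m * norm (f x) \<le> C"
      using f schwartz_bounded by metis
    \<comment> \<open>The cost of undoing the affine map in the weight: the first factor pays for
      the shift, the second for the dilation.\<close>
    let ?k = "(1 + norm a) * (1 + 1 / \<bar>c\<bar>)"
    have k: "1 + norm x \<le> ?k * (1 + norm (a + c *\<^sub>R x))" for x
    proof -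
      have 1: "1 + norm (c *\<^sub>R x) \<le> (1 + norm (a + c *\<^sub>R x)) * (1 + norm a)"
        using one_plus_norm_le_mult[of "a + c *\<^sub>R x" "-a"] by simp
      have "1 + norm x \<le> (1 + 1 / \<bar>c\<bar>) * (1 + norm (c *\<^sub>R x))"
        using assms(2) by (simp add: field_simps)
      also have "\<dots> \<le> (1 + 1 / \<bar>c\<bar>) * ((1 + norm (a + c *\<^sub>R x)) * (1 + norm a))"
        by (intro mult_left_mono 1) auto
      finally show ?thesis by (simp add: mult_ac)
    qed
    have "(1 + norm x) ^ m * norm (h x) \<le> ?k ^ m * norm b * C" for x
    proof -
      have "(1 + norm x) ^ m * norm (h x) \<le> (?k * (1 + norm (a + c *\<^sub>R x))) ^ m * norm (h x)"
        by (intro mult_right_mono power_mono k) auto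
      also have "\<dots> = ?k ^ m * norm b * ((1 + norm (a + c *\<^sub>R x)) ^ m * norm (f (a + c *\<^sub>R x)))"
        unfolding h by (simp add: norm_mult power_mult_distrib)
      also have "\<dots> \<le> ?k ^ m * norm b * C"
        by (intro mult_left_mono C) auto
      finally show ?thesis .
    qed
    then show "\<exists>C. \<forall>x. (1 + norm x) ^ m * norm (h x) \<le> C" by blast
  qed
qed

lemma schwartz_scale: "f \<in> schwartz \<Longrightarrow> (\<lambda>x. b * f x) \<in> schwartz"
  using schwartz_affine[of f 1 b 0] by simp

lemma schwartz_translate: "f \<in> schwartz \<Longrightarrow> (\<lambda>x. f (x - a)) \<in> schwartz"
  using schwartz_affine[of f 1 1 "-a"] by simp

lemma schwartz_reflect: "f \<in> schwartz \<Longrightarrow> (\<lambda>x. f (a - x)) \<in> schwartz"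
  using schwartz_affine[of f "-1" 1 "a"] by simp

lemma schwartz_zero: "(\<lambda>x::real^'a::finite. 0) \<in> schwartz"
proof (rule schwartz_coinduct[where A = "{\<lambda>x. 0}"])
  show "partial_deriv i g \<in> {\<lambda>x. 0}" if "g \<in> {\<lambda>x. 0}" for g :: "real^'a \<Rightarrow> complex" and i
  proof -
    have "g = (\<lambda>x. 0)" using that by blast
    then show ?thesis by (auto simp: partial_deriv_eqI[OF has_derivative_const])
  qed
qed auto

lemma schwartz_sum: "(\<And>i. i \<in> I \<Longrightarrow> f i \<in> schwartz) \<Longrightarrow> (\<lambda>x. \<Sum>i\<in>I. f i x) \<in> schwartz"
  by (induction I rule: infinite_finite_induct) (auto intro: schwartz_zero schwartz_add)

text \<open>By the Leibniz rule single products are not closed under differentiation, whereas finite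
  sums of products are.\<close>

inductive_set schwartz_products :: "(real^'n::finite \<Rightarrow> complex) set" where
  "f \<in> schwartz \<Longrightarrow> g \<in> schwartz \<Longrightarrow> (\<lambda>x. f x * g x) \<in> schwartz_products"
| "f \<in> schwartz_products \<Longrightarrow> g \<in> schwartz_products \<Longrightarrow> (\<lambda>x. f x + g x) \<in> schwartz_products"

lemma schwartz_mult:
  fixes f g :: "real^'n::finite \<Rightarrow> complex"
  assumes "f \<in> schwartz" "g \<in> schwartz"
  shows "(\<lambda>x. f x * g x) \<in> schwartz"
proof (rule schwartz_coinduct[where A = schwartz_products])
  show "(\<lambda>x. f x * g x) \<in> schwartz_products" using assms schwartz_products.intros by blast
next
  fix h :: "real^'n \<Rightarrow> complex" and x assume "h \<in> schwartz_products"
  then show "h differentiable at x"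
    by induction (auto intro: differentiable_mult differentiable_add schwartz_differentiable)
next
  fix h :: "real^'n \<Rightarrow> complex" and i assume "h \<in> schwartz_products"
  then have "(\<forall>x. h differentiable at x) \<and> partial_deriv i h \<in> schwartz_products"
  proof induction
    case (1 f g)
    have "partial_deriv i (\<lambda>x. f x * g x) = (\<lambda>x. f x * partial_deriv i g x + partial_deriv i f x * g x)"
      using has_derivative_mult[OF 1[THEN schwartz_differentiable, THEN frechet_derivative_works[THEN iffD1]]]
      by (intro ext, subst partial_deriv_eqI) (auto simp: partial_deriv_def)
    then show ?case using 1
      by (auto intro!: schwartz_products.intros schwartz_partial_deriv intro: differentiable_mult schwartz_differentiable)
  next
    case (2 f g)
    then have "partial_deriv i (\<lambda>x. f x + g x) = (\<lambda>x. partial_deriv i f x + partial_deriv i g x)"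
      by (intro ext, subst partial_deriv_eqI[OF has_derivative_add])
         (auto simp: partial_deriv_def frechet_derivative_works[symmetric])
    then show ?case using 2 by (auto intro!: schwartz_products.intros(2))
  qed
  then show "partial_deriv i h \<in> schwartz_products" by blast
next
  fix h :: "real^'n \<Rightarrow> complex" and m assume "h \<in> schwartz_products"
  then show "\<exists>C. \<forall>x. (1 + norm x) ^ m * norm (h x) \<le> C"
  proof induction
    case (1 f g)
    obtain C where C: "\<And>x. (1 + norm x) ^ m * norm (f x) \<le> C"
      using 1 schwartz_bounded by metis
    obtain D where D: "\<And>x. norm (g x) \<le> D"
      using schwartz_bounded[OF 1(2), of 0] by auto
    have "(1 + norm x) ^ m * norm (f x * g x) \<le> C * D" for x
      using mult_mono[OF C[of x] D[of x]] order_trans[OF _ C[of x]]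
      by (simp add: norm_mult mult.assoc)
    then show ?case by blast
  next
    case (2 f g)
    then obtain C D where "\<And>x. (1 + norm x) ^ m * norm (f x) \<le> C" "\<And>x. (1 + norm x) ^ m * norm (g x) \<le> D"
      by metis
    then have "(1 + norm x) ^ m * norm (f x + g x) \<le> C + D" for x
      using mult_left_mono[OF norm_triangle_ineq[of "f x" "g x"], of "(1 + norm x) ^ m"]
      by (simp add: distrib_left) (smt (verit, ccfv_threshold))
    then show ?case by blast
  qed
qed

lemma schwartz_coord_mult:
  fixes f :: "real^'n::finite \<Rightarrow> complex"
  assumes "f \<in> schwartz"
  shows "(\<lambda>x. of_real (x $ i) * f x) \<in> schwartz"
proof -
  \<comment> \<open>The summand \<open>g\<close> absorbs the term that arises when the product rule
    differentiates the coordinate itself.\<close>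
  let ?A = "{\<lambda>x. of_real (x $ i) * f x + g x | f g. f \<in> schwartz \<and> g \<in> schwartz}"
  show ?thesis
  proof (rule schwartz_coinduct[where A = ?A])
    show "(\<lambda>x. of_real (x $ i) * f x) \<in> ?A"
      using assms schwartz_zero by force
  next
    fix h :: "real^'n \<Rightarrow> complex"
    assume "h \<in> ?A"
    then obtain f g where h: "h = (\<lambda>x. of_real (x $ i) * f x + g x)" and fg: "f \<in> schwartz" "g \<in> schwartz" by blast
    have D: "(h has_derivative (\<lambda>y. (of_real (x $ i) * frechet_derivative f (at x) y + of_real (y $ i) * f x) + frechet_derivative g (at x) y)) (at x)" for x
    proof -
      have "((\<lambda>x::real^'n. complex_of_real (x $ i)) has_derivative (\<lambda>y. of_real (y $ i))) (at x)"
        by (intro has_derivative_of_real bounded_linear.has_derivative[OF bounded_linear_vec_nth] has_derivative_ident)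
      then show ?thesis unfolding h
        by (intro has_derivative_add has_derivative_mult)
           (use fg schwartz_differentiable frechet_derivative_works in blast)+
    qed
    show "h differentiable at x" for x using D differentiableI by blast
    show "partial_deriv j h \<in> ?A" for j
    proof -
      have "partial_deriv j h = (\<lambda>x. of_real (x $ i) * partial_deriv j f x + (of_real (axis j 1 $ i) * f x + partial_deriv j g x))"
        by (intro ext, subst partial_deriv_eqI[OF D]) (simp add: partial_deriv_def)
      moreover have "(\<lambda>x. of_real (axis j 1 $ i) * f x + partial_deriv j g x) \<in> schwartz"
        by (intro schwartz_add schwartz_scale schwartz_partial_deriv fg)
      ultimately show ?thesis using schwartz_partial_deriv[OF fg(1), of j]
        by (intro CollectI exI[of _ "partial_deriv j f"] exI conjI)
    qed
    fix m
    \<comment> \<open>One power more than requested, to be spent on the coordinate factor.\<close>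
    obtain C where C: "\<And>x. (1 + norm x) ^ Suc m * norm (f x) \<le> C"
      using fg schwartz_bounded by metis
    obtain D where D: "\<And>x. (1 + norm x) ^ m * norm (g x) \<le> D"
      using fg schwartz_bounded by metis
    have "(1 + norm x) ^ m * norm (h x) \<le> C + D" for x
    proof -
      have "norm (h x) \<le> (1 + norm x) * norm (f x) + norm (g x)"
        unfolding h using component_le_norm_cart[of x i]
        by (intro norm_triangle_mono) (auto simp: norm_mult intro!: mult_right_mono)
      then have "(1 + norm x) ^ m * norm (h x) \<le> (1 + norm x) ^ m * ((1 + norm x) * norm (f x) + norm (g x))"
        by (intro mult_left_mono) auto
      also have "\<dots> \<le> C + D" using add_mono[OF C[of x] D[of x]] by (simp add: algebra_simps)
      finally show ?thesis .
    qed
    then show "\<exists>C. \<forall>x. (1 + norm x) ^ m * norm (h x) \<le> C" by blast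
  qed
qed

lemma has_derivative_cis_inner:
  fixes a :: "'a::real_inner"
  shows "((\<lambda>x. cis (x \<bullet> a)) has_derivative (\<lambda>y. cis (x \<bullet> a) * (\<i> * of_real (y \<bullet> a)))) (at x)"
  by (rule has_derivative_eq_rhs[OF has_derivative_cis[OF has_derivative_inner_left[OF has_derivative_ident]]])
     (simp add: fun_eq_iff scaleR_conv_of_real mult_ac)

lemma schwartz_modulate:
  fixes f :: "real^'n::finite \<Rightarrow> complex"
  assumes "f \<in> schwartz"
  shows "(\<lambda>x. cis (x \<bullet> a) * f x) \<in> schwartz"
proof -
  let ?A = "{\<lambda>x. cis (x \<bullet> a) * f x | f. f \<in> schwartz}"
  show ?thesis
  proof (rule schwartz_coinduct[where A = ?A])
    show "(\<lambda>x. cis (x \<bullet> a) * f x) \<in> ?A"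
      using assms by blast
  next
    fix h :: "real^'n \<Rightarrow> complex"
    assume "h \<in> ?A"
    then obtain f where h: "h = (\<lambda>x. cis (x \<bullet> a) * f x)" and f: "f \<in> schwartz" by blast
    have D: "(h has_derivative (\<lambda>y. cis (x \<bullet> a) * frechet_derivative f (at x) y + (cis (x \<bullet> a) * (\<i> * of_real (y \<bullet> a))) * f x)) (at x)" for x
      unfolding h
      by (intro has_derivative_mult has_derivative_cis_inner)
         (use f schwartz_differentiable frechet_derivative_works in blast)
    show "h differentiable at x" for x using D differentiableI by blast
    show "partial_deriv j h \<in> ?A" for j
    proof -
      have "partial_deriv j h = (\<lambda>x. cis (x \<bullet> a) * (partial_deriv j f x + (\<i> * of_real (axis j 1 \<bullet> a)) * f x))"
        by (intro ext, subst partial_deriv_eqI[OF D]) (simp add: partial_deriv_def algebra_simps)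
      moreover have "(\<lambda>x. partial_deriv j f x + (\<i> * of_real (axis j 1 \<bullet> a)) * f x) \<in> schwartz"
        by (intro schwartz_add schwartz_scale schwartz_partial_deriv f)
      ultimately show ?thesis
        by (intro CollectI exI[of _ "\<lambda>x. partial_deriv j f x + (\<i> * of_real (axis j 1 \<bullet> a)) * f x"] conjI)
    qed
    show "\<exists>C. \<forall>x. (1 + norm x) ^ m * norm (h x) \<le> C" for m
      using schwartz_bounded[OF f] by (simp add: h norm_mult)
  qed
qed

lemma schwartz_cnj:
  fixes f :: "real^'n::finite \<Rightarrow> complex"
  assumes "f \<in> schwartz"
  shows "(\<lambda>x. cnj (f x)) \<in> schwartz"
proof -
  let ?A = "{\<lambda>x. cnj (f x) | f. f \<in> schwartz}"
  show ?thesis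
  proof (rule schwartz_coinduct[where A = ?A])
    show "(\<lambda>x. cnj (f x)) \<in> ?A"
      using assms by blast
  next
    fix h :: "real^'n \<Rightarrow> complex"
    assume "h \<in> ?A"
    then obtain f where h: "h = (\<lambda>x. cnj (f x))" and f: "f \<in> schwartz" by blast
    have D: "(h has_derivative (\<lambda>y. cnj (frechet_derivative f (at x) y))) (at x)" for x
      unfolding h
      by (intro bounded_linear.has_derivative[OF bounded_linear_cnj])
         (use f schwartz_differentiable frechet_derivative_works in blast)
    show "h differentiable at x" for x using D differentiableI by blast
    show "partial_deriv j h \<in> ?A" for j
    proof -
      have "partial_deriv j h = (\<lambda>x. cnj (partial_deriv j f x))"
        by (intro ext, subst partial_deriv_eqI[OF D]) (simp add: partial_deriv_def algebra_simps)
      then show ?thesis using f schwartz_partial_deriv by blast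
    qed
    show "\<exists>C. \<forall>x. (1 + norm x) ^ m * norm (h x) \<le> C" for m
      using schwartz_bounded[OF f] by (simp add: h norm_mult)
  qed
qed

text \<open>The condition |x_i| > r is open, so a function vanishing there has derivatives vanishing
  there. On the remaining cube continuity and compactness give every weighted bound.\<close>

lemma schwartz_compact_support:
  fixes f :: "real^'n::finite \<Rightarrow> complex"
  assumes "smooth f" and "\<And>x. \<exists>i. \<bar>x $ i\<bar> > r \<Longrightarrow> f x = 0"
  shows "f \<in> schwartz"
proof -
  let ?A = "{f. smooth f \<and> (\<forall>x. (\<exists>i. \<bar>x $ i\<bar> > r) \<longrightarrow> f x = 0)}"
  show ?thesis
  proof (rule schwartz_coinduct[where A = ?A])
    show "f \<in> ?A"
      using assms by blast
  next
    fix h :: "real^'n \<Rightarrow> complex"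
    assume "h \<in> ?A"
    then have h: "smooth h" and 0: "\<And>x i. \<bar>x $ i\<bar> > r \<Longrightarrow> h x = 0" by auto
    show d: "h differentiable at x" for x using h unfolding smooth_def by (metis iter_deriv_Nil)
    have "partial_deriv j h x = 0" if "\<bar>x $ i\<bar> > r" for x i j
    proof -
      have "open {x::real^'n. \<bar>x $ i\<bar> > r}"
        by (intro open_Collect_less continuous_intros)
      then have "(h has_derivative (\<lambda>_. 0)) (at x)"
        by (rule has_derivative_transform_within_open[OF has_derivative_const]) (use that in \<open>auto simp: 0\<close>)
      then show ?thesis by (simp add: partial_deriv_eqI)
    qed
    moreover have "smooth (partial_deriv j h)" for j
      using h unfolding smooth_def by (auto simp flip: iter_deriv_snoc)
    ultimately show "partial_deriv j h \<in> ?A" for j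
      by blast
    fix m
    let ?K = "cbox (\<chi> i. - r) (\<chi> i. r) :: (real^'n) set"
    have "continuous_on ?K (\<lambda>x. (1 + norm x) ^ m * norm (h x))"
      by (intro continuous_intros continuous_at_imp_continuous_on) (use d differentiable_imp_continuous_within in auto)
    then have "bounded ((\<lambda>x. (1 + norm x) ^ m * norm (h x)) ` ?K)"
      by (intro compact_imp_bounded compact_continuous_image) auto
    then obtain C where C: "\<And>x. x \<in> ?K \<Longrightarrow> (1 + norm x) ^ m * norm (h x) \<le> C"
      unfolding bounded_iff by (auto simp: abs_mult)
    have "(1 + norm x) ^ m * norm (h x) \<le> max C 0" for x
    proof (cases "x \<in> ?K")
      case False
      then obtain i where "\<bar>x $ i\<bar> > r" by (auto simp: mem_box_cart abs_le_iff not_le) (smt (verit))+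
      then show ?thesis using 0 by simp
    qed (use C le_max_iff_disj in blast)
    then show "\<exists>C. \<forall>x. (1 + norm x) ^ m * norm (h x) \<le> C" by blast
  qed
qed

subsection \<open>Integrability\<close>

text \<open>Where the integer part of |x| is n, the integrand is at most (n+1)^-M, and the ball of
  radius n+1 has volume proportional to (n+1)^d. The two surplus powers leave the convergent series
  of 1/(n+1)^2.\<close>

lemma nn_integral_decay_finite:
  fixes M :: nat
  assumes "M \<ge> DIM('a) + 2"
  shows "(\<integral>\<^sup>+ (x::'a::euclidean_space). ennreal (1 / (1 + norm x) ^ M) \<partial>lborel) < top"
proof -
  let ?d = "DIM('a)"
  have "ennreal (1 / (1 + norm x) ^ M) \<le> (\<Sum>n. ennreal (1 / real (Suc n) ^ M) * indicator (ball 0 (real (Suc n))) x)" for x :: 'a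
  proof -
    define n where "n = nat \<lfloor>norm x\<rfloor>"
    have n: "real n \<le> norm x" "norm x < real (Suc n)"
      unfolding n_def by (auto, linarith)
    have "ennreal (1 / (1 + norm x) ^ M) \<le> ennreal (1 / real (Suc n) ^ M) * indicator (ball 0 (real (Suc n))) x"
    proof -
      have "1 / (1 + norm x) ^ M \<le> 1 / real (Suc n) ^ M"
        using n by (intro divide_left_mono power_mono mult_pos_pos zero_less_power add_pos_nonneg) auto
      then show ?thesis using n by (simp add: ennreal_leI)
    qed
    also have "\<dots> \<le> (\<Sum>n. ennreal (1 / real (Suc n) ^ M) * indicator (ball 0 (real (Suc n))) x)"
      (is "?F n \<le> _")
    proof -
      have "sum ?F {n} \<le> suminf ?F" by (intro sum_le_suminf summableI) auto
      then show ?thesis by (simp only: sum.insert_if sum.empty finite.emptyI empty_iff if_False add_0_right)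
    qed
    finally show ?thesis .
  qed
  then have "(\<integral>\<^sup>+ (x::'a). ennreal (1 / (1 + norm x) ^ M) \<partial>lborel)
    \<le> (\<integral>\<^sup>+ (x::'a). (\<Sum>n. ennreal (1 / real (Suc n) ^ M) * indicator (ball 0 (real (Suc n))) x) \<partial>lborel)"
    by (intro nn_integral_mono) auto
  also have "\<dots> = (\<Sum>n. ennreal (1 / real (Suc n) ^ M) * emeasure lborel (ball (0::'a) (real (Suc n))))"
  proof (subst nn_integral_suminf)
    show "(\<lambda>x::'a. ennreal (1 / real (Suc n) ^ M) * indicator (ball 0 (real (Suc n))) x) \<in> borel_measurable lborel" for n
    proof -
      have [measurable]: "ball (0::'a) (real (Suc n)) \<in> sets borel" by simp
      show ?thesis unfolding measurable_lborel2 by measurable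
    qed
  qed (simp add: nn_integral_cmult_indicator)
  also have "\<dots> = (\<Sum>n. ennreal (1 / real (Suc n) ^ M * (unit_ball_vol (real ?d) * real (Suc n) ^ ?d)))"
    by (intro suminf_cong) (simp add: emeasure_ball ennreal_mult[symmetric] del: of_nat_Suc)
  also have "\<dots> \<le> (\<Sum>n. ennreal (unit_ball_vol (real ?d) * (1 / real (Suc n) ^ 2)))"
  proof (intro suminf_le allI ennreal_leI summableI)
    fix n
    have "real (Suc n) ^ (?d + 2) \<le> real (Suc n) ^ M"
      using assms by (intro power_increasing) auto
    then have "1 / real (Suc n) ^ M * real (Suc n) ^ ?d \<le> 1 / real (Suc n) ^ 2"
      by (simp add: divide_simps del: of_nat_Suc) (simp add: power_add power2_eq_square mult_ac del: of_nat_Suc)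
    then show "1 / real (Suc n) ^ M * (unit_ball_vol (real ?d) * real (Suc n) ^ ?d) \<le> unit_ball_vol (real ?d) * (1 / real (Suc n) ^ 2)"
      using mult_left_mono[of "1 / real (Suc n) ^ M * real (Suc n) ^ ?d" "1 / real (Suc n) ^ 2" "unit_ball_vol (real ?d)"]
      by (simp add: mult_ac)
  qed
  also have "\<dots> = ennreal (\<Sum>n. unit_ball_vol (real ?d) * (1 / real (Suc n) ^ 2))"
  proof (rule suminf_ennreal2)
    have "summable (\<lambda>n. inverse (real (Suc n) ^ 2))"
      using inverse_power_summable[of 2, where 'a=real] by (subst summable_Suc_iff) auto
    then show "summable (\<lambda>n. unit_ball_vol (real ?d) * (1 / real (Suc n) ^ 2))"
      by (intro summable_mult) (simp add: inverse_eq_divide)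
  qed auto
  finally show ?thesis using ennreal_less_top order_le_less_trans by blast
qed

lemma integrable_decay:
  fixes M :: nat
  assumes "M \<ge> DIM('a) + 2"
  shows "integrable lborel (\<lambda>x::'a::euclidean_space. 1 / (1 + norm x) ^ M)"
proof (rule integrableI_nonneg)
  show "(\<lambda>x::'a. 1 / (1 + norm x) ^ M) \<in> borel_measurable lborel" by measurable
qed (use nn_integral_decay_finite[OF assms] in auto)

lemma integrable_decay_bound:
  fixes f :: "'a::euclidean_space \<Rightarrow> 'b::{banach, second_countable_topology}"
  assumes "f \<in> borel_measurable borel" "\<And>x. norm (f x) \<le> C / (1 + norm x) ^ (DIM('a) + 2)"
  shows "integrable lborel f"
proof (rule Bochner_Integration.integrable_bound)
  show "integrable lborel (\<lambda>x::'a. C * (1 / (1 + norm x) ^ (DIM('a) + 2)))"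
    by (intro integrable_mult_right integrable_decay) auto
  have "norm (f x) \<le> norm (C * (1 / (1 + norm x) ^ (DIM('a) + 2)))" for x
    using order_trans[OF assms(2)[of x] abs_ge_self] by simp
  then show "AE x in lborel. norm (f x) \<le> norm (C * (1 / (1 + norm x) ^ (DIM('a) + 2)))"
    by (intro AE_I2) blast
qed (use assms in simp)

definition poly_growth :: "(real^'n::finite \<Rightarrow> complex) \<Rightarrow> bool"
  where "poly_growth g \<longleftrightarrow> (\<exists>C N. \<forall>x. norm (g x) \<le> C * (1 + norm x) ^ N)"

lemma schwartz_poly_decay:
  fixes f g :: "real^'n::finite \<Rightarrow> complex"
  assumes "poly_growth g" "f \<in> schwartz"
  obtains C where "\<And>x. norm (g x * f x) \<le> C / (1 + norm x) ^ m"
proof -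
  obtain C N where C: "\<And>x. norm (g x) \<le> C * (1 + norm x) ^ N"
    using assms(1) unfolding poly_growth_def by blast
  have "C \<ge> 0" using order_trans[OF norm_ge_zero C[of 0]] by simp
  obtain D where D: "\<And>x. norm (f x) \<le> D / (1 + norm x) ^ (N + m)" using schwartz_decay[OF assms(2)] by metis
  have "norm (g x * f x) \<le> (C * D) / (1 + norm x) ^ m" for x
  proof -
    have "norm (g x * f x) \<le> (C * (1 + norm x) ^ N) * (D / (1 + norm x) ^ (N + m))"
      unfolding norm_mult using \<open>C \<ge> 0\<close> by (intro mult_mono C D) auto
    moreover have "1 + norm x \<noteq> 0" using norm_ge_zero[of x] by linarith
    ultimately show ?thesis by (simp add: power_add)
  qed
  then show ?thesis using that by blast
qed

lemma schwartz_integrable_poly: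
  fixes f g :: "real^'n::finite \<Rightarrow> complex"
  assumes "g \<in> borel_measurable borel" "poly_growth g" "f \<in> schwartz"
  shows "integrable lborel (\<lambda>x. g x * f x)"
proof -
  have [measurable]: "f \<in> borel_measurable borel" using assms schwartz_measurable by blast
  note assms(1)[measurable]
  obtain C where "\<And>x. norm (g x * f x) \<le> C / (1 + norm x) ^ (DIM(real^'n) + 2)"
    using schwartz_poly_decay[OF assms(2,3)] by metis
  then show ?thesis by (intro integrable_decay_bound) auto
qed

lemma poly_growth_bounded: "(\<And>x. norm (g x) \<le> C) \<Longrightarrow> poly_growth g"
  unfolding poly_growth_def by (rule exI[of _ C], rule exI[of _ 0]) simp

lemma schwartz_integrable:
  fixes f :: "real^'n::finite \<Rightarrow> complex"
  shows "f \<in> schwartz \<Longrightarrow> integrable lborel f"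
  using schwartz_integrable_poly[of "\<lambda>_. 1" f] poly_growth_bounded[of "\<lambda>_. 1" 1] by simp

subsection \<open>The Fourier transform on Schwartz functions\<close>

lemma lborel_integral_affine:
  fixes f :: "'a::euclidean_space \<Rightarrow> 'b::{banach, second_countable_topology}"
  assumes "c \<noteq> 0" and [measurable]: "f \<in> borel_measurable borel"
  shows "(LINT x|lborel. f x) = \<bar>c\<bar> ^ DIM('a) *\<^sub>R (LINT x|lborel. f (t + c *\<^sub>R x))"
  by (subst lborel_affine[OF assms(1), of t]) (simp add: integral_density integral_distr)

lemma lborel_nn_integral_affine:
  fixes f :: "'a::euclidean_space \<Rightarrow> ennreal"
  assumes "c \<noteq> 0" and [measurable]: "f \<in> borel_measurable borel"
  shows "(\<integral>\<^sup>+x. f x \<partial>lborel) = ennreal (\<bar>c\<bar> ^ DIM('a)) * (\<integral>\<^sup>+x. f (t + c *\<^sub>R x) \<partial>lborel)"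
  by (subst lborel_affine[OF assms(1), of t])
     (simp add: nn_integral_density nn_integral_distr nn_integral_cmult)

lemma lborel_integral_translate:
  fixes f :: "'a::euclidean_space \<Rightarrow> 'b::{banach, second_countable_topology}"
  assumes "f \<in> borel_measurable borel"
  shows "(LINT x|lborel. f (t + x)) = (LINT x|lborel. f x)"
  using lborel_integral_affine[OF _ assms, of 1 t] by simp

lemma lborel_integral_reflect:
  fixes f :: "'a::euclidean_space \<Rightarrow> 'b::{banach, second_countable_topology}"
  assumes "f \<in> borel_measurable borel"
  shows "(LINT x|lborel. f (- x)) = (LINT x|lborel. f x)"
  using lborel_integral_affine[OF _ assms, of "-1" 0] by simp

lemma measurable_cis [measurable]: "cis \<in> borel_measurable borel"
  by (intro borel_measurable_continuous_onI continuous_on_cis continuous_on_id)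

text \<open>Supplies the hypothesis of Fubini's theorem for oscillatory kernels: characters have
  modulus one, so the integrands are dominated by tensor products.\<close>

lemma integrable_pair_bound:
  fixes H :: "'a::euclidean_space \<times> 'b::euclidean_space \<Rightarrow> 'c::{banach, second_countable_topology}"
    and a :: "'a \<Rightarrow> 'd::{banach, second_countable_topology}"
    and b :: "'b \<Rightarrow> 'e::{banach, second_countable_topology}"
  assumes [measurable]: "H \<in> borel_measurable (lborel \<Otimes>\<^sub>M lborel)"
    and "integrable lborel a" "integrable lborel b"
    and "\<And>x y. norm (H (x, y)) \<le> norm (a x) * norm (b y)"
  shows "integrable (lborel \<Otimes>\<^sub>M lborel) H"
proof (rule integrableI_bounded)
  have [measurable]: "a \<in> borel_measurable borel" "b \<in> borel_measurable borel"
    using assms by auto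
  have "(\<integral>\<^sup>+ z. ennreal (norm (H z)) \<partial>(lborel \<Otimes>\<^sub>M lborel)) = (\<integral>\<^sup>+ x. \<integral>\<^sup>+ y. ennreal (norm (H (x, y))) \<partial>lborel \<partial>lborel)"
    by (subst lborel.nn_integral_fst[symmetric]) auto
  also have "\<dots> \<le> (\<integral>\<^sup>+ x. \<integral>\<^sup>+ y. ennreal (norm (a x)) * ennreal (norm (b y)) \<partial>lborel \<partial>lborel)"
    using assms(4) by (intro nn_integral_mono) (auto simp: ennreal_mult[symmetric] intro!: ennreal_leI)
  also have "\<dots> = (\<integral>\<^sup>+ x. ennreal (norm (a x)) \<partial>lborel) * (\<integral>\<^sup>+ y. ennreal (norm (b y)) \<partial>lborel)"
    by (simp add: nn_integral_cmult nn_integral_multc)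
  also have "\<dots> < \<infinity>"
    using assms(2,3) by (auto simp: integrable_iff_bounded ennreal_mult_less_top)
  finally show "(\<integral>\<^sup>+ z. ennreal (norm (H z)) \<partial>(lborel \<Otimes>\<^sub>M lborel)) < \<infinity>" .
qed auto

lemma norm_cis_diff_le: "norm (cis t - 1 - \<i> * of_real t) \<le> t\<^sup>2 / 2"
  using iexp_approx1[of t 1] by (simp add: cis_conv_exp algebra_simps power2_eq_square)

lemma integrable_cis_mult:
  fixes g :: "'a::euclidean_space \<Rightarrow> complex"
  assumes "integrable lborel g" and [measurable]: "h \<in> borel_measurable borel"
  shows "integrable lborel (\<lambda>x. cis (h x) * g x)"
  using assms by (intro Bochner_Integration.integrable_bound[OF assms(1)]) (auto simp: norm_mult)

lemma fourier_scale: "fourier (\<lambda>x. c * f x) \<xi> = c * fourier f \<xi>"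
  unfolding fourier_def integral_mult_right_zero[symmetric] by (intro Bochner_Integration.integral_cong) auto

lemma schwartz_fourier_integrable:
  "f \<in> schwartz \<Longrightarrow> integrable lborel (\<lambda>x. cis (- 2 * pi * (x \<bullet> \<xi>)) * f x)"
  by (intro integrable_cis_mult schwartz_integrable) auto

lemma fourier_sum:
  assumes "\<And>i. i \<in> I \<Longrightarrow> f i \<in> schwartz"
  shows "fourier (\<lambda>x. \<Sum>i\<in>I. f i x) \<xi> = (\<Sum>i\<in>I. fourier (f i) \<xi>)"
  unfolding fourier_def sum_distrib_left
  by (intro Bochner_Integration.integral_sum schwartz_fourier_integrable assms)

lemma schwartz_coord_mult': "f \<in> schwartz \<Longrightarrow> (\<lambda>x. c * of_real (x $ i) * f x) \<in> schwartz"
  using schwartz_scale[OF schwartz_coord_mult, of f c i] by (simp add: mult.assoc)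

text \<open>Differentiation under the integral by a quantitative estimate: the second-order Taylor
  remainder of the character is at most (2 pi x.h)^2 / 2. The remainder of the transform is thus at
  most |h|^2 times a multiple of the second moment of |f|.\<close>

lemma has_derivative_fourier:
  fixes f :: "real^'n::finite \<Rightarrow> complex"
  assumes f: "f \<in> schwartz"
  shows "(fourier f has_derivative (\<lambda>h. \<Sum>i\<in>UNIV. h $ i *\<^sub>R fourier (\<lambda>x. (- 2 * pi * \<i>) * of_real (x $ i) * f x) \<xi>)) (at \<xi>)"
    (is "(_ has_derivative ?D) _")
proof -
  have [measurable]: "f \<in> borel_measurable borel" using f schwartz_measurable by blast
  have D: "?D h = (LINT x|lborel. cis (- 2 * pi * (x \<bullet> \<xi>)) * (\<i> * of_real (- 2 * pi * (x \<bullet> h)) * f x))" for h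
  proof -
    have "?D h = (\<Sum>i\<in>UNIV. fourier (\<lambda>x. of_real (h $ i) * ((- 2 * pi * \<i>) * of_real (x $ i) * f x)) \<xi>)"
      by (simp only: fourier_scale scaleR_conv_of_real)
    also have "\<dots> = fourier (\<lambda>x. \<Sum>i\<in>UNIV. of_real (h $ i) * ((- 2 * pi * \<i>) * of_real (x $ i) * f x)) \<xi>"
      by (intro fourier_sum[symmetric] schwartz_scale schwartz_coord_mult' f)
    also have "(\<lambda>x. \<Sum>i\<in>UNIV. of_real (h $ i) * ((- 2 * pi * \<i>) * of_real (x $ i) * f x))
      = (\<lambda>x. \<i> * of_real (- 2 * pi * (x \<bullet> h)) * f x)"
      by (simp add: inner_vec_def sum_distrib_left sum_distrib_right mult_ac sum_negf)
    finally show ?thesis by (simp add: fourier_def)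
  qed
  have "poly_growth (\<lambda>x::real^'n. complex_of_real ((norm x)\<^sup>2))"
    unfolding poly_growth_def
    by (intro exI[of _ 1] exI[of _ 2] allI) (auto intro!: power_mono simp: norm_power)
  then have "integrable lborel (\<lambda>x. complex_of_real ((norm x)\<^sup>2) * f x)"
    by (intro schwartz_integrable_poly f) auto
  then have int2: "integrable lborel (\<lambda>x. (norm x)\<^sup>2 * norm (f x))"
    using integrable_norm by (fastforce simp: norm_mult norm_power)
  define C where "C = 2 * pi\<^sup>2 * (LINT x|lborel. (norm x)\<^sup>2 * norm (f x))"
  have intD: "integrable lborel (\<lambda>x. cis (- 2 * pi * (x \<bullet> \<xi>)) * (\<i> * of_real (- 2 * pi * (x \<bullet> h)) * f x))" for h
  proof -
    have "poly_growth (\<lambda>x::real^'n. \<i> * of_real (- 2 * pi * (x \<bullet> h)))"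
      unfolding poly_growth_def
    proof (intro exI[of _ "2 * pi * norm h"] exI[of _ 1] allI)
      fix x :: "real^'n"
      have "norm (\<i> * complex_of_real (- 2 * pi * (x \<bullet> h))) = 2 * pi * \<bar>x \<bullet> h\<bar>"
        by (simp add: norm_mult abs_mult)
      also have "\<dots> \<le> 2 * pi * (norm x * norm h)"
        by (intro mult_left_mono Cauchy_Schwarz_ineq2) auto
      also have "\<dots> \<le> 2 * pi * norm h * (1 + norm x) ^ 1"
        by (simp add: algebra_simps)
      finally show "norm (\<i> * complex_of_real (- 2 * pi * (x \<bullet> h))) \<le> 2 * pi * norm h * (1 + norm x) ^ 1" .
    qed
    then show ?thesis by (intro integrable_cis_mult schwartz_integrable_poly f) auto
  qed
  have est: "norm (fourier f (\<xi> + h) - fourier f \<xi> - ?D h) \<le> C * norm h ^ 2" for h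
  proof -
    have eq0: "fourier f (\<xi> + h) - fourier f \<xi> - ?D h =
      (LINT x|lborel. cis (- 2 * pi * (x \<bullet> (\<xi> + h))) * f x - cis (- 2 * pi * (x \<bullet> \<xi>)) * f x
         - cis (- 2 * pi * (x \<bullet> \<xi>)) * (\<i> * of_real (- 2 * pi * (x \<bullet> h)) * f x))"
      unfolding D unfolding fourier_def
      by (subst Bochner_Integration.integral_diff, intro Bochner_Integration.integrable_diff schwartz_fourier_integrable f, rule intD)
         (subst Bochner_Integration.integral_diff, (intro schwartz_fourier_integrable f)+, rule refl)
    have "norm (LINT x|lborel. cis (- 2 * pi * (x \<bullet> (\<xi> + h))) * f x - cis (- 2 * pi * (x \<bullet> \<xi>)) * f x
         - cis (- 2 * pi * (x \<bullet> \<xi>)) * (\<i> * of_real (- 2 * pi * (x \<bullet> h)) * f x)) \<le> (LINT x|lborel. 2 * pi\<^sup>2 * norm h ^ 2 * ((norm x)\<^sup>2 * norm (f x)))"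
    proof (rule Bochner_Integration.integral_norm_bound_integral)
      fix x :: "real^'n"
      let ?t = "- 2 * pi * (x \<bullet> h)"
      have "cis (- 2 * pi * (x \<bullet> (\<xi> + h))) = cis (- 2 * pi * (x \<bullet> \<xi>)) * cis ?t"
        by (simp add: cis_mult inner_add_right algebra_simps)
      then have eq: "cis (- 2 * pi * (x \<bullet> (\<xi> + h))) * f x - cis (- 2 * pi * (x \<bullet> \<xi>)) * f x
         - cis (- 2 * pi * (x \<bullet> \<xi>)) * (\<i> * of_real ?t * f x) = cis (- 2 * pi * (x \<bullet> \<xi>)) * ((cis ?t - 1 - \<i> * of_real ?t) * f x)"
        by (simp add: algebra_simps)
      have "norm (cis (- 2 * pi * (x \<bullet> \<xi>)) * ((cis ?t - 1 - \<i> * of_real ?t) * f x)) \<le> ?t\<^sup>2 / 2 * norm (f x)"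
        unfolding norm_mult norm_cis mult_1 by (intro mult_right_mono norm_cis_diff_le) auto
      moreover have "?t\<^sup>2 / 2 * norm (f x) \<le> 2 * pi\<^sup>2 * (norm x * norm h)\<^sup>2 * norm (f x)"
      proof (intro mult_right_mono)
        have "\<bar>x \<bullet> h\<bar>\<^sup>2 \<le> (norm x * norm h)\<^sup>2" by (intro power_mono Cauchy_Schwarz_ineq2) auto
        then show "?t\<^sup>2 / 2 \<le> 2 * pi\<^sup>2 * (norm x * norm h)\<^sup>2" by (simp add: power_mult_distrib)
      qed auto
      moreover have "2 * pi\<^sup>2 * (norm x * norm h)\<^sup>2 * norm (f x) = 2 * pi\<^sup>2 * norm h ^ 2 * ((norm x)\<^sup>2 * norm (f x))"
        by (simp add: power_mult_distrib mult_ac)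
      ultimately show "norm (cis (- 2 * pi * (x \<bullet> (\<xi> + h))) * f x - cis (- 2 * pi * (x \<bullet> \<xi>)) * f x
         - cis (- 2 * pi * (x \<bullet> \<xi>)) * (\<i> * of_real ?t * f x)) \<le> 2 * pi\<^sup>2 * norm h ^ 2 * ((norm x)\<^sup>2 * norm (f x))"
        unfolding eq by linarith
    qed (intro integrable_mult_right int2 Bochner_Integration.integrable_diff schwartz_fourier_integrable f intD)+
    also have "\<dots> = C * norm h ^ 2" by (simp add: C_def)
    finally show ?thesis unfolding eq0 .
  qed
  show ?thesis
    unfolding has_derivative_at
  proof
    show "bounded_linear ?D"
      by (intro bounded_linear_sum bounded_linear_compose[OF bounded_linear_scaleR_left] bounded_linear_vec_nth)
    have "((\<lambda>h::real^'n. C * norm h) \<longlongrightarrow> C * norm (0::real^'n)) (at 0)"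
      by (intro tendsto_intros)
    then have lim: "((\<lambda>h::real^'n. C * norm h) \<longlongrightarrow> 0) (at 0)" by simp
    show "((\<lambda>h. norm (fourier f (\<xi> + h) - fourier f \<xi> - ?D h) / norm h) \<longlongrightarrow> 0) (at 0)"
    proof (rule tendsto_sandwich[OF _ _ tendsto_const lim])
      show "\<forall>\<^sub>F h in at 0. norm (fourier f (\<xi> + h) - fourier f \<xi> - ?D h) / norm h \<le> C * norm h"
        using est by (auto simp: eventually_at_filter divide_le_eq power2_eq_square mult.assoc)
    qed auto
  qed
qed

lemma partial_deriv_fourier:
  assumes "f \<in> schwartz"
  shows "partial_deriv i (fourier f) = fourier (\<lambda>x. (- 2 * pi * \<i>) * of_real (x $ i) * f x)"
proof
  fix \<xi>
  show "partial_deriv i (fourier f) \<xi> = fourier (\<lambda>x. (- 2 * pi * \<i>) * of_real (x $ i) * f x) \<xi>"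
    by (subst partial_deriv_eqI[OF has_derivative_fourier[OF assms]])
       (simp add: axis_def if_distrib if_distribR cong: if_cong)
qed

text \<open>Takes the place of integration by parts. Translation invariance makes every difference
  quotient integrate to zero, and \<open>schwartz_lipschitz\<close> provides the integrable majorant
  for the passage to the limit.\<close>

lemma integral_partial_deriv:
  fixes f :: "real^'n::finite \<Rightarrow> complex"
  assumes f: "f \<in> schwartz"
  shows "(LINT x|lborel. partial_deriv i f x) = 0"
proof -
  have [measurable]: "f \<in> borel_measurable borel" "partial_deriv i f \<in> borel_measurable borel"
    using f schwartz_measurable schwartz_partial_deriv by blast+
  let ?e = "axis i 1 :: real^'n"
  let ?s = "\<lambda>n x. of_nat (Suc n) * (f (inverse (of_nat (Suc n)) *\<^sub>R ?e + x) - f x)"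
  obtain C where C: "C > 0"
    "\<And>x y. norm (x - y) \<le> 1 \<Longrightarrow> norm (f x - f y) \<le> C * norm (x - y) / (1 + norm x) ^ (DIM(real^'n) + 2)"
    using schwartz_lipschitz[OF f] by metis
  have ne: "norm ?e = 1" by (simp add: norm_axis_1)
  have L: "(\<lambda>n. LINT x|lborel. ?s n x) \<longlonglongrightarrow> (LINT x|lborel. partial_deriv i f x)"
  proof (rule integral_dominated_convergence)
    show "integrable lborel (\<lambda>x::real^'n. C * (1 / (1 + norm x) ^ (DIM(real^'n) + 2)))"
      by (intro integrable_mult_right integrable_decay) auto
    show "AE x in lborel. (\<lambda>n. ?s n x) \<longlonglongrightarrow> partial_deriv i f x"
    proof (rule AE_I2)
      fix x
      have "(f has_derivative frechet_derivative f (at x)) (at x)"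
        using schwartz_differentiable[OF f] frechet_derivative_works by blast
      then have "((\<lambda>h. norm (f (x + h) - f x - frechet_derivative f (at x) h) / norm h) \<longlongrightarrow> 0) (at 0)"
        by (simp add: has_derivative_at)
      moreover have "filterlim (\<lambda>n. inverse (real (Suc n)) *\<^sub>R ?e) (at 0) sequentially"
        unfolding filterlim_at
      proof
        have "(\<lambda>n. inverse (real (Suc n)) *\<^sub>R ?e) \<longlonglongrightarrow> 0 *\<^sub>R ?e"
          by (intro tendsto_intros LIMSEQ_inverse_real_of_nat)
        then show "(\<lambda>n. inverse (real (Suc n)) *\<^sub>R ?e) \<longlonglongrightarrow> 0" by simp
      qed (simp del: of_nat_Suc add: axis_eq_0_iff)
      ultimately have "(\<lambda>n. norm (f (x + inverse (real (Suc n)) *\<^sub>R ?e) - f x - frechet_derivative f (at x) (inverse (real (Suc n)) *\<^sub>R ?e)) / norm (inverse (real (Suc n)) *\<^sub>R ?e)) \<longlonglongrightarrow> 0"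
        by (rule filterlim_compose)
      moreover have "(\<lambda>n. norm (f (x + inverse (real (Suc n)) *\<^sub>R ?e) - f x - frechet_derivative f (at x) (inverse (real (Suc n)) *\<^sub>R ?e)) / norm (inverse (real (Suc n)) *\<^sub>R ?e))
         = (\<lambda>n. norm (?s n x - partial_deriv i f x))"
      proof
        fix n
        let ?h = "inverse (real (Suc n))"
        have "?s n x - partial_deriv i f x = of_nat (Suc n) * (f (x + ?h *\<^sub>R ?e) - f x - frechet_derivative f (at x) (?h *\<^sub>R ?e))"
          using linear_scale[OF linear_frechet_derivative[OF schwartz_differentiable[OF f]]]
          by (simp add: partial_deriv_def right_diff_distrib scaleR_conv_of_real add.commute del: of_nat_Suc)
        then show "norm (f (x + ?h *\<^sub>R ?e) - f x - frechet_derivative f (at x) (?h *\<^sub>R ?e)) / norm (?h *\<^sub>R ?e) = norm (?s n x - partial_deriv i f x)"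
          by (simp add: norm_mult ne divide_inverse mult.commute del: of_nat_Suc)
      qed
      ultimately have "(\<lambda>n. norm (?s n x - partial_deriv i f x)) \<longlonglongrightarrow> 0" by (simp only:)
      then have "(\<lambda>n. ?s n x - partial_deriv i f x) \<longlonglongrightarrow> 0" by (rule tendsto_norm_zero_cancel)
      then show "(\<lambda>n. ?s n x) \<longlonglongrightarrow> partial_deriv i f x" by (rule LIM_zero_cancel)
    qed
    fix n
    show "AE x in lborel. norm (?s n x) \<le> C * (1 / (1 + norm x) ^ (DIM(real^'n) + 2))"
    proof (rule AE_I2)
      fix x
      let ?h = "inverse (of_nat (Suc n)) :: real"
      have h: "norm (x - (?h *\<^sub>R ?e + x)) = ?h" by (simp add: ne)
      have "?h \<le> 1" by (simp add: inverse_le_1_iff)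
      then have "norm (f x - f (?h *\<^sub>R ?e + x)) \<le> C * ?h / (1 + norm x) ^ (DIM(real^'n) + 2)"
        using C(2)[of x "?h *\<^sub>R ?e + x"] unfolding h by blast
      then have "of_nat (Suc n) * norm (f x - f (?h *\<^sub>R ?e + x)) \<le> of_nat (Suc n) * (C * ?h / (1 + norm x) ^ (DIM(real^'n) + 2))"
        by (intro mult_left_mono) auto
      also have "\<dots> = C * (1 / (1 + norm x) ^ (DIM(real^'n) + 2))" by (simp del: of_nat_Suc)
      finally show "norm (?s n x) \<le> C * (1 / (1 + norm x) ^ (DIM(real^'n) + 2))"
        unfolding norm_mult by (simp add: norm_minus_commute del: of_nat_Suc)
    qed
  qed measurable
  have Z: "(LINT x|lborel. ?s n x) = 0" for n
  proof -
    have "integrable lborel (\<lambda>x. f (inverse (of_nat (Suc n)) *\<^sub>R ?e + x))"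
      using schwartz_integrable[OF schwartz_translate[OF f, of "- (inverse (of_nat (Suc n)) *\<^sub>R ?e)"]] by (simp add: add.commute)
    then show ?thesis
      using lborel_integral_translate[of f "inverse (of_nat (Suc n)) *\<^sub>R ?e"] schwartz_integrable[OF f] by (simp add: Bochner_Integration.integral_diff)
  qed
  show ?thesis using L unfolding Z by (simp add: LIMSEQ_const_iff)
qed

lemma partial_deriv_modulate:
  assumes f: "f \<in> schwartz"
  shows "partial_deriv i (\<lambda>x. cis (x \<bullet> a) * f x) x = cis (x \<bullet> a) * (partial_deriv i f x + (\<i> * of_real (a $ i)) * f x)"
proof -
  have *: "((\<lambda>x. cis (x \<bullet> a) * f x) has_derivative (\<lambda>y. cis (x \<bullet> a) * frechet_derivative f (at x) y + (cis (x \<bullet> a) * (\<i> * of_real (y \<bullet> a))) * f x)) (at x)"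
    by (intro has_derivative_mult has_derivative_cis_inner)
       (use f schwartz_differentiable frechet_derivative_works in blast)
  show ?thesis
    unfolding partial_deriv_eqI[OF *] by (simp add: partial_deriv_def algebra_simps inner_axis')
qed

text \<open>Apply \<open>integral_partial_deriv\<close> to \<open>f\<close> times the character; the
  product rule yields the two terms that have to cancel.\<close>

lemma fourier_partial_deriv:
  fixes f :: "real^'n::finite \<Rightarrow> complex"
  assumes f: "f \<in> schwartz"
  shows "fourier (partial_deriv i f) \<xi> = (2 * pi * \<i>) * of_real (\<xi> $ i) * fourier f \<xi>"
proof -
  let ?a = "(- 2 * pi) *\<^sub>R \<xi>"
  have *: "cis (- 2 * pi * (x \<bullet> \<xi>)) = cis (x \<bullet> ?a)" for x by simp
  have "0 = (LINT x|lborel. partial_deriv i (\<lambda>x. cis (x \<bullet> ?a) * f x) x)"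
    by (intro integral_partial_deriv[symmetric] schwartz_modulate f)
  also have "\<dots> = (LINT x|lborel. cis (x \<bullet> ?a) * partial_deriv i f x + (\<i> * of_real (?a $ i)) * (cis (x \<bullet> ?a) * f x))"
    by (intro Bochner_Integration.integral_cong refl) (simp only: partial_deriv_modulate[OF f], simp only: algebra_simps)
  also have "\<dots> = (LINT x|lborel. cis (x \<bullet> ?a) * partial_deriv i f x) + (LINT x|lborel. (\<i> * of_real (?a $ i)) * (cis (x \<bullet> ?a) * f x))"
    by (intro Bochner_Integration.integral_add integrable_mult_right integrable_cis_mult schwartz_integrable schwartz_partial_deriv f) auto
  also have "\<dots> = fourier (partial_deriv i f) \<xi> + (\<i> * of_real (?a $ i)) * fourier f \<xi>"
    unfolding fourier_def * by simp
  finally show ?thesis by (simp add: algebra_simps eq_neg_iff_add_eq_0)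
qed

text \<open>A factor |xi_i| is traded for a derivative of \<open>f\<close>, so the induction on the
  power must range over all Schwartz functions. The l^1 norm dominates the Euclidean one and reduces
  the weight to coordinates.\<close>

lemma fourier_decay:
  fixes f :: "real^'n::finite \<Rightarrow> complex"
  assumes "f \<in> schwartz"
  shows "\<exists>C. \<forall>\<xi>. (1 + norm \<xi>) ^ m * norm (fourier f \<xi>) \<le> C"
  using assms
proof (induction m arbitrary: f)
  case 0
  have "norm (fourier f \<xi>) \<le> (LINT x|lborel. norm (f x))" for \<xi>
    unfolding fourier_def
    using integral_norm_bound[of lborel "\<lambda>x. cis (- 2 * pi * (x \<bullet> \<xi>)) * f x"] by (simp add: norm_mult)
  then show ?case by auto
next
  case (Suc m)
  obtain C where C: "\<And>\<xi>. (1 + norm \<xi>) ^ m * norm (fourier f \<xi>) \<le> C" using Suc by metis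
  have "\<forall>i. \<exists>C. \<forall>\<xi>. (1 + norm \<xi>) ^ m * norm (fourier (partial_deriv i f) \<xi>) \<le> C"
    using Suc schwartz_partial_deriv by blast
  then obtain c where c: "\<And>i \<xi>. (1 + norm \<xi>) ^ m * norm (fourier (partial_deriv i f) \<xi>) \<le> c i"
    by metis
  have "(1 + norm \<xi>) ^ Suc m * norm (fourier f \<xi>) \<le> C + (\<Sum>i\<in>UNIV. c i)" for \<xi>
  proof -
    have 1: "(1 + norm \<xi>) ^ m * (\<bar>\<xi> $ i\<bar> * norm (fourier f \<xi>)) \<le> c i" for i
    proof -
      have "\<bar>\<xi> $ i\<bar> * norm (fourier f \<xi>) \<le> 2 * pi * (\<bar>\<xi> $ i\<bar> * norm (fourier f \<xi>))"
        using pi_ge_two mult_right_mono[of 1 "2 * pi" "\<bar>\<xi> $ i\<bar> * norm (fourier f \<xi>)"] by simp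
      also have "\<dots> = norm (fourier (partial_deriv i f) \<xi>)"
        by (simp add: fourier_partial_deriv[OF Suc(2)] norm_mult)
      finally have "(1 + norm \<xi>) ^ m * (\<bar>\<xi> $ i\<bar> * norm (fourier f \<xi>)) \<le> (1 + norm \<xi>) ^ m * norm (fourier (partial_deriv i f) \<xi>)"
        by (intro mult_left_mono) auto
      also have "\<dots> \<le> c i" by (rule c)
      finally show ?thesis .
    qed
    have "(1 + norm \<xi>) ^ Suc m * norm (fourier f \<xi>) \<le> (1 + norm \<xi>) ^ m * ((1 + (\<Sum>i\<in>UNIV. \<bar>\<xi> $ i\<bar>)) * norm (fourier f \<xi>))"
      using norm_le_l1_cart[of \<xi>] unfolding power_Suc2 mult.assoc
      by (intro mult_left_mono mult_right_mono) auto
    also have "\<dots> = (1 + norm \<xi>) ^ m * norm (fourier f \<xi>) + (\<Sum>i\<in>UNIV. (1 + norm \<xi>) ^ m * (\<bar>\<xi> $ i\<bar> * norm (fourier f \<xi>)))"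
      by (simp add: distrib_left distrib_right sum_distrib_left sum_distrib_right)
    also have "\<dots> \<le> C + (\<Sum>i\<in>UNIV. c i)"
      by (intro add_mono sum_mono C 1)
    finally show ?thesis .
  qed
  then show ?case by blast
qed

lemma schwartz_fourier:
  fixes f :: "real^'n::finite \<Rightarrow> complex"
  assumes "f \<in> schwartz"
  shows "fourier f \<in> schwartz"
proof (rule schwartz_coinduct[where A = "fourier ` schwartz"])
  show "g differentiable at x" if "g \<in> fourier ` schwartz" for g :: "real^'n \<Rightarrow> complex" and x
    using that has_derivative_fourier differentiableI by blast
  show "partial_deriv i g \<in> fourier ` schwartz" if "g \<in> fourier ` schwartz" for g :: "real^'n \<Rightarrow> complex" and i
  proof -
    obtain h where "h \<in> schwartz" "g = fourier h" using \<open>g \<in> fourier ` schwartz\<close> by blast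
    then show ?thesis using schwartz_coord_mult' by (simp only: partial_deriv_fourier) blast
  qed
  show "\<exists>C. \<forall>x. (1 + norm x) ^ m * norm (g x) \<le> C" if "g \<in> fourier ` schwartz" for g :: "real^'n \<Rightarrow> complex" and m
    using that fourier_decay by auto
qed (use assms in blast)

lemma inv_fourier_eq: "inv_fourier f x = fourier f (- x)"
  unfolding inv_fourier_def fourier_def by (intro Bochner_Integration.integral_cong) (simp_all add: inner_commute)

lemma schwartz_inv_fourier: "f \<in> schwartz \<Longrightarrow> inv_fourier f \<in> schwartz"
  using schwartz_reflect[OF schwartz_fourier, of f 0] by (simp add: inv_fourier_eq[abs_def])

lemma fourier_mult_formula:
  fixes f g :: "real^'n::finite \<Rightarrow> complex"
  assumes "f \<in> schwartz" "g \<in> schwartz"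
  shows "(LINT x|lborel. fourier f x * g x) = (LINT x|lborel. f x * fourier g x)"
proof -
  have [measurable]: "f \<in> borel_measurable borel" "g \<in> borel_measurable borel"
    using assms schwartz_measurable by blast+
  let ?h = "\<lambda>x y. cis (- 2 * pi * (x \<bullet> y)) * f x * g y"
  have "integrable (lborel \<Otimes>\<^sub>M lborel) (case_prod ?h)"
    by (rule integrable_pair_bound[OF _ schwartz_integrable[OF assms(1)] schwartz_integrable[OF assms(2)]])
       (auto simp: norm_mult)
  then have F: "(LINT y|lborel. LINT x|lborel. ?h x y) = (LINT x|lborel. LINT y|lborel. ?h x y)"
    by (rule lborel_pair.Fubini_integral)
  have A: "(LINT x|lborel. ?h x y) = fourier f y * g y" for y
    unfolding fourier_def by (subst integral_mult_left_zero[symmetric]) simp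
  have B: "(LINT y|lborel. ?h x y) = f x * fourier g x" for x
    unfolding fourier_def
    by (subst integral_mult_right_zero[symmetric], intro Bochner_Integration.integral_cong) (auto simp: inner_commute)
  show ?thesis using F unfolding A B .
qed

text \<open>Test-function side of the multiplier with symbol \<open>m\<close>: an integral against
  translates of one fixed kernel. The counterpart for distributions is
  \<open>tempered_conv\<close>.\<close>

lemma fourier_conv:
  fixes f m :: "real^'n::finite \<Rightarrow> complex"
  assumes "f \<in> schwartz" "m \<in> schwartz"
  shows "fourier (\<lambda>\<xi>. m \<xi> * inv_fourier f \<xi>) y = (LINT x|lborel. f x * inv_fourier m (x - y))"
proof -
  have [measurable]: "f \<in> borel_measurable borel" "m \<in> borel_measurable borel"
    using assms schwartz_measurable by blast+
  let ?h = "\<lambda>x \<xi>. cis (2 * pi * ((x - y) \<bullet> \<xi>)) * f x * m \<xi>"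
  have "integrable (lborel \<Otimes>\<^sub>M lborel) (case_prod ?h)"
    by (rule integrable_pair_bound[OF _ schwartz_integrable[OF assms(1)] schwartz_integrable[OF assms(2)]])
       (auto simp: norm_mult)
  then have F: "(LINT \<xi>|lborel. LINT x|lborel. ?h x \<xi>) = (LINT x|lborel. LINT \<xi>|lborel. ?h x \<xi>)"
    by (rule lborel_pair.Fubini_integral)
  have A: "(LINT x|lborel. ?h x \<xi>) = cis (- 2 * pi * (\<xi> \<bullet> y)) * (m \<xi> * inv_fourier f \<xi>)" for \<xi>
  proof -
    have "(LINT x|lborel. ?h x \<xi>) = (LINT x|lborel. (cis (- 2 * pi * (\<xi> \<bullet> y)) * m \<xi>) * (cis (2 * pi * (\<xi> \<bullet> x)) * f x))"
    proof (intro Bochner_Integration.integral_cong refl)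
      fix x
      have "cis (2 * pi * ((x - y) \<bullet> \<xi>)) = cis (- 2 * pi * (\<xi> \<bullet> y)) * cis (2 * pi * (\<xi> \<bullet> x))"
        by (simp add: cis_mult inner_commute algebra_simps)
      then show "?h x \<xi> = (cis (- 2 * pi * (\<xi> \<bullet> y)) * m \<xi>) * (cis (2 * pi * (\<xi> \<bullet> x)) * f x)"
        by (simp add: mult_ac)
    qed
    then show ?thesis by (simp add: inv_fourier_def mult.assoc)
  qed
  have B: "(LINT \<xi>|lborel. ?h x \<xi>) = f x * inv_fourier m (x - y)" for x
    unfolding inv_fourier_def
    by (subst integral_mult_right_zero[symmetric], intro Bochner_Integration.integral_cong) auto
  show ?thesis using F unfolding A B fourier_def[of "\<lambda>\<xi>. m \<xi> * inv_fourier f \<xi>"] .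
qed

subsection \<open>Fourier inversion\<close>

lemma integral_prod_Basis:
  fixes f :: "'a::euclidean_space \<Rightarrow> real \<Rightarrow> complex"
  assumes "\<And>b. b \<in> Basis \<Longrightarrow> integrable lborel (f b)"
  shows "(LINT x|lborel. (\<Prod>b\<in>Basis. f b (x \<bullet> b))) = (\<Prod>b\<in>Basis. LINT t|lborel. f b t)"
proof -
  interpret product_sigma_finite "\<lambda>_::'a. lborel :: real measure" ..
  have [measurable]: "f b \<in> borel_measurable borel" if "b \<in> Basis" for b
    using assms[OF that] by auto
  have "(LINT x|lborel. (\<Prod>b\<in>Basis. f b (x \<bullet> b))) =
    (LINT y|(\<Pi>\<^sub>M b\<in>Basis. lborel). (\<Prod>b\<in>Basis. f b ((\<Sum>b\<in>Basis. y b *\<^sub>R b) \<bullet> b)))"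
    by (subst lborel_eq, subst integral_distr) auto
  also have "\<dots> = (LINT y|(\<Pi>\<^sub>M b\<in>Basis. lborel). (\<Prod>b\<in>Basis. f b (y b)))"
    by (intro Bochner_Integration.integral_cong prod.cong) (auto simp: inner_sum_left inner_Basis if_distrib cong: if_cong)
  also have "\<dots> = (\<Prod>b\<in>Basis. LINT t|lborel. f b t)"
    by (intro product_integral_prod assms) auto
  finally show ?thesis .
qed

text \<open>The density of the standard normal law on the whole space.\<close>

definition gauss :: "'a::euclidean_space \<Rightarrow> real"
  where "gauss x = (1 / sqrt (2 * pi)) ^ DIM('a) * exp (- (norm x)\<^sup>2 / 2)"

lemma gauss_prod: "gauss x = (\<Prod>b\<in>Basis. std_normal_density (x \<bullet> b))"
proof -
  have "(norm x)\<^sup>2 = (\<Sum>b\<in>Basis. (x \<bullet> b)\<^sup>2)"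
    unfolding power2_norm_eq_inner by (simp add: euclidean_inner[of x x] power2_eq_square)
  then show ?thesis
    by (simp add: gauss_def std_normal_density_def prod.distrib exp_sum[symmetric] sum_divide_distrib sum_negf power_one_over prod_dividef)
qed

lemma cis_sum: "finite A \<Longrightarrow> cis (\<Sum>a\<in>A. f a) = (\<Prod>a\<in>A. cis (f a))"
  by (induction A rule: finite_induct) (auto simp: cis_mult[symmetric])

text \<open>Factorises over the coordinates into the characteristic function of the one-dimensional
  standard normal law.\<close>

lemma integral_gauss_cis:
  fixes s :: "'a::euclidean_space"
  shows "(LINT x|lborel. cis (s \<bullet> x) * of_real (gauss x)) = of_real (exp (- (norm s)\<^sup>2 / 2))"
proof -
  have int: "integrable lborel (\<lambda>t. cis (c * t) * of_real (std_normal_density t))" for c :: real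
    by (intro integrable_cis_mult integrable_of_real integrable_normal_density) auto
  have 1: "(LINT t|lborel. cis (c * t) * of_real (std_normal_density t)) = of_real (exp (- c\<^sup>2 / 2))" for c :: real
    using fun_cong[OF char_std_normal_distribution, of c]
    by (simp add: char_def integral_density cis_conv_exp scaleR_conv_of_real mult_ac)
  have "(LINT x|lborel. cis (s \<bullet> x) * of_real (gauss x)) = (LINT x|lborel. (\<Prod>b\<in>Basis. cis ((s \<bullet> b) * (x \<bullet> b)) * of_real (std_normal_density (x \<bullet> b))))"
  proof (intro Bochner_Integration.integral_cong refl)
    fix x :: 'a
    have "s \<bullet> x = (\<Sum>b\<in>Basis. (s \<bullet> b) * (x \<bullet> b))" by (rule euclidean_inner)
    then show "cis (s \<bullet> x) * of_real (gauss x) = (\<Prod>b\<in>Basis. cis ((s \<bullet> b) * (x \<bullet> b)) * of_real (std_normal_density (x \<bullet> b)))"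
      by (simp only: cis_sum[OF finite_Basis] gauss_prod prod.distrib of_real_prod)
  qed
  also have "\<dots> = (\<Prod>b\<in>Basis. of_real (exp (- (s \<bullet> b)\<^sup>2 / 2)))"
    by (subst integral_prod_Basis[of "\<lambda>b t. cis ((s \<bullet> b) * t) * of_real (std_normal_density t)"]) (auto simp: 1 int)
  also have "\<dots> = of_real (exp (- (norm s)\<^sup>2 / 2))"
  proof -
    have "(norm s)\<^sup>2 = (\<Sum>b\<in>Basis. (s \<bullet> b)\<^sup>2)"
      unfolding power2_norm_eq_inner by (simp add: euclidean_inner[of s s] power2_eq_square)
    then show ?thesis by (simp add: exp_sum[symmetric] sum_divide_distrib sum_negf flip: of_real_prod)
  qed
  finally show ?thesis .
qed

lemma gauss_measurable [measurable]: "gauss \<in> borel_measurable borel"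
  unfolding gauss_def by measurable

lemma gauss_nonneg: "gauss x \<ge> 0"
  by (simp add: gauss_def)

lemma gauss_le: "gauss (x::'a::euclidean_space) \<le> gauss (0::'a)"
  by (simp add: gauss_def mult_left_le)

text \<open>The preceding computation gives the integral 1, whereas the integral of a non-integrable
  function is 0 by convention.\<close>

lemma integrable_gauss: "integrable lborel (\<lambda>x::'a::euclidean_space. complex_of_real (gauss x))"
proof (rule ccontr)
  assume "\<not> ?thesis"
  then have "(LINT x|lborel. complex_of_real (gauss (x::'a))) = 0" by (rule not_integrable_integral_eq)
  then show False using integral_gauss_cis[of "0::'a"] by simp
qed

text \<open>The Gaussian is its own transform up to a constant. Inserting this and interchanging the
  integrals shows that averaging \<open>f\<close> over a Gaussian of width \<open>e\<close> is
  Fourier inversion damped by a Gaussian of width of order 1/e.\<close>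

lemma gauss_conv:
  fixes f :: "real^'n::finite \<Rightarrow> complex"
  assumes f: "f \<in> schwartz" and e: "e > 0"
  shows "(LINT z|lborel. f (x + e *\<^sub>R z) * of_real (gauss z)) =
    of_real (gauss (0::real^'n) * (2 * pi) ^ CARD('n)) * (LINT \<xi>|lborel. of_real (gauss ((2 * pi * e) *\<^sub>R \<xi>)) * (cis (2 * pi * (x \<bullet> \<xi>)) * fourier f \<xi>))"
proof -
  have [measurable]: "f \<in> borel_measurable borel" "fourier f \<in> borel_measurable borel"
    using f schwartz_measurable schwartz_fourier by blast+
  let ?h = "\<lambda>z u. f (x + e *\<^sub>R z) * cis (z \<bullet> u) * of_real (gauss u)"
  have S: "(\<lambda>z. f (x + e *\<^sub>R z)) \<in> schwartz"
    using schwartz_affine[OF f, of e 1 x] e by simp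
  have "integrable (lborel \<Otimes>\<^sub>M lborel) (case_prod ?h)"
    by (rule integrable_pair_bound[OF _ schwartz_integrable[OF S] integrable_gauss])
       (auto simp: norm_mult gauss_nonneg)
  then have F: "(LINT z|lborel. LINT u|lborel. ?h z u) = (LINT u|lborel. LINT z|lborel. ?h z u)"
    by (rule lborel_pair.Fubini_integral[symmetric])
  have g: "gauss z = gauss (0::real^'n) * exp (- (norm z)\<^sup>2 / 2)" for z :: "real^'n"
    by (simp add: gauss_def)
  have "(LINT z|lborel. f (x + e *\<^sub>R z) * of_real (gauss z)) = (LINT z|lborel. of_real (gauss (0::real^'n)) * (LINT u|lborel. ?h z u))"
  proof (intro Bochner_Integration.integral_cong refl)
    fix z
    have "(LINT u|lborel. ?h z u) = f (x + e *\<^sub>R z) * (LINT u|lborel. cis (z \<bullet> u) * of_real (gauss u))"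
      by (simp add: mult.assoc)
    then show "f (x + e *\<^sub>R z) * of_real (gauss z) = of_real (gauss (0::real^'n)) * (LINT u|lborel. ?h z u)"
      using integral_gauss_cis[of z] g[of z] by simp
  qed
  also have "\<dots> = of_real (gauss (0::real^'n)) * (LINT u|lborel. LINT z|lborel. ?h z u)"
    by (simp add: F)
  also have "(LINT u|lborel. LINT z|lborel. ?h z u) = (LINT u|lborel. of_real (1 / e ^ CARD('n)) * (cis (- (x \<bullet> u) / e) * fourier f ((- 1 / (2 * pi * e)) *\<^sub>R u) * of_real (gauss u)))"
  proof (intro Bochner_Integration.integral_cong refl)
    fix u :: "real^'n"
    \<comment> \<open>The frequency for which the substitution x + e z turns the Fourier character
      into cis(z.u), up to a factor that does not depend on z.\<close>
    let ?v = "(- 1 / (2 * pi * e)) *\<^sub>R u"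
    have "fourier f ?v = of_real (e ^ CARD('n)) * (LINT z|lborel. cis (- 2 * pi * ((x + e *\<^sub>R z) \<bullet> ?v)) * f (x + e *\<^sub>R z))"
      unfolding fourier_def using e
      by (subst lborel_integral_affine[of e _ x]) (auto simp: scaleR_conv_of_real)
    also have "(LINT z|lborel. cis (- 2 * pi * ((x + e *\<^sub>R z) \<bullet> ?v)) * f (x + e *\<^sub>R z)) = (LINT z|lborel. cis ((x \<bullet> u) / e) * (f (x + e *\<^sub>R z) * cis (z \<bullet> u)))"
    proof (intro Bochner_Integration.integral_cong refl)
      fix z
      have "- 2 * pi * ((x + e *\<^sub>R z) \<bullet> ?v) = (x \<bullet> u) / e + z \<bullet> u"
        using e by (simp add: inner_add_left field_simps)
      then show "cis (- 2 * pi * ((x + e *\<^sub>R z) \<bullet> ?v)) * f (x + e *\<^sub>R z) = cis ((x \<bullet> u) / e) * (f (x + e *\<^sub>R z) * cis (z \<bullet> u))"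
        by (simp only: cis_mult[symmetric]) (simp add: mult_ac)
    qed
    also have "\<dots> = cis ((x \<bullet> u) / e) * (LINT z|lborel. f (x + e *\<^sub>R z) * cis (z \<bullet> u))"
      by simp
    finally have "cis (- (x \<bullet> u) / e) * fourier f ?v = of_real (e ^ CARD('n)) * ((cis (- (x \<bullet> u) / e) * cis ((x \<bullet> u) / e)) * (LINT z|lborel. f (x + e *\<^sub>R z) * cis (z \<bullet> u)))"
      by simp
    also have "cis (- (x \<bullet> u) / e) * cis ((x \<bullet> u) / e) = 1" by (simp add: cis_mult)
    finally show "(LINT z|lborel. ?h z u) = of_real (1 / e ^ CARD('n)) * (cis (- (x \<bullet> u) / e) * fourier f ?v * of_real (gauss u))"
      using e by (simp add: field_simps)
  qed
  also have "\<dots> = of_real (\<bar>- 2 * pi * e\<bar> ^ CARD('n)) * (LINT \<xi>|lborel. of_real (1 / e ^ CARD('n)) * (cis (2 * pi * (x \<bullet> \<xi>)) * fourier f \<xi> * of_real (gauss ((2 * pi * e) *\<^sub>R \<xi>))))"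
  proof (subst lborel_integral_affine[of "- 2 * pi * e" _ 0])
    show "- 2 * pi * e \<noteq> 0" using e by simp
    show "(\<lambda>u. of_real (1 / e ^ CARD('n)) * (cis (- (x \<bullet> u) / e) * fourier f ((- 1 / (2 * pi * e)) *\<^sub>R u) * of_real (gauss u))) \<in> borel_measurable borel"
      by measurable
    have "of_real (1 / e ^ CARD('n)) * (cis (- (x \<bullet> (0 + (- 2 * pi * e) *\<^sub>R \<xi>)) / e) * fourier f ((- 1 / (2 * pi * e)) *\<^sub>R (0 + (- 2 * pi * e) *\<^sub>R \<xi>)) * of_real (gauss (0 + (- 2 * pi * e) *\<^sub>R \<xi>)))
      = of_real (1 / e ^ CARD('n)) * (cis (2 * pi * (x \<bullet> \<xi>)) * fourier f \<xi> * of_real (gauss ((2 * pi * e) *\<^sub>R \<xi>)))" for \<xi> :: "real^'n"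
      using e by (simp add: gauss_def mult.assoc)
    then show "\<bar>- 2 * pi * e\<bar> ^ DIM(real^'n) *\<^sub>R (LINT \<xi>|lborel. of_real (1 / e ^ CARD('n)) * (cis (- (x \<bullet> (0 + (- 2 * pi * e) *\<^sub>R \<xi>)) / e) * fourier f ((- 1 / (2 * pi * e)) *\<^sub>R (0 + (- 2 * pi * e) *\<^sub>R \<xi>)) * of_real (gauss (0 + (- 2 * pi * e) *\<^sub>R \<xi>))))
      = of_real (\<bar>- 2 * pi * e\<bar> ^ CARD('n)) * (LINT \<xi>|lborel. of_real (1 / e ^ CARD('n)) * (cis (2 * pi * (x \<bullet> \<xi>)) * fourier f \<xi> * of_real (gauss ((2 * pi * e) *\<^sub>R \<xi>))))"
      by (simp only: scaleR_conv_of_real) (simp add: DIM_cart)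
  qed
  also have "\<dots> = of_real ((2 * pi) ^ CARD('n)) * (LINT \<xi>|lborel. of_real (gauss ((2 * pi * e) *\<^sub>R \<xi>)) * (cis (2 * pi * (x \<bullet> \<xi>)) * fourier f \<xi>))"
    using e by (simp add: abs_mult power_mult_distrib mult_ac)
  finally show ?thesis by (simp add: mult_ac)
qed

text \<open>Let the width in \<open>gauss_conv\<close> tend to zero: the average tends to
  \<open>f x\<close> and the damping disappears, both by dominated convergence. The constants cancel
  because gauss(0)^2 (2 pi)^d = 1.\<close>

theorem inv_fourier_fourier:
  fixes f :: "real^'n::finite \<Rightarrow> complex"
  assumes f: "f \<in> schwartz"
  shows "inv_fourier (fourier f) = f"
proof
  fix x
  have [measurable]: "f \<in> borel_measurable borel" "fourier f \<in> borel_measurable borel"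
    using f schwartz_measurable schwartz_fourier by blast+
  define e where "e = (\<lambda>n. inverse (real (Suc n)))"
  have e: "e n > 0" "e \<longlonglongrightarrow> 0" for n
    unfolding e_def using LIMSEQ_inverse_real_of_nat by auto
  obtain C where C: "\<And>x. norm (f x) \<le> C" using schwartz_bounded[OF f, of 0] by auto
  have L: "(\<lambda>n. LINT z|lborel. f (x + e n *\<^sub>R z) * of_real (gauss z)) \<longlonglongrightarrow> (LINT z|lborel. f x * of_real (gauss (z::real^'n)))"
  proof (rule integral_dominated_convergence)
    show "integrable lborel (\<lambda>z::real^'n. C * gauss z)"
      using integrable_gauss[where 'a="real^'n"] by (intro integrable_mult_right) (simp add: complex_of_real_integrable_eq)
    show "AE z in lborel. (\<lambda>n. f (x + e n *\<^sub>R z) * of_real (gauss z)) \<longlonglongrightarrow> f x * of_real (gauss z)"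
    proof (intro AE_I2 tendsto_intros)
      fix z
      have "(\<lambda>n. x + e n *\<^sub>R z) \<longlonglongrightarrow> x + 0 *\<^sub>R z" by (intro tendsto_intros e)
      then have "(\<lambda>n. x + e n *\<^sub>R z) \<longlonglongrightarrow> x" by simp
      then show "(\<lambda>n. f (x + e n *\<^sub>R z)) \<longlonglongrightarrow> f x"
        by (rule continuous_on_tendsto_compose[OF schwartz_continuous[OF f, of UNIV]]) auto
    qed
    show "AE z in lborel. norm (f (x + e n *\<^sub>R z) * of_real (gauss z)) \<le> C * gauss z" for n
      using C by (intro AE_I2) (auto simp: norm_mult gauss_nonneg intro!: mult_right_mono)
  qed measurable
  have Z: "(LINT z|lborel. f x * of_real (gauss (z::real^'n))) = f x"
    using integral_gauss_cis[of "0::real^'n"] by simp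
  have 1: "(\<lambda>n. LINT z|lborel. f (x + e n *\<^sub>R z) * of_real (gauss z)) \<longlonglongrightarrow> f x"
    using L unfolding Z .
  let ?k = "\<lambda>\<xi>. cis (2 * pi * (x \<bullet> \<xi>)) * fourier f \<xi>"
  have k: "integrable lborel ?k"
    by (intro integrable_cis_mult schwartz_integrable schwartz_fourier f) auto
  have "(\<lambda>n. LINT \<xi>|lborel. of_real (gauss ((2 * pi * e n) *\<^sub>R \<xi>)) * ?k \<xi>) \<longlonglongrightarrow> (LINT \<xi>|lborel. of_real (gauss (0::real^'n)) * ?k \<xi>)"
  proof (rule integral_dominated_convergence)
    show "integrable lborel (\<lambda>\<xi>. gauss (0::real^'n) * norm (?k \<xi>))"
      by (intro integrable_mult_right integrable_norm k)
    show "AE \<xi> in lborel. (\<lambda>n. of_real (gauss ((2 * pi * e n) *\<^sub>R \<xi>)) * ?k \<xi>) \<longlonglongrightarrow> of_real (gauss (0::real^'n)) * ?k \<xi>"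
    proof (intro AE_I2 tendsto_mult tendsto_of_real tendsto_const)
      fix \<xi> :: "real^'n"
      have "(\<lambda>n. (2 * pi * e n) *\<^sub>R \<xi>) \<longlonglongrightarrow> (2 * pi * 0) *\<^sub>R \<xi>" by (intro tendsto_intros e)
      then have "(\<lambda>n. (2 * pi * e n) *\<^sub>R \<xi>) \<longlonglongrightarrow> 0" by simp
      have "continuous_on UNIV (gauss :: real^'n \<Rightarrow> real)"
        unfolding gauss_def by (intro continuous_intros) auto
      from continuous_on_tendsto_compose[OF this \<open>(\<lambda>n. (2 * pi * e n) *\<^sub>R \<xi>) \<longlonglongrightarrow> 0\<close>]
      show "(\<lambda>n. gauss ((2 * pi * e n) *\<^sub>R \<xi>)) \<longlonglongrightarrow> gauss (0::real^'n)" by auto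
    qed
    show "AE \<xi> in lborel. norm (of_real (gauss ((2 * pi * e n) *\<^sub>R \<xi>)) * ?k \<xi>) \<le> gauss (0::real^'n) * norm (?k \<xi>)" for n
      using gauss_le by (intro AE_I2) (auto simp: norm_mult gauss_nonneg intro!: mult_right_mono)
  qed measurable
  from tendsto_mult_left[OF this, of "of_real (gauss (0::real^'n) * (2 * pi) ^ CARD('n))"]
  have "(\<lambda>n. LINT z|lborel. f (x + e n *\<^sub>R z) * of_real (gauss z)) \<longlonglongrightarrow>
     of_real (gauss (0::real^'n) * (2 * pi) ^ CARD('n)) * (LINT \<xi>|lborel. of_real (gauss (0::real^'n)) * ?k \<xi>)"
    by (simp only: gauss_conv[OF f e(1)])
  with 1 have "f x = of_real (gauss (0::real^'n) * (2 * pi) ^ CARD('n)) * (LINT \<xi>|lborel. of_real (gauss (0::real^'n)) * ?k \<xi>)"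
    by (rule LIMSEQ_unique)
  also have "\<dots> = of_real (gauss (0::real^'n) * gauss (0::real^'n) * (2 * pi) ^ CARD('n)) * inv_fourier (fourier f) x"
    by (simp add: inv_fourier_def)
  also have "gauss (0::real^'n) * gauss (0::real^'n) * (2 * pi) ^ CARD('n) = 1"
  proof -
    have 2: "1 / sqrt (2 * pi) * (1 / sqrt (2 * pi)) * (2 * pi) = 1" by simp
    have 3: "gauss (0::real^'n) = (1 / sqrt (2 * pi)) ^ CARD('n)" by (simp add: gauss_def)
    show ?thesis unfolding 3 power_mult_distrib[symmetric] 2 power_one ..
  qed
  finally show "inv_fourier (fourier f) x = f x" by simp
qed

lemma fourier_inv_fourier:
  fixes f :: "real^'n::finite \<Rightarrow> complex"
  assumes f: "f \<in> schwartz"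
  shows "fourier (inv_fourier f) = f"
proof -
  have [measurable]: "fourier f \<in> borel_measurable borel"
    using f schwartz_measurable schwartz_fourier by blast
  have "fourier (inv_fourier f) \<xi> = inv_fourier (fourier f) \<xi>" for \<xi>
    using lborel_integral_reflect[of "\<lambda>x. cis (2 * pi * (\<xi> \<bullet> x)) * fourier f x"]
    unfolding fourier_def[of "inv_fourier f"] inv_fourier_eq[of f] inv_fourier_def[of "fourier f"]
    by (simp add: inner_commute)
  then show ?thesis using inv_fourier_fourier[OF f] by auto
qed

subsection \<open>Riemann sums\<close>

lemma finite_vec_box: "finite A \<Longrightarrow> finite {v::'a^'n::finite. \<forall>i. v $ i \<in> A}"
proof -
  assume "finite A"
  then have "finite (vec_lambda ` (PiE (UNIV::'n set) (\<lambda>_. A)))"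
    by (intro finite_imageI finite_PiE) auto
  moreover have "{v::'a^'n. \<forall>i. v $ i \<in> A} \<subseteq> vec_lambda ` (PiE (UNIV::'n set) (\<lambda>_. A))"
  proof
    fix v :: "'a^'n" assume "v \<in> {v. \<forall>i. v $ i \<in> A}"
    then have "vec_nth v \<in> PiE UNIV (\<lambda>_. A)" by auto
    then show "v \<in> vec_lambda ` (PiE UNIV (\<lambda>_. A))" by (metis imageI vec_nth_inverse)
  qed
  ultimately show ?thesis by (rule finite_subset[rotated])
qed

text \<open>Riemann sums are set up as integrals of the rounded integrand over a ball. The nodes are
  the values of the rounding map, and the weight of a node is the volume of its cell inside the
  ball, so truncated boundary cells need no separate treatment.\<close>

definition grid_round :: "nat \<Rightarrow> real^'n \<Rightarrow> real^'n::finite"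
  where "grid_round n x = (\<chi> i. of_int \<lfloor>real (Suc n) * x $ i\<rfloor> / real (Suc n))"

definition grid :: "nat \<Rightarrow> (real^'n::finite) set"
  where "grid n = grid_round n ` cball 0 (real n)"

definition grid_weight :: "nat \<Rightarrow> real^'n::finite \<Rightarrow> real"
  where "grid_weight n v = measure lborel {x \<in> cball 0 (real n). grid_round n x = v}"

lemma grid_round_dist: "norm (x - grid_round n x) \<le> real CARD('n) / real (Suc n)" for x :: "real^'n::finite"
proof -
  have "\<bar>(x - grid_round n x) $ i\<bar> \<le> 1 / real (Suc n)" for i
  proof -
    have "x $ i - of_int \<lfloor>real (Suc n) * x $ i\<rfloor> / real (Suc n) = (real (Suc n) * x $ i - of_int \<lfloor>real (Suc n) * x $ i\<rfloor>) / real (Suc n)"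
      by (simp add: diff_divide_distrib del: of_nat_Suc)
    moreover have "0 \<le> real (Suc n) * x $ i - of_int \<lfloor>real (Suc n) * x $ i\<rfloor>" "real (Suc n) * x $ i - of_int \<lfloor>real (Suc n) * x $ i\<rfloor> \<le> 1"
      by linarith+
    ultimately show ?thesis
      by (simp add: grid_round_def divide_right_mono del: of_nat_Suc)
  qed
  then have "(\<Sum>i\<in>UNIV. \<bar>(x - grid_round n x) $ i\<bar>) \<le> (\<Sum>i\<in>(UNIV::'n set). 1 / real (Suc n))"
    by (intro sum_mono)
  then show ?thesis using norm_le_l1_cart[of "x - grid_round n x"] by simp
qed

lemma grid_round_measurable [measurable]:
  "(grid_round n :: real^'n::finite \<Rightarrow> real^'n) \<in> borel_measurable borel"
proof (subst borel_measurable_euclidean_space, rule ballI)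
  fix b :: "real^'n" assume "b \<in> Basis"
  then obtain i where b: "b = axis i 1" by (auto simp: Basis_vec_def)
  have "(\<lambda>x::real^'n. real (Suc n) * x $ i) \<in> borel_measurable borel"
    by (intro borel_measurable_continuous_onI continuous_intros)
  from measurable_compose[OF this borel_measurable_real_floor]
  have "(\<lambda>x::real^'n. of_int \<lfloor>real (Suc n) * x $ i\<rfloor> / real (Suc n)) \<in> borel_measurable borel"
    by (intro borel_measurable_divide borel_measurable_const)
  then show "(\<lambda>x. grid_round n x \<bullet> b) \<in> borel_measurable borel"
    by (simp add: b inner_axis grid_round_def del: of_nat_Suc)
qed

lemma finite_grid: "finite (grid n :: (real^'n::finite) set)"
proof -
  let ?A = "(\<lambda>k. of_int k / real (Suc n)) ` {- int (n * Suc n) - 1 .. int (n * Suc n)}"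
  have "grid n \<subseteq> {v::real^'n. \<forall>i. v $ i \<in> ?A}"
  proof (intro subsetI CollectI allI)
    fix v :: "real^'n" and i assume "v \<in> grid n"
    then obtain x where "norm x \<le> real n" and v: "v = grid_round n x" by (auto simp: grid_def)
    then have "\<bar>x $ i\<bar> \<le> real n" using component_le_norm_cart[of x i] by linarith
    then have "real (Suc n) * \<bar>x $ i\<bar> \<le> real (Suc n) * real n" by (intro mult_left_mono) auto
    then have "\<bar>real (Suc n) * x $ i\<bar> \<le> real (n * Suc n)"
      by (simp only: abs_mult of_nat_mult mult.commute abs_of_nat)
    then have "of_int \<lfloor>real (Suc n) * x $ i\<rfloor> / real (Suc n) \<in> ?A"
      by (intro imageI) (simp add: le_floor_iff floor_le_iff abs_le_iff del: of_nat_Suc of_nat_mult)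
    then show "v $ i \<in> ?A" by (simp only: v grid_round_def vec_lambda_beta)
  qed
  then show ?thesis using finite_vec_box finite_subset by blast
qed

lemma grid_sum_eq_integral:
  fixes P :: "real^'n::finite \<Rightarrow> complex"
  shows "integrable lborel (\<lambda>x. indicator (cball 0 (real n)) x *\<^sub>R P (grid_round n x))"
    and "(\<Sum>v\<in>grid n. of_real (grid_weight n v) * P v) = (LINT x|lborel. indicator (cball 0 (real n)) x *\<^sub>R P (grid_round n x))"
proof -
  let ?A = "\<lambda>v. {x \<in> cball 0 (real n). grid_round n x = v} :: (real^'n) set"
  have A: "?A v \<in> sets lborel" for v
    by measurable
  have fin: "emeasure lborel (?A v) < \<infinity>" for v
  proof -
    have "emeasure lborel (?A v) \<le> emeasure lborel (cball (0::real^'n) (real n))"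
      by (intro emeasure_mono) auto
    then show ?thesis using emeasure_lborel_cball_finite order_le_less_trans by blast
  qed
  have eq: "indicator (cball 0 (real n)) x *\<^sub>R P (grid_round n x) = (\<Sum>v\<in>grid n. indicator (?A v) x *\<^sub>R P v)" for x
  proof (cases "x \<in> cball 0 (real n)")
    case True
    have "(\<Sum>v\<in>grid n. indicator (?A v) x *\<^sub>R P v) = (\<Sum>v\<in>{grid_round n x}. indicator (?A v) x *\<^sub>R P v)"
      by (intro sum.mono_neutral_right finite_grid) (use True in \<open>auto simp: grid_def indicator_def\<close>)
    then show ?thesis using True by (simp add: indicator_def)
  qed (auto simp: indicator_def)
  have int: "integrable lborel (\<lambda>x. indicator (?A v) x *\<^sub>R P v)" for v
    using A fin by (intro integrable_scaleR_left integrable_real_indicator)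
  show "integrable lborel (\<lambda>x. indicator (cball 0 (real n)) x *\<^sub>R P (grid_round n x))"
    unfolding eq by (intro Bochner_Integration.integrable_sum int)
  show "(\<Sum>v\<in>grid n. of_real (grid_weight n v) * P v) = (LINT x|lborel. indicator (cball 0 (real n)) x *\<^sub>R P (grid_round n x))"
    unfolding eq using A fin int
    by (subst Bochner_Integration.integral_sum) (auto simp: grid_weight_def scaleR_conv_of_real)
qed

lemma lipschitz_imp_continuous:
  fixes g :: "'a::real_normed_vector \<Rightarrow> 'b::real_normed_vector"
  assumes "\<And>x x'. norm (x - x') \<le> 1 \<Longrightarrow> norm (g x - g x') \<le> B x * norm (x - x')"
  shows "continuous_on UNIV g"
proof (intro continuous_at_imp_continuous_on ballI)
  fix x
  have "((\<lambda>x'. B x * norm (x - x')) \<longlongrightarrow> B x * norm (x - x)) (at x)"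
    by (intro tendsto_intros)
  then have lim: "((\<lambda>x'. B x * norm (x - x')) \<longlongrightarrow> 0) (at x)" by simp
  have "\<forall>\<^sub>F x' in at x. norm (g x' - g x) \<le> B x * norm (x - x')"
    unfolding eventually_at
  proof (intro exI[of _ 1] conjI ballI impI)
    fix x' assume "x' \<noteq> x \<and> dist x' x < 1"
    then have "norm (x - x') \<le> 1" by (simp add: dist_norm norm_minus_commute)
    from assms[OF this] show "norm (g x' - g x) \<le> B x * norm (x - x')"
      by (simp only: norm_minus_commute[of "g x'"])
  qed simp
  then have "((\<lambda>x'. g x' - g x) \<longlongrightarrow> 0) (at x)"
    using lim by (rule Lim_null_comparison)
  then show "isCont g x"
    unfolding isCont_def by (rule LIM_zero_cancel)
qed

text \<open>The bound \<open>B\<close> enters the error of a Riemann sum linearly. When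
  \<open>g\<close> depends on a further parameter y, \<open>B\<close> can therefore carry decay in
  y, which is what convergence in Schwartz seminorms demands.\<close>

definition slowly_lipschitz :: "nat \<Rightarrow> real \<Rightarrow> (real^'n::finite \<Rightarrow> complex) \<Rightarrow> bool"
  where "slowly_lipschitz N B g \<longleftrightarrow> (\<forall>x. norm (g x) \<le> B * (1 + norm x) ^ N) \<and>
    (\<forall>x x'. norm (x - x') \<le> 1 \<longrightarrow> norm (g x - g x') \<le> B * norm (x - x') * (1 + norm x) ^ N)"

lemma slowly_lipschitz_continuous: "slowly_lipschitz N B g \<Longrightarrow> continuous_on UNIV g"
  unfolding slowly_lipschitz_def
  by (intro lipschitz_imp_continuous[where B = "\<lambda>x. B * (1 + norm x) ^ N"]) (auto simp: mult_ac)

lemma slowly_lipschitz_poly_growth: "slowly_lipschitz N B g \<Longrightarrow> poly_growth g"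
  unfolding slowly_lipschitz_def poly_growth_def by blast

text \<open>The point is the uniformity: \<open>K\<close> depends on \<open>\<phi>\<close> and
  \<open>N\<close> only. Inside the ball the error comes from the Lipschitz bounds of both factors
  over the distance to the node. Outside the ball 1 + |x| exceeds n + 1, and one surplus power of
  the weight gives the same rate.\<close>

lemma riemann_sum_error:
  fixes \<phi> :: "real^'n::finite \<Rightarrow> complex"
  assumes \<phi>: "\<phi> \<in> schwartz"
  shows "\<exists>K\<ge>0. \<forall>g B n. slowly_lipschitz N B g \<longrightarrow> CARD('n) \<le> Suc n \<longrightarrow>
    norm ((\<Sum>v\<in>grid n. of_real (grid_weight n v) * (\<phi> v * g v)) - (LINT x|lborel. \<phi> x * g x)) \<le> K * B / real (Suc n)"
proof -
  let ?m = "DIM(real^'n) + 2"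
  \<comment> \<open>The decay order is a budget: \<open>?m\<close> powers for integrability, one for
    the rate outside the ball, and \<open>N\<close> against the growth of \<open>g\<close>.\<close>
  obtain C1 where C1: "C1 > 0" "\<And>x. norm (\<phi> x) \<le> C1 / (1 + norm x) ^ (?m + 1 + N)"
    using schwartz_decay[OF \<phi>] by metis
  obtain C2 where C2: "C2 > 0" "\<And>x y. norm (x - y) \<le> 1 \<Longrightarrow> norm (\<phi> x - \<phi> y) \<le> C2 * norm (x - y) / (1 + norm x) ^ (?m + 1 + N)"
    using schwartz_lipschitz[OF \<phi>] by metis
  define I where "I = (LINT x::real^'n|lborel. 1 / (1 + norm x) ^ ?m)"
  have I0: "I \<ge> 0" unfolding I_def by (intro Bochner_Integration.integral_nonneg) auto
  let ?d = "real CARD('n)"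
  let ?c = "(C1 + C2 + C2) * ?d + C1"
  show ?thesis
  proof (intro exI[of _ "?c * I"] conjI allI impI)
    show "0 \<le> ?c * I" using C1(1) C2(1) I0 by simp
    fix g :: "real^'n \<Rightarrow> complex" and B :: real and n
    assume g: "slowly_lipschitz N B g" and n: "CARD('n) \<le> Suc n"
    note cont = slowly_lipschitz_continuous[OF g]
    have gm [measurable]: "g \<in> borel_measurable borel" using cont by (rule borel_measurable_continuous_onI)
    have g1: "norm (g x) \<le> B * (1 + norm x) ^ N" for x using g unfolding slowly_lipschitz_def by blast
    have g2: "norm (g x - g x') \<le> B * norm (x - x') * (1 + norm x) ^ N" if "norm (x - x') \<le> 1" for x x'
      using g that unfolding slowly_lipschitz_def by blast
    have B0: "B \<ge> 0" using order_trans[OF norm_ge_zero g1[of 0]] by simp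
    let ?P = "\<lambda>x. \<phi> x * g x"
    let ?Q = "\<lambda>x. indicator (cball 0 (real n)) x *\<^sub>R ?P (grid_round n x)"
    have intP: "integrable lborel ?P"
      using schwartz_integrable_poly[OF gm slowly_lipschitz_poly_growth[OF g] \<phi>] by (simp add: mult.commute)
    have "(\<Sum>v\<in>grid n. of_real (grid_weight n v) * (\<phi> v * g v)) - (LINT x|lborel. ?P x) = (LINT x|lborel. ?Q x - ?P x)"
      unfolding grid_sum_eq_integral(2)
      by (intro Bochner_Integration.integral_diff[symmetric] grid_sum_eq_integral(1) intP)
    moreover have "norm (LINT x|lborel. ?Q x - ?P x) \<le> (LINT x|lborel. (?c * B / real (Suc n)) * (1 / (1 + norm (x::real^'n)) ^ ?m))"
    proof (rule Bochner_Integration.integral_norm_bound_integral)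
      show "integrable lborel (\<lambda>x::real^'n. (?c * B / real (Suc n)) * (1 / (1 + norm x) ^ ?m))"
        by (intro integrable_mult_right integrable_decay) auto
      show "integrable lborel (\<lambda>x. ?Q x - ?P x)"
        by (intro Bochner_Integration.integrable_diff grid_sum_eq_integral(1) intP)
      fix x :: "real^'n"
      define w where "w = 1 + norm x"
      have w: "w \<ge> 1" unfolding w_def by simp
      then have w0: "w > 0" by linarith
      show "norm (?Q x - ?P x) \<le> (?c * B / real (Suc n)) * (1 / (1 + norm x) ^ ?m)"
      proof (cases "x \<in> cball 0 (real n)")
        case True
        let ?y = "grid_round n x"
        have d: "norm (x - ?y) \<le> ?d / real (Suc n)" by (rule grid_round_dist)
        \<comment> \<open>The assumption on \<open>n\<close> places the node within distance 1 of
          \<open>x\<close>, the range in which the Lipschitz bounds apply.\<close>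
        also have "\<dots> \<le> 1" using n by simp
        finally have d1: "norm (x - ?y) \<le> 1" .
        have dif: "norm (\<phi> x - \<phi> ?y) \<le> C2 * norm (x - ?y) / w ^ (?m + 1 + N)"
          using C2(2)[OF d1] by (simp add: w_def)
        have y: "norm (\<phi> ?y) \<le> (C1 + C2) / w ^ (?m + 1 + N)"
        proof -
          have "norm (\<phi> ?y) \<le> norm (\<phi> x) + norm (\<phi> x - \<phi> ?y)"
            using norm_triangle_ineq4[of "\<phi> x" "\<phi> x - \<phi> ?y"] by simp
          also have "\<dots> \<le> C1 / w ^ (?m + 1 + N) + C2 * 1 / w ^ (?m + 1 + N)"
            using C1(2)[of x] C2(1) d1 w0
            by (intro add_mono order_trans[OF dif] divide_right_mono mult_left_mono) (auto simp: w_def)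
          finally show ?thesis by (simp add: add_divide_distrib)
        qed
        have "norm (?Q x - ?P x) = norm ((\<phi> ?y - \<phi> x) * g x + \<phi> ?y * (g ?y - g x))"
          using True by (simp add: algebra_simps)
        also have "\<dots> \<le> norm (\<phi> x - \<phi> ?y) * norm (g x) + norm (\<phi> ?y) * norm (g x - g ?y)"
          by (intro norm_triangle_mono) (simp_all add: norm_mult norm_minus_commute)
        also have "\<dots> \<le> (C2 * norm (x - ?y) / w ^ (?m + 1 + N)) * (B * w ^ N) + ((C1 + C2) / w ^ (?m + 1 + N)) * (B * norm (x - ?y) * w ^ N)"
          using C1(1) C2(1) w0 B0 by (intro add_mono mult_mono dif y g1[of x, folded w_def] g2[OF d1, folded w_def]) auto
        also have "\<dots> = (C1 + C2 + C2) * B * norm (x - ?y) / w ^ (?m + 1)"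
          using w0 by (simp add: power_add field_simps)
        also have "\<dots> \<le> (C1 + C2 + C2) * B * (?d / real (Suc n)) / w ^ ?m"
          using C1(1) C2(1) B0 w w0
          by (intro frac_le mult_left_mono d power_increasing) auto
        also have "\<dots> \<le> (?c * B / real (Suc n)) * (1 / w ^ ?m)"
        proof -
          have "(C1 + C2 + C2) * B * (?d / real (Suc n)) \<le> ?c * B / real (Suc n)"
          proof -
            have "0 \<le> C1 * B" using C1(1) B0 by simp
            then have "(C1 + C2 + C2) * B * ?d \<le> ?c * B" by (simp add: algebra_simps)
            then show ?thesis by (simp add: divide_right_mono del: of_nat_Suc)
          qed
          from mult_right_mono[OF this, of "1 / w ^ ?m"] show ?thesis using w0 by simp
        qed
        finally show ?thesis by (simp add: w_def)
      next
        case False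
        then have nw: "real (Suc n) \<le> w" by (simp add: w_def)
        have "norm (?Q x - ?P x) = norm (\<phi> x) * norm (g x)" using False by (simp add: norm_mult)
        also have "\<dots> \<le> (C1 / w ^ (?m + 1 + N)) * (B * w ^ N)"
          using C1(1) w0 by (intro mult_mono C1(2)[of x, folded w_def] g1[of x, folded w_def]) auto
        also have "\<dots> = C1 * B / w * (1 / w ^ ?m)"
          using w0 by (simp add: power_add field_simps)
        also have "\<dots> \<le> (?c * B / real (Suc n)) * (1 / w ^ ?m)"
          using C1(1) C2(1) B0 nw w0
          by (intro mult_right_mono frac_le) (auto intro!: mult_right_mono mult_nonneg_nonneg)
        finally show ?thesis by (simp add: w_def)
      qed
    qed
    moreover have "(LINT x|lborel. (?c * B / real (Suc n)) * (1 / (1 + norm (x::real^'n)) ^ ?m)) = ?c * I * B / real (Suc n)"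
      unfolding I_def integral_mult_right_zero by (simp add: mult_ac)
    ultimately show "norm ((\<Sum>v\<in>grid n. of_real (grid_weight n v) * (\<phi> v * g v)) - (LINT x|lborel. \<phi> x * g x)) \<le> ?c * I * B / real (Suc n)"
      by simp
  qed
qed

subsection \<open>Tempered distributions with compact spectrum\<close>

lemma partial_deriv_lincomb:
  assumes f: "f \<in> schwartz" and g: "g \<in> schwartz"
  shows "partial_deriv i (\<lambda>x. f x + c * g x) = (\<lambda>x. partial_deriv i f x + c * partial_deriv i g x)"
proof
  fix x
  have D: "((\<lambda>x. f x + c * g x) has_derivative (\<lambda>h. frechet_derivative f (at x) h + c * frechet_derivative g (at x) h)) (at x)"
    by (intro has_derivative_add has_derivative_mult_right)
       (use schwartz_differentiable f g frechet_derivative_works in blast)+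
  show "partial_deriv i (\<lambda>x. f x + c * g x) x = partial_deriv i f x + c * partial_deriv i g x"
    unfolding partial_deriv_eqI[OF D] by (simp add: partial_deriv_def)
qed

lemma iter_deriv_lincomb:
  assumes f: "f \<in> schwartz" and g: "g \<in> schwartz"
  shows "iter_deriv is (\<lambda>x. f x + c * g x) = (\<lambda>x. iter_deriv is f x + c * iter_deriv is g x)"
  by (induction "is") (simp_all add: iter_deriv_Cons partial_deriv_lincomb schwartz_iter_deriv f g)

lemma iter_deriv_zero: "iter_deriv is (\<lambda>x. 0) = (\<lambda>x. 0)"
  using iter_deriv_lincomb[OF schwartz_zero schwartz_zero, of "is" "-1"] by simp

lemma iter_deriv_sum:
  assumes "\<And>v. v \<in> I \<Longrightarrow> f v \<in> schwartz"
  shows "iter_deriv is (\<lambda>x. \<Sum>v\<in>I. c v * f v x) = (\<lambda>x. \<Sum>v\<in>I. c v * iter_deriv is (f v) x)"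
  using assms
proof (induction I rule: infinite_finite_induct)
  case (insert v I)
  have "iter_deriv is (\<lambda>x. (\<Sum>v\<in>I. c v * f v x) + c v * f v x) = (\<lambda>x. (\<Sum>v\<in>I. c v * iter_deriv is (f v) x) + c v * iter_deriv is (f v) x)"
    using insert by (subst iter_deriv_lincomb) (auto intro!: schwartz_sum schwartz_scale)
  then show ?case using insert(1,2) by (simp add: add.commute)
qed (auto simp: iter_deriv_zero)

text \<open>The symbol belonging to an iterated derivative of the transform: differentiating
  \<open>fourier m\<close> in direction i multiplies \<open>m\<close> by -2 pi i xi_i.\<close>

definition multi_monomial :: "'n list \<Rightarrow> (real^'n \<Rightarrow> complex) \<Rightarrow> real^'n::finite \<Rightarrow> complex"
  where "multi_monomial is m = foldr (\<lambda>i g \<xi>. (- 2 * pi * \<i>) * of_real (\<xi> $ i) * g \<xi>) is m"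

lemma multi_monomial_Nil [simp]: "multi_monomial [] m = m"
  by (simp add: multi_monomial_def)

lemma multi_monomial_Cons:
  "multi_monomial (i # is) m = (\<lambda>\<xi>. (- 2 * pi * \<i>) * of_real (\<xi> $ i) * multi_monomial is m \<xi>)"
  by (simp add: multi_monomial_def)

lemma schwartz_multi_monomial: "m \<in> schwartz \<Longrightarrow> multi_monomial is m \<in> schwartz"
proof (induction "is")
  case (Cons i "is")
  then show ?case unfolding multi_monomial_Cons by (intro schwartz_coord_mult') auto
qed auto

lemma multi_monomial_mult: "multi_monomial is (\<lambda>\<xi>. m \<xi> * g \<xi>) = (\<lambda>\<xi>. multi_monomial is m \<xi> * g \<xi>)"
  by (induction "is") (simp_all add: multi_monomial_Cons mult.assoc)

lemma iter_deriv_fourier: "m \<in> schwartz \<Longrightarrow> iter_deriv is (fourier m) = fourier (multi_monomial is m)"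
proof (induction "is")
  case (Cons i "is")
  then show ?case
    by (simp only: iter_deriv_Cons multi_monomial_Cons partial_deriv_fourier schwartz_multi_monomial)
qed auto

text \<open>As a function of y, this is the test function on which a distribution must be evaluated
  to obtain, at the point x, the value of its image under the multiplier \<open>m\<close>.\<close>

definition fourier_kernel :: "(real^'n::finite \<Rightarrow> complex) \<Rightarrow> real^'n \<Rightarrow> real^'n \<Rightarrow> complex"
  where "fourier_kernel m x = (\<lambda>y. inv_fourier m (x - y))"

lemma schwartz_character: "m \<in> schwartz \<Longrightarrow> (\<lambda>\<xi>. m \<xi> * cis (2 * pi * (x \<bullet> \<xi>))) \<in> schwartz"
  using schwartz_modulate[of m "(2 * pi) *\<^sub>R x"] by (simp add: inner_commute mult_ac)

lemma fourier_character: "fourier (\<lambda>\<xi>. m \<xi> * cis (2 * pi * (x \<bullet> \<xi>))) = fourier_kernel m x"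
  unfolding fourier_kernel_def fourier_def inv_fourier_def
proof (intro ext Bochner_Integration.integral_cong refl)
  fix y \<xi>
  have "cis (- 2 * pi * (\<xi> \<bullet> y)) * cis (2 * pi * (x \<bullet> \<xi>)) = cis (2 * pi * ((x - y) \<bullet> \<xi>))"
    by (simp add: cis_mult inner_commute algebra_simps)
  then show "cis (- 2 * pi * (\<xi> \<bullet> y)) * (m \<xi> * cis (2 * pi * (x \<bullet> \<xi>))) = cis (2 * pi * ((x - y) \<bullet> \<xi>)) * m \<xi>"
    by (simp add: mult_ac)
qed

lemma schwartz_fourier_kernel: "m \<in> schwartz \<Longrightarrow> fourier_kernel m x \<in> schwartz"
  unfolding fourier_character[symmetric] by (intro schwartz_fourier schwartz_character)

section \<open>Tempered distributions evaluated on convolution kernels\<close>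

lemma temperedD:
  assumes "u \<in> tempered"
  shows tempered_add: "\<phi> \<in> schwartz \<Longrightarrow> \<psi> \<in> schwartz \<Longrightarrow> u (\<lambda>x. \<phi> x + \<psi> x) = u \<phi> + u \<psi>"
    and tempered_scale: "\<phi> \<in> schwartz \<Longrightarrow> u (\<lambda>x. c * \<phi> x) = c * u \<phi>"
  using assms unfolding tempered_def by blast+

lemma tempered_sum:
  assumes "u \<in> tempered" "\<And>i. i \<in> I \<Longrightarrow> \<phi> i \<in> schwartz"
  shows "u (\<lambda>x. \<Sum>i\<in>I. \<phi> i x) = (\<Sum>i\<in>I. u (\<phi> i))"
  using assms(2)
proof (induction I rule: infinite_finite_induct)
  case (insert i I)
  then show ?case
    using tempered_add[OF assms(1), of "\<phi> i" "\<lambda>x. \<Sum>i\<in>I. \<phi> i x"] by (simp add: schwartz_sum)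
qed (use tempered_scale[OF assms(1) schwartz_zero, of 0] in auto)

text \<open>\<open>schwartz_norm\<close> is a real supremum and says something only over a bounded
  set. In this form a termwise bound \<open>B\<close> on the weighted derivatives suffices, and it
  also supplies the boundedness.\<close>

lemma tempered_bound:
  fixes u :: "'n::finite distr"
  assumes "u \<in> tempered"
  obtains C N where "C \<ge> 0"
    "\<And>\<phi> B. \<phi> \<in> schwartz \<Longrightarrow> (\<And>is y. length is \<le> N \<Longrightarrow> (1 + norm y) ^ N * norm (iter_deriv is \<phi> y) \<le> B) \<Longrightarrow> norm (u \<phi>) \<le> C * B"
proof -
  obtain C N where C: "\<And>\<phi>. \<phi> \<in> schwartz \<Longrightarrow> norm (u \<phi>) \<le> C * schwartz_norm N \<phi>"
    using assms unfolding tempered_def by blast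
  have "norm (u \<phi>) \<le> \<bar>C\<bar> * B" if "\<phi> \<in> schwartz"
    and B: "\<And>is y. length is \<le> N \<Longrightarrow> (1 + norm y) ^ N * norm (iter_deriv is \<phi> y) \<le> B" for \<phi> B
  proof -
    let ?F = "\<lambda>(is, x). (1 + norm x) ^ N * norm (iter_deriv is \<phi> x)"
    let ?S = "{is::'n list. length is \<le> N} \<times> (UNIV :: (real^'n) set)"
    \<comment> \<open>This index makes the supremum range over a non-empty set and shows that the
      seminorm is non-negative, so that \<open>C\<close> may be replaced by its absolute
      value.\<close>
    have ne: "([], 0) \<in> ?S" by simp
    have "bdd_above (?F ` ?S)"
      using B by (intro bdd_aboveI[of _ B]) auto
    then have "?F ([], 0) \<le> schwartz_norm N \<phi>"
      unfolding schwartz_norm_def by (intro cSUP_upper ne)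
    moreover have "0 \<le> ?F ([], 0)" by simp
    ultimately have "0 \<le> schwartz_norm N \<phi>" by linarith
    moreover have "schwartz_norm N \<phi> \<le> B"
      unfolding schwartz_norm_def using B by (intro cSUP_least) (auto intro!: exI[of _ "[]"])
    ultimately show ?thesis
      by (intro order_trans[OF C[OF that(1)]] mult_mono) auto
  qed
  then show ?thesis using that[of "\<bar>C\<bar>" N] by auto
qed

text \<open>Submultiplicativity of the weight converts decay in x - y into decay in y and growth in
  x.\<close>

lemma kernel_slowly_lipschitz:
  fixes H :: "real^'n::finite \<Rightarrow> complex"
  assumes "H \<in> schwartz"
  shows "\<exists>C>0. \<forall>y. slowly_lipschitz N (C / (1 + norm y) ^ N) (\<lambda>x. H (x - y))"
proof -
  obtain C1 where C1: "C1 > 0" "\<And>x. norm (H x) \<le> C1 / (1 + norm x) ^ N"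
    using schwartz_decay[OF assms] by metis
  obtain C2 where C2: "C2 > 0" "\<And>x y. norm (x - y) \<le> 1 \<Longrightarrow> norm (H x - H y) \<le> C2 * norm (x - y) / (1 + norm x) ^ N"
    using schwartz_lipschitz[OF assms] by metis
  have w: "1 / (1 + norm (x - y)) ^ N \<le> (1 + norm x) ^ N / (1 + norm y) ^ N" for x y :: "real^'n"
  proof -
    have "(1 + norm y) ^ N \<le> ((1 + norm (x - y)) * (1 + norm x)) ^ N"
      using one_plus_norm_diff_le[of y x] by (intro power_mono) (auto simp: norm_minus_commute)
    moreover have "0 < (1 + norm y) ^ N" "0 < (1 + norm (x - y)) ^ N" by (simp_all add: add_pos_nonneg)
    ultimately show ?thesis unfolding power_mult_distrib by (simp add: pos_divide_le_eq pos_le_divide_eq mult.commute)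
  qed
  have "slowly_lipschitz N ((C1 + C2) / (1 + norm y) ^ N) (\<lambda>x. H (x - y))" for y
    unfolding slowly_lipschitz_def
  proof (intro conjI allI impI)
    fix x
    have "norm (H (x - y)) \<le> C1 * (1 / (1 + norm (x - y)) ^ N)" using C1(2)[of "x - y"] by simp
    also have "\<dots> \<le> (C1 + C2) * ((1 + norm x) ^ N / (1 + norm y) ^ N)"
      using C1(1) C2(1) by (intro mult_mono w) auto
    finally show "norm (H (x - y)) \<le> (C1 + C2) / (1 + norm y) ^ N * (1 + norm x) ^ N" by simp
    fix x' assume "norm (x - x') \<le> 1"
    then have "norm (H (x - y) - H (x' - y)) \<le> (C2 * norm (x - x')) * (1 / (1 + norm (x - y)) ^ N)"
      using C2(2)[of "x - y" "x' - y"] by simp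
    also have "\<dots> \<le> ((C1 + C2) * norm (x - x')) * ((1 + norm x) ^ N / (1 + norm y) ^ N)"
      using C1(1) C2(1) by (intro mult_mono w) auto
    finally show "norm (H (x - y) - H (x' - y)) \<le> (C1 + C2) / (1 + norm y) ^ N * norm (x - x') * (1 + norm x) ^ N"
      by (simp add: mult_ac)
  qed
  then show ?thesis using C1(1) C2(1) by (intro exI[of _ "C1 + C2"]) auto
qed

text \<open>Only finitely many lists have length at most \<open>N\<close>, so adding up their
  constants gives one constant for all derivatives that a seminorm of order \<open>N\<close>
  tests.\<close>

lemma kernel_slowly_lipschitz_uniform:
  fixes m :: "real^'n::finite \<Rightarrow> complex"
  assumes "m \<in> schwartz"
  obtains D where "D > 0"
    "\<And>is y. length is \<le> N \<Longrightarrow> slowly_lipschitz N (D / (1 + norm y) ^ N) (\<lambda>x. fourier_kernel (multi_monomial is m) x y)"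
proof -
  let ?L = "{is::'n list. length is \<le> N}"
  have "\<forall>is. \<exists>C>0. \<forall>y. slowly_lipschitz N (C / (1 + norm y) ^ N) (\<lambda>x. inv_fourier (multi_monomial is m) (x - y))"
    using kernel_slowly_lipschitz[OF schwartz_inv_fourier[OF schwartz_multi_monomial[OF assms]]] by blast
  then obtain C where C: "\<And>is. C is > 0"
    "\<And>is y. slowly_lipschitz N (C is / (1 + norm y) ^ N) (\<lambda>x. inv_fourier (multi_monomial is m) (x - y))"
    by metis
  have fin: "finite ?L" using finite_lists_length_le[of "UNIV :: 'n set" N] by simp
  have mono: "slowly_lipschitz N B' g" if "slowly_lipschitz N B g" "B \<le> B'" for B B' and g :: "real^'n \<Rightarrow> complex"
    using that unfolding slowly_lipschitz_def
    by (auto intro!: mult_right_mono elim!: order_trans[rotated] dest: spec)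
       (meson mult_right_mono norm_ge_zero order_trans zero_le_power add_nonneg_nonneg zero_le_one)+
  show ?thesis
  proof (rule that[of "\<Sum>is\<in>?L. C is"])
    show "0 < (\<Sum>is\<in>?L. C is)" using C(1) fin by (intro sum_pos) (auto intro!: exI[of _ "[]"])
    fix "is" :: "'n list" and y :: "real^'n" assume "length is \<le> N"
    then have "C is \<le> (\<Sum>is\<in>?L. C is)" using fin C(1) by (intro member_le_sum) (auto intro: less_imp_le)
    then show "slowly_lipschitz N ((\<Sum>is\<in>?L. C is) / (1 + norm y) ^ N) (\<lambda>x. fourier_kernel (multi_monomial is m) x y)"
      unfolding fourier_kernel_def by (intro mono[OF C(2)[of "is" y]] divide_right_mono) auto
  qed
qed

lemma iter_deriv_fourier_kernel:
  "m \<in> schwartz \<Longrightarrow> iter_deriv is (fourier_kernel m x) = fourier_kernel (multi_monomial is m) x"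
  unfolding fourier_character[symmetric]
  by (simp only: iter_deriv_fourier schwartz_character multi_monomial_mult)

text \<open>A seminorm of order \<open>N\<close> weighs the y-derivatives of the kernel by (1 +
  |y|)^N, exactly what their decay in y cancels. Growth and Lipschitz behaviour in x survive the
  evaluation, so x -> u(kernel) is continuous and of polynomial growth.\<close>

lemma tempered_kernel_slowly_lipschitz:
  fixes u :: "'n::finite distr"
  assumes u: "u \<in> tempered" and m: "m \<in> schwartz"
  obtains N B where "slowly_lipschitz N B (\<lambda>x. u (fourier_kernel m x))"
proof -
  obtain C N where C: "C \<ge> 0"
    "\<And>\<phi> B. \<phi> \<in> schwartz \<Longrightarrow> (\<And>is y. length is \<le> N \<Longrightarrow> (1 + norm y) ^ N * norm (iter_deriv is \<phi> y) \<le> B) \<Longrightarrow> norm (u \<phi>) \<le> C * B"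
    using tempered_bound[OF u] by blast
  obtain D where D: "D > 0"
    "\<And>is y. length is \<le> N \<Longrightarrow> slowly_lipschitz N (D / (1 + norm y) ^ N) (\<lambda>x. fourier_kernel (multi_monomial is m) x y)"
    using kernel_slowly_lipschitz_uniform[OF m, of N] by blast
  have p: "0 < (1 + norm y) ^ N" for y :: "real^'n" by (simp add: add_pos_nonneg)
  have "slowly_lipschitz N (C * D) (\<lambda>x. u (fourier_kernel m x))"
    unfolding slowly_lipschitz_def
  proof (intro conjI allI impI)
    fix x
    have "norm (u (fourier_kernel m x)) \<le> C * (D * (1 + norm x) ^ N)"
    proof (rule C(2)[OF schwartz_fourier_kernel[OF m]])
      fix "is" :: "'n list" and y :: "real^'n" assume "length is \<le> N"
      then have "norm (fourier_kernel (multi_monomial is m) x y) \<le> D / (1 + norm y) ^ N * (1 + norm x) ^ N"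
        using D(2) unfolding slowly_lipschitz_def by blast
      then show "(1 + norm y) ^ N * norm (iter_deriv is (fourier_kernel m x) y) \<le> D * (1 + norm x) ^ N"
        using p[of y] unfolding iter_deriv_fourier_kernel[OF m] by (simp add: field_simps)
    qed
    then show "norm (u (fourier_kernel m x)) \<le> C * D * (1 + norm x) ^ N" by (simp add: mult_ac)
    fix x' assume x': "norm (x - x') \<le> 1"
    have S: "fourier_kernel m x \<in> schwartz" "fourier_kernel m x' \<in> schwartz" by (intro schwartz_fourier_kernel m)+
    have lin: "u (fourier_kernel m x) - u (fourier_kernel m x') = u (\<lambda>y. fourier_kernel m x y + (-1) * fourier_kernel m x' y)"
      using tempered_add[OF u S(1) schwartz_scale[OF S(2)], of "-1"] tempered_scale[OF u S(2), of "-1"] by simp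
    have "norm (u (\<lambda>y. fourier_kernel m x y + (-1) * fourier_kernel m x' y)) \<le> C * (D * norm (x - x') * (1 + norm x) ^ N)"
    proof (rule C(2))
      show "(\<lambda>y. fourier_kernel m x y + (-1) * fourier_kernel m x' y) \<in> schwartz"
        by (intro schwartz_add schwartz_scale S)
      fix "is" :: "'n list" and y :: "real^'n" assume "length is \<le> N"
      then have "norm (fourier_kernel (multi_monomial is m) x y - fourier_kernel (multi_monomial is m) x' y) \<le> D / (1 + norm y) ^ N * norm (x - x') * (1 + norm x) ^ N"
        using D(2) x' unfolding slowly_lipschitz_def by blast
      then show "(1 + norm y) ^ N * norm (iter_deriv is (\<lambda>y. fourier_kernel m x y + (-1) * fourier_kernel m x' y) y) \<le> D * norm (x - x') * (1 + norm x) ^ N"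
        using p[of y] unfolding iter_deriv_lincomb[OF S] iter_deriv_fourier_kernel[OF m] by (simp add: field_simps)
    qed
    then show "norm (u (fourier_kernel m x) - u (fourier_kernel m x')) \<le> C * D * norm (x - x') * (1 + norm x) ^ N"
      unfolding lin by (simp add: mult_ac)
  qed
  then show ?thesis using that by blast
qed

text \<open>Riemann sums of the kernels are evaluated in two ways. By
  \<open>riemann_sum_error\<close>, uniformly in y and in the derivatives, they converge in the
  Schwartz seminorm that controls \<open>u\<close>. By linearity their images are Riemann sums of
  the scalar function x -> u(kernel), to which the same lemma applies.\<close>

theorem tempered_conv:
  fixes u :: "'n::finite distr"
  assumes u: "u \<in> tempered" and m: "m \<in> schwartz" and \<phi>: "\<phi> \<in> schwartz"
  shows "u (fourier (\<lambda>\<xi>. m \<xi> * inv_fourier \<phi> \<xi>)) = (LINT x|lborel. \<phi> x * u (fourier_kernel m x))"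
proof -
  let ?\<Phi> = "fourier (\<lambda>\<xi>. m \<xi> * inv_fourier \<phi> \<xi>)"
  let ?G = "\<lambda>x. u (fourier_kernel m x)"
  let ?c = "\<lambda>n v. of_real (grid_weight n v) * \<phi> v"
  define S where "S = (\<lambda>n y. \<Sum>v\<in>grid n. ?c n v * fourier_kernel m v y)"
  have \<Phi>: "?\<Phi> \<in> schwartz" by (intro schwartz_fourier schwartz_mult m schwartz_inv_fourier \<phi>)
  have S: "S n \<in> schwartz" for n
    unfolding S_def by (intro schwartz_sum schwartz_scale schwartz_fourier_kernel m)
  obtain C N where C: "C \<ge> 0"
    "\<And>\<phi> B. \<phi> \<in> schwartz \<Longrightarrow> (\<And>is y. length is \<le> N \<Longrightarrow> (1 + norm y) ^ N * norm (iter_deriv is \<phi> y) \<le> B) \<Longrightarrow> norm (u \<phi>) \<le> C * B"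
    using tempered_bound[OF u] by blast
  obtain D where D: "D > 0"
    "\<And>is y. length is \<le> N \<Longrightarrow> slowly_lipschitz N (D / (1 + norm y) ^ N) (\<lambda>x. fourier_kernel (multi_monomial is m) x y)"
    using kernel_slowly_lipschitz_uniform[OF m, of N] by blast
  obtain K where K: "K \<ge> 0" "\<And>g B n. slowly_lipschitz N B g \<Longrightarrow> CARD('n) \<le> Suc n \<Longrightarrow>
    norm ((\<Sum>v\<in>grid n. of_real (grid_weight n v) * (\<phi> v * g v)) - (LINT x|lborel. \<phi> x * g x)) \<le> K * B / real (Suc n)"
    using riemann_sum_error[OF \<phi>, of N] by blast
  have p: "0 < (1 + norm y) ^ N" for y :: "real^'n" by (simp add: add_pos_nonneg)
  have lim0: "(\<lambda>n. c / real (Suc n)) \<longlonglongrightarrow> 0" for c :: real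
    using tendsto_mult_left[OF LIMSEQ_inverse_real_of_nat, of c] by (simp add: divide_inverse del: of_nat_Suc)
  have ev: "\<forall>\<^sub>F n in sequentially. CARD('n) \<le> Suc n"
    by (rule eventually_sequentiallyI[of "CARD('n)"]) simp
  have "norm (u (S n) - u ?\<Phi>) \<le> C * (K * D) / real (Suc n)" if n: "CARD('n) \<le> Suc n" for n
  proof -
    have "u (S n) - u ?\<Phi> = u (\<lambda>y. S n y + (-1) * ?\<Phi> y)"
      using tempered_add[OF u S schwartz_scale[OF \<Phi>], of n "-1"] tempered_scale[OF u \<Phi>, of "-1"] by simp
    moreover have "norm (u (\<lambda>y. S n y + (-1) * ?\<Phi> y)) \<le> C * (K * D / real (Suc n))"
    proof (rule C(2))
      show "(\<lambda>y. S n y + (-1) * ?\<Phi> y) \<in> schwartz"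
        by (intro schwartz_add schwartz_scale S \<Phi>)
      fix "is" :: "'n list" and y :: "real^'n" assume len: "length is \<le> N"
      have "iter_deriv is (S n) y = (\<Sum>v\<in>grid n. of_real (grid_weight n v) * (\<phi> v * fourier_kernel (multi_monomial is m) v y))"
        unfolding S_def
        by (subst iter_deriv_sum) (simp_all add: schwartz_fourier_kernel m iter_deriv_fourier_kernel mult.assoc)
      \<comment> \<open>Derivatives act on the symbol only, so each derivative of the limit is an
        integral of the same type with \<open>multi_monomial is m\<close> in place of
        \<open>m\<close>.\<close>
      moreover have "iter_deriv is ?\<Phi> y = (LINT x|lborel. \<phi> x * fourier_kernel (multi_monomial is m) x y)"
      proof -
        have "iter_deriv is ?\<Phi> = fourier (\<lambda>\<xi>. multi_monomial is m \<xi> * inv_fourier \<phi> \<xi>)"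
          by (subst iter_deriv_fourier) (auto simp: multi_monomial_mult intro!: schwartz_mult m schwartz_inv_fourier \<phi>)
        then show ?thesis
          by (simp only: fourier_conv[OF \<phi> schwartz_multi_monomial[OF m]] fourier_kernel_def)
      qed
      ultimately have "norm (iter_deriv is (\<lambda>y. S n y + (-1) * ?\<Phi> y) y) \<le> K * (D / (1 + norm y) ^ N) / real (Suc n)"
        unfolding iter_deriv_lincomb[OF S \<Phi>] using K(2)[OF D(2)[OF len, of y] n] by simp
      then have "(1 + norm y) ^ N * norm (iter_deriv is (\<lambda>y. S n y + (-1) * ?\<Phi> y) y) \<le> (1 + norm y) ^ N * (K * (D / (1 + norm y) ^ N) / real (Suc n))"
        using p[of y] by (intro mult_left_mono) auto
      also have "P * (K * (D / P) / real (Suc n)) = K * D / real (Suc n)" if "P > 0" for P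
        using that by (simp del: of_nat_Suc)
      from this[OF p] have "(1 + norm y) ^ N * (K * (D / (1 + norm y) ^ N) / real (Suc n)) = K * D / real (Suc n)" .
      finally show "(1 + norm y) ^ N * norm (iter_deriv is (\<lambda>y. S n y + (-1) * ?\<Phi> y) y) \<le> K * D / real (Suc n)" .
    qed
    ultimately show ?thesis by simp
  qed
  then have "(\<lambda>n. u (S n) - u ?\<Phi>) \<longlonglongrightarrow> 0"
    by (intro Lim_null_comparison[OF eventually_mono[OF ev] lim0])
  then have lim1: "(\<lambda>n. u (S n)) \<longlonglongrightarrow> u ?\<Phi>" by (rule LIM_zero_cancel)
  obtain N' B' where G: "slowly_lipschitz N' B' ?G"
    using tempered_kernel_slowly_lipschitz[OF u m] by blast
  obtain K' where K': "K' \<ge> 0" "\<And>g B n. slowly_lipschitz N' B g \<Longrightarrow> CARD('n) \<le> Suc n \<Longrightarrow>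
    norm ((\<Sum>v\<in>grid n. of_real (grid_weight n v) * (\<phi> v * g v)) - (LINT x|lborel. \<phi> x * g x)) \<le> K' * B / real (Suc n)"
    using riemann_sum_error[OF \<phi>, of N'] by blast
  \<comment> \<open>Linearity over the finite grid produces a Riemann sum for the function
    \<open>?G\<close>.\<close>
  have uS: "u (S n) = (\<Sum>v\<in>grid n. of_real (grid_weight n v) * (\<phi> v * ?G v))" for n
    unfolding S_def
    by (subst tempered_sum[OF u])
       (intro schwartz_scale schwartz_fourier_kernel m, simp only: tempered_scale[OF u schwartz_fourier_kernel[OF m]], simp only: mult.assoc)
  have "(\<lambda>n. u (S n) - (LINT x|lborel. \<phi> x * ?G x)) \<longlonglongrightarrow> 0"
    unfolding uS by (intro Lim_null_comparison[OF eventually_mono[OF ev] lim0[of "K' * B'"]] K'(2)[OF G])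
  then have "(\<lambda>n. u (S n)) \<longlonglongrightarrow> (LINT x|lborel. \<phi> x * ?G x)" by (rule LIM_zero_cancel)
  with lim1 show ?thesis by (rule LIMSEQ_unique)
qed

text \<open>Take the kernel of \<open>\<eta>\<close> as test function in
  \<open>tempered_conv\<close>. Its inverse transform is \<open>\<eta>\<close> times a character,
  and multiplication by \<open>m\<close> then leaves the kernel of \<open>m\<close> itself.\<close>

lemma kernel_reproducing:
  fixes u :: "'n::finite distr"
  assumes u: "u \<in> tempered" and m: "m \<in> schwartz" and \<eta>: "\<eta> \<in> schwartz"
    and m\<eta>: "\<And>\<xi>. m \<xi> * \<eta> \<xi> = m \<xi>"
  shows "u (fourier_kernel m x) = (LINT y|lborel. inv_fourier \<eta> (x - y) * u (fourier_kernel m y))"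
proof -
  let ?\<phi> = "fourier_kernel \<eta> x"
  have "inv_fourier ?\<phi> = (\<lambda>\<xi>. \<eta> \<xi> * cis (2 * pi * (x \<bullet> \<xi>)))"
    unfolding fourier_character[symmetric] by (intro inv_fourier_fourier schwartz_character \<eta>)
  then have "fourier (\<lambda>\<xi>. m \<xi> * inv_fourier ?\<phi> \<xi>) = fourier_kernel m x"
    by (simp add: mult.assoc[symmetric] m\<eta> fourier_character)
  then have "u (fourier_kernel m x) = u (fourier (\<lambda>\<xi>. m \<xi> * inv_fourier ?\<phi> \<xi>))" by simp
  also have "\<dots> = (LINT y|lborel. ?\<phi> y * u (fourier_kernel m y))"
    by (intro tempered_conv u m schwartz_fourier_kernel \<eta>)
  finally show ?thesis by (simp add: fourier_kernel_def)
qed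

lemma inv_fourier_translate:
  fixes m :: "real^'n::finite \<Rightarrow> complex"
  assumes "m \<in> schwartz"
  shows "inv_fourier (\<lambda>\<xi>. m (\<xi> - a)) z = cis (2 * pi * (z \<bullet> a)) * inv_fourier m z"
proof -
  have [measurable]: "m \<in> borel_measurable borel" using assms schwartz_measurable by blast
  have "inv_fourier (\<lambda>\<xi>. m (\<xi> - a)) z = (LINT \<xi>|lborel. cis (2 * pi * (z \<bullet> (a + \<xi>))) * m (a + \<xi> - a))"
    unfolding inv_fourier_def by (subst lborel_integral_translate[where t = a, symmetric]) auto
  also have "\<dots> = (LINT \<xi>|lborel. cis (2 * pi * (z \<bullet> a)) * (cis (2 * pi * (z \<bullet> \<xi>)) * m \<xi>))"
    by (intro Bochner_Integration.integral_cong) (simp_all add: inner_add_right distrib_left cis_mult[symmetric] mult.assoc)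
  finally show ?thesis by (simp add: inv_fourier_def)
qed

lemma distr_box:
  assumes "u \<in> tempered" "\<sigma> \<in> schwartz" "\<phi> \<in> schwartz"
  shows "box_op \<sigma> k u \<phi> = u (fourier (\<lambda>\<xi>. \<sigma> (\<xi> - lattice_pt k) * inv_fourier \<phi> \<xi>))"
  using assms schwartz_inv_fourier[of \<phi>] schwartz_mult[OF schwartz_translate[of \<sigma> "lattice_pt k"] schwartz_inv_fourier[of \<phi>]]
  by (simp add: box_op_def distr_inv_fourier_def distr_mult_def distr_fourier_def)

section \<open>Uniqueness of the continuous function representing a distribution\<close>

lemma continuous_integral_pos:
  fixes b :: "'a::euclidean_space \<Rightarrow> real"
  assumes "continuous_on UNIV b" "integrable lborel b" "\<And>x. b x \<ge> 0" "b a > 0"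
  shows "(LINT x|lborel. b x) > 0"
proof -
  have "isCont b a" using assms(1) by (simp add: continuous_on_eq_continuous_at)
  then obtain r where r: "r > 0" "\<And>x. dist x a < r \<Longrightarrow> dist (b x) (b a) < b a / 2"
    unfolding continuous_at_eps_delta using assms(4) by (metis half_gt_zero)
  have ge: "b x \<ge> b a / 2 * indicator (ball a r) x" for x
    using r(2)[of x] assms(3)[of x] by (auto simp: indicator_def dist_real_def dist_commute abs_less_iff split: if_splits) (smt (verit) field_sum_of_halves)
  have "0 < b a / 2 * measure lborel (ball a r)" using assms(4) r(1) by simp
  also have "\<dots> = (LINT x|lborel. b a / 2 * indicator (ball a r) x)" by simp
  also have "\<dots> \<le> (LINT x|lborel. b x)"
  proof (intro integral_mono assms ge)
    show "integrable lborel (\<lambda>x. b a / 2 * indicator (ball a r) x)"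
      using emeasure_lborel_ball_finite[of a r] by (intro integrable_mult_right integrable_real_indicator) auto
  qed
  finally show ?thesis .
qed

text \<open>The test functions are copies of \<open>b\<close> shrinking to \<open>x0\<close>.\<close>

lemma continuous_eq_zeroI:
  fixes d :: "real^'n::finite \<Rightarrow> complex" and b :: "real^'n \<Rightarrow> real"
  assumes d: "continuous_on UNIV d"
    and b: "(\<lambda>x. of_real (b x)) \<in> schwartz" "\<And>x. b x \<ge> 0" "b 0 > 0" "\<And>x. norm x > R \<Longrightarrow> b x = 0"
    and int: "\<And>\<phi>. \<phi> \<in> schwartz \<Longrightarrow> integrable lborel (\<lambda>x. d x * \<phi> x)"
    and zero: "\<And>\<phi>. \<phi> \<in> schwartz \<Longrightarrow> (LINT x|lborel. d x * \<phi> x) = 0"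
  shows "d x0 = 0"
proof -
  have bi: "integrable lborel b"
    using schwartz_integrable[OF b(1)] by (simp add: complex_of_real_integrable_eq)
  have bc: "continuous_on UNIV b"
    using continuous_on_Re[OF schwartz_continuous[OF b(1)]] by simp
  have [measurable]: "d \<in> borel_measurable borel" "b \<in> borel_measurable borel"
    using d bc by (auto intro: borel_measurable_continuous_onI)
  define I where "I = (LINT x|lborel. b x)"
  have I: "I > 0" unfolding I_def by (intro continuous_integral_pos[OF bc bi b(2,3)])
  have "norm (d x0) \<le> e" if e: "e > 0" for e
  proof -
    have "isCont d x0" using d by (simp add: continuous_on_eq_continuous_at)
    then obtain r where r: "r > 0" "\<And>x. dist x x0 < r \<Longrightarrow> dist (d x) (d x0) < e"
      unfolding continuous_at_eps_delta using e by metis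
    \<comment> \<open>With this scale the support radius t |R| of the shrunken bump stays below
      \<open>r\<close>; the added 1 excludes a vanishing denominator.\<close>
    define t where "t = r / (\<bar>R\<bar> + 1)"
    have t: "t > 0" unfolding t_def using r by simp
    have S: "(\<lambda>x. complex_of_real (b ((1 / t) *\<^sub>R (x - x0)))) \<in> schwartz"
      using schwartz_affine[OF b(1), of "1 / t" 1 "- ((1 / t) *\<^sub>R x0)"] t by (simp add: scaleR_diff_right)
    have "0 = (LINT x|lborel. d x * complex_of_real (b ((1 / t) *\<^sub>R (x - x0))))"
      using zero[OF S] by simp
    also have "\<dots> = \<bar>t\<bar> ^ DIM(real^'n) *\<^sub>R (LINT z|lborel. d (x0 + t *\<^sub>R z) * complex_of_real (b ((1 / t) *\<^sub>R (x0 + t *\<^sub>R z - x0))))"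
      using t by (intro lborel_integral_affine) auto
    finally have z: "(LINT z|lborel. d (x0 + t *\<^sub>R z) * complex_of_real (b z)) = 0"
      using t by simp
    have close: "norm (d x0 * of_real (b z) - d (x0 + t *\<^sub>R z) * of_real (b z)) \<le> e * b z" for z
    proof (cases "norm z > R")
      case False
      have "dist (x0 + t *\<^sub>R z) x0 = t * norm z" using t by (simp add: dist_norm)
      also have "\<dots> \<le> t * \<bar>R\<bar>" using False t by (intro mult_left_mono) auto
      also have "\<dots> < r" using r(1) by (simp add: t_def field_simps)
      finally have "dist (d (x0 + t *\<^sub>R z)) (d x0) < e" by (rule r(2))
      then have "norm (d x0 - d (x0 + t *\<^sub>R z)) * b z \<le> e * b z"
        using b(2)[of z] by (intro mult_right_mono) (auto simp: dist_norm norm_minus_commute)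
      then show ?thesis using b(2)[of z] by (simp add: norm_mult flip: left_diff_distrib)
    qed (simp add: b(4))
    have i1: "integrable lborel (\<lambda>z. d x0 * complex_of_real (b z))"
      using schwartz_integrable[OF b(1)] by simp
    have i2: "integrable lborel (\<lambda>z. d (x0 + t *\<^sub>R z) * complex_of_real (b z))"
    proof (rule Bochner_Integration.integrable_bound)
      show "integrable lborel (\<lambda>z. (norm (d x0) + e) * b z)" using bi by simp
      show "AE z in lborel. norm (d (x0 + t *\<^sub>R z) * complex_of_real (b z)) \<le> norm ((norm (d x0) + e) * b z)"
      proof (rule AE_I2)
        fix z
        have "norm (d (x0 + t *\<^sub>R z) * complex_of_real (b z)) \<le> norm (d x0 * of_real (b z)) + norm (d x0 * of_real (b z) - d (x0 + t *\<^sub>R z) * of_real (b z))"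
          using norm_triangle_ineq4[of "d x0 * of_real (b z)" "d x0 * of_real (b z) - d (x0 + t *\<^sub>R z) * of_real (b z)"] by simp
        also have "\<dots> \<le> norm (d x0) * b z + e * b z"
          using close[of z] b(2)[of z] by (simp add: norm_mult)
        finally show "norm (d (x0 + t *\<^sub>R z) * complex_of_real (b z)) \<le> norm ((norm (d x0) + e) * b z)"
          using b(2)[of z] e by (simp add: abs_mult distrib_right)
      qed
    qed measurable
    have "norm (LINT z|lborel. d x0 * of_real (b z) - d (x0 + t *\<^sub>R z) * of_real (b z)) \<le> (LINT z|lborel. e * b z)"
      using i1 i2 bi close by (intro Bochner_Integration.integral_norm_bound_integral) auto
    also have "(LINT z|lborel. d x0 * of_real (b z) - d (x0 + t *\<^sub>R z) * of_real (b z)) = d x0 * of_real I"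
      using i1 i2 z by (subst Bochner_Integration.integral_diff) (auto simp: I_def)
    finally have "norm (d x0) * I \<le> e * I" using I by (simp add: norm_mult I_def)
    then show ?thesis using I by simp
  qed
  note le = this
  have "norm (d x0) \<le> 0"
    by (rule field_le_epsilon) (simp add: le)
  then show ?thesis by simp
qed

text \<open>A definite description requires uniqueness, which \<open>continuous_eq_zeroI\<close>
  gives for the difference of two representatives. The price is one non-negative bump
  \<open>b\<close> of compact support; later it is obtained from the partition function.\<close>

lemma function_of_eqI:
  fixes u :: "'n::finite distr"
  assumes g: "continuous_on UNIV g" "\<And>\<phi>. \<phi> \<in> schwartz \<Longrightarrow> integrable lborel (\<lambda>x. g x * \<phi> x)"
      "\<And>\<phi>. \<phi> \<in> schwartz \<Longrightarrow> u \<phi> = (LINT x|lborel. g x * \<phi> x)"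
    and b: "(\<lambda>x. of_real (b x)) \<in> schwartz" "\<And>x::real^'n. b x \<ge> (0::real)" "b 0 > 0" "\<And>x. norm x > R \<Longrightarrow> b x = 0"
  shows "function_of u = g"
  unfolding function_of_def
proof (rule the_equality)
  fix h
  assume h: "continuous_on UNIV h \<and> (\<forall>\<phi>\<in>schwartz. integrable lborel (\<lambda>x. h x * \<phi> x) \<and> u \<phi> = (LINT x|lborel. h x * \<phi> x))"
  have "h x - g x = 0" for x
  proof (rule continuous_eq_zeroI[OF _ b])
    show "continuous_on UNIV (\<lambda>x. h x - g x)" using g h by (intro continuous_on_diff) auto
    fix \<phi> :: "real^'n \<Rightarrow> complex" assume \<phi>: "\<phi> \<in> schwartz"
    show "integrable lborel (\<lambda>x. (h x - g x) * \<phi> x)"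
      using g h \<phi> unfolding left_diff_distrib by (intro Bochner_Integration.integrable_diff) auto
    show "(LINT x|lborel. (h x - g x) * \<phi> x) = 0"
      using g h \<phi> unfolding left_diff_distrib by (subst Bochner_Integration.integral_diff) force+
  qed
  then show "h = g" by (simp add: fun_eq_iff)
qed (use g in auto)

section \<open>Distributions given by Schwartz functions\<close>

definition distr_of :: "(real^'n::finite \<Rightarrow> complex) \<Rightarrow> 'n distr"
  where "distr_of g = (\<lambda>\<phi>\<in>schwartz. LINT x|lborel. g x * \<phi> x)"

lemma schwartz_prod_integrable: "f \<in> schwartz \<Longrightarrow> g \<in> schwartz \<Longrightarrow> integrable lborel (\<lambda>x. f x * g x)"
  using schwartz_integrable[OF schwartz_mult] .

lemma distr_of_tempered:
  fixes g :: "real^'n::finite \<Rightarrow> complex"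
  assumes g: "g \<in> schwartz"
  shows "distr_of g \<in> tempered"
proof -
  have "norm (distr_of g \<phi>) \<le> (LINT x|lborel. norm (g x)) * schwartz_norm 0 \<phi>" if \<phi>: "\<phi> \<in> schwartz" for \<phi>
  proof -
    have le: "norm (\<phi> x) \<le> schwartz_norm 0 \<phi>" for x
    proof -
      obtain C where "\<And>x. norm (\<phi> x) \<le> C" using schwartz_bounded[OF \<phi>, of 0] by auto
      then have "bdd_above ((\<lambda>(is, x). (1 + norm x) ^ 0 * norm (iter_deriv is \<phi> x)) ` ({is::'n list. length is \<le> 0} \<times> UNIV))"
        by (intro bdd_aboveI[of _ C]) auto
      from cSUP_upper[OF _ this, of "([], x)"] show ?thesis by (simp add: schwartz_norm_def)
    qed
    have "norm (LINT x|lborel. g x * \<phi> x) \<le> (LINT x|lborel. norm (g x) * schwartz_norm 0 \<phi>)"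
      using schwartz_prod_integrable[OF g \<phi>] schwartz_integrable[OF g] le
      by (intro Bochner_Integration.integral_norm_bound_integral) (auto simp: norm_mult intro!: mult_left_mono)
    then show ?thesis using \<phi> by (simp add: distr_of_def)
  qed
  moreover have "distr_of g (\<lambda>x. \<phi> x + \<psi> x) = distr_of g \<phi> + distr_of g \<psi>" if "\<phi> \<in> schwartz" "\<psi> \<in> schwartz" for \<phi> \<psi>
    using that schwartz_add[OF that] schwartz_prod_integrable[OF g that(1)] schwartz_prod_integrable[OF g that(2)]
    by (simp add: distr_of_def distrib_left)
  moreover have "distr_of g (\<lambda>x. c * \<phi> x) = c * distr_of g \<phi>" if "\<phi> \<in> schwartz" for \<phi> c
    using that schwartz_scale[OF that, of c] by (simp add: distr_of_def mult.left_commute)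
  moreover have "distr_of g \<in> extensional schwartz" by (simp add: distr_of_def)
  ultimately show ?thesis unfolding tempered_def by blast
qed

text \<open>Two uses of \<open>fourier_mult_formula\<close> with the inversion theorem in between:
  on Schwartz functions the transposed definition of the box operator becomes multiplication of the
  spectrum.\<close>

lemma box_op_distr_of:
  fixes \<Psi> :: "real^'n::finite \<Rightarrow> complex"
  assumes \<Psi>: "\<Psi> \<in> schwartz" and \<sigma>: "\<sigma> \<in> schwartz" and \<phi>: "\<phi> \<in> schwartz"
  shows "box_op \<sigma> k (distr_of (inv_fourier \<Psi>)) \<phi> = (LINT x|lborel. inv_fourier (\<lambda>\<xi>. \<sigma> (\<xi> - lattice_pt k) * \<Psi> \<xi>) x * \<phi> x)"
proof -
  let ?\<sigma> = "\<lambda>\<xi>. \<sigma> (\<xi> - lattice_pt k)"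
  have s: "?\<sigma> \<in> schwartz" by (intro schwartz_translate \<sigma>)
  have m: "(\<lambda>\<xi>. ?\<sigma> \<xi> * inv_fourier \<phi> \<xi>) \<in> schwartz" by (intro schwartz_mult s schwartz_inv_fourier \<phi>)
  have "box_op \<sigma> k (distr_of (inv_fourier \<Psi>)) \<phi> = (LINT x|lborel. inv_fourier \<Psi> x * fourier (\<lambda>\<xi>. ?\<sigma> \<xi> * inv_fourier \<phi> \<xi>) x)"
    unfolding distr_box[OF distr_of_tempered[OF schwartz_inv_fourier[OF \<Psi>]] \<sigma> \<phi>]
    using schwartz_fourier[OF m] by (simp add: distr_of_def)
  also have "\<dots> = (LINT x|lborel. fourier (inv_fourier \<Psi>) x * (?\<sigma> x * inv_fourier \<phi> x))"
    by (intro fourier_mult_formula[symmetric] schwartz_inv_fourier \<Psi> m)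
  also have "\<dots> = (LINT x|lborel. (?\<sigma> x * \<Psi> x) * inv_fourier \<phi> x)"
    by (simp add: fourier_inv_fourier[OF \<Psi>] mult_ac)
  also have "\<dots> = (LINT x|lborel. fourier (inv_fourier (\<lambda>x. ?\<sigma> x * \<Psi> x)) x * inv_fourier \<phi> x)"
    by (subst fourier_inv_fourier) (auto intro!: schwartz_mult s \<Psi>)
  also have "\<dots> = (LINT x|lborel. inv_fourier (\<lambda>x. ?\<sigma> x * \<Psi> x) x * fourier (inv_fourier \<phi>) x)"
    by (intro fourier_mult_formula schwartz_inv_fourier schwartz_mult s \<Psi> \<phi>)
  finally show ?thesis by (simp add: fourier_inv_fourier[OF \<phi>])
qed

subsection \<open>Quasi-norms\<close>

lemma ennreal_powr_ennreal [simp]: "0 \<le> x \<Longrightarrow> ennreal_powr (ennreal x) r = ennreal (x powr r)"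
  by (simp add: ennreal_powr_def)

lemma ennreal_powr_top [simp]: "ennreal_powr top r = top"
  by (simp add: ennreal_powr_def)

lemma ennreal_powr_0 [simp]: "ennreal_powr 0 r = 0"
  by (simp add: ennreal_powr_def)

lemma ennreal_powr_one [simp]: "ennreal_powr 1 r = 1"
  by (simp add: ennreal_powr_def)

lemma ennreal_powr_exp_one [simp]: "ennreal_powr a 1 = a"
  by (cases a) (auto simp: top_ennreal_def[symmetric] infinity_ennreal_def)

lemma ennreal_powr_mono: "a \<le> b \<Longrightarrow> 0 \<le> r \<Longrightarrow> ennreal_powr a r \<le> ennreal_powr b r"
  by (cases a; cases b) (auto simp: top_unique intro!: ennreal_leI powr_mono2)

lemma ennreal_powr_mult: "0 < r \<Longrightarrow> ennreal_powr (a * b) r = ennreal_powr a r * ennreal_powr b r"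
proof (cases a; cases b)
  assume "0 < r"
  fix x y assume "a = ennreal x" "0 \<le> x" "b = ennreal y" "0 \<le> y"
  then show ?thesis by (simp add: ennreal_mult[symmetric] powr_mult)
next
  assume r: "0 < r"
  fix x assume x: "a = ennreal x" "0 \<le> x" and b: "b = top"
  show ?thesis using x b r by (cases "x = 0") (auto simp: ennreal_mult_top ennreal_eq_0_iff powr_non_neg)
next
  assume r: "0 < r"
  fix x assume x: "b = ennreal x" "0 \<le> x" and b: "a = top"
  show ?thesis using x b r by (cases "x = 0") (auto simp: ennreal_top_mult ennreal_eq_0_iff powr_non_neg)
qed auto

lemma ennreal_powr_powr: "ennreal_powr (ennreal_powr a r) s = ennreal_powr a (r * s)"
  by (cases a) (auto simp: powr_powr)

lemma ennreal_powr_add: "0 < r \<Longrightarrow> 0 < s \<Longrightarrow> ennreal_powr a (r + s) = ennreal_powr a r * ennreal_powr a s"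
  by (cases a) (auto simp: powr_add ennreal_mult)

lemma ennreal_powr_le_iff:
  assumes "0 < r"
  shows "ennreal_powr a r \<le> b \<longleftrightarrow> a \<le> ennreal_powr b (1 / r)"
proof
  assume "ennreal_powr a r \<le> b"
  then have "ennreal_powr (ennreal_powr a r) (1 / r) \<le> ennreal_powr b (1 / r)"
    using assms by (intro ennreal_powr_mono) auto
  then show "a \<le> ennreal_powr b (1 / r)" using assms by (simp add: ennreal_powr_powr)
next
  assume "a \<le> ennreal_powr b (1 / r)"
  then have "ennreal_powr a r \<le> ennreal_powr (ennreal_powr b (1 / r)) r"
    using assms by (intro ennreal_powr_mono) auto
  then show "ennreal_powr a r \<le> b" using assms by (simp add: ennreal_powr_powr)
qed

lemma ennreal_powr_le_iff':
  assumes "0 < r"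
  shows "ennreal_powr a (1 / r) \<le> b \<longleftrightarrow> a \<le> ennreal_powr b r"
  using ennreal_powr_le_iff[of "1 / r" a b] assms by simp

lemma ennreal_powr_eq_0_iff [simp]: "ennreal_powr a r = 0 \<longleftrightarrow> a = 0"
  by (cases a) (auto simp: ennreal_eq_0_iff powr_non_neg)

lemma ennreal_powr_less_top [simp]: "ennreal_powr a r < top \<longleftrightarrow> a < top"
  by (cases a) auto

lemma ennreal_powr_measurable [measurable]:
  assumes [measurable]: "f \<in> borel_measurable M"
  shows "(\<lambda>x. ennreal_powr (f x) r) \<in> borel_measurable M"
  unfolding ennreal_powr_def by measurable

section \<open>L^p quasi-norms: monotonicity and homogeneity\<close>

lemma ereal_cases_pos:
  assumes "(0::ereal) < p"
  obtains "p = \<infinity>" | r where "p = ereal r" "r > 0"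
  using assms by (cases p) auto

lemma Lp_norm_ereal: "Lp_norm M (ereal r) f = ennreal_powr (\<integral>\<^sup>+ x. ennreal_powr (f x) r \<partial>M) (1 / r)"
  by (simp add: Lp_norm_def)

lemma Lp_norm_infinity: "Lp_norm M \<infinity> f = esssup M f"
  by (simp add: Lp_norm_def)

lemma Lp_norm_ereal_le_iff:
  "0 < r \<Longrightarrow> Lp_norm M (ereal r) f \<le> C \<longleftrightarrow> (\<integral>\<^sup>+ x. ennreal_powr (f x) r \<partial>M) \<le> ennreal_powr C r"
  by (simp add: Lp_norm_ereal ennreal_powr_le_iff')

lemma Lp_norm_powr: "0 < r \<Longrightarrow> ennreal_powr (Lp_norm M (ereal r) f) r = (\<integral>\<^sup>+ x. ennreal_powr (f x) r \<partial>M)"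
  by (simp add: Lp_norm_ereal ennreal_powr_powr)

lemma Lp_norm_AE_mono:
  assumes "0 < p" "f \<in> borel_measurable M" "AE x in M. f x \<le> g x"
  shows "Lp_norm M p f \<le> Lp_norm M p g"
  using assms(1)
proof (cases rule: ereal_cases_pos)
  case 1
  then show ?thesis using assms by (simp add: Lp_norm_infinity esssup_AE_mono)
next
  case (2 r)
  then show ?thesis unfolding 2 Lp_norm_ereal
    using assms(3) by (intro ennreal_powr_mono nn_integral_mono_AE) (auto elim!: eventually_mono intro: ennreal_powr_mono)
qed

lemma Lp_norm_mono:
  "0 < p \<Longrightarrow> f \<in> borel_measurable M \<Longrightarrow> (\<And>x. f x \<le> g x) \<Longrightarrow> Lp_norm M p f \<le> Lp_norm M p g"
  by (intro Lp_norm_AE_mono) auto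

lemma Lp_norm_cmult_le:
  assumes p: "0 < p" and [measurable]: "f \<in> borel_measurable M" and c: "0 < c"
  shows "Lp_norm M p (\<lambda>x. ennreal c * f x) \<le> ennreal c * Lp_norm M p f"
  using p
proof (cases rule: ereal_cases_pos)
  case 1
  have "AE x in M. ennreal c * f x \<le> ennreal c * esssup M f"
    using esssup_AE[of f M] by eventually_elim (rule mult_left_mono, auto)
  then show ?thesis unfolding 1 Lp_norm_infinity by (intro esssup_I) auto
next
  case (2 r)
  show ?thesis unfolding 2(1) Lp_norm_ereal_le_iff[OF 2(2)] ennreal_powr_mult[OF 2(2)] Lp_norm_powr[OF 2(2)]
    by (subst nn_integral_cmult) auto
qed

lemma Lp_norm_cmult:
  assumes p: "0 < p" and [measurable]: "f \<in> borel_measurable M" and c: "0 < c"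
  shows "Lp_norm M p (\<lambda>x. ennreal c * f x) = ennreal c * Lp_norm M p f"
proof (rule antisym[OF Lp_norm_cmult_le[OF assms]])
  have "f = (\<lambda>x. ennreal (1 / c) * (ennreal c * f x))"
    using c by (simp add: mult.assoc[symmetric] ennreal_mult[symmetric])
  then have "Lp_norm M p f \<le> ennreal (1 / c) * Lp_norm M p (\<lambda>x. ennreal c * f x)"
    using Lp_norm_cmult_le[OF p, of "\<lambda>x. ennreal c * f x" M "1 / c"] c by simp
  then have "ennreal c * Lp_norm M p f \<le> ennreal c * (ennreal (1 / c) * Lp_norm M p (\<lambda>x. ennreal c * f x))"
    by (rule mult_left_mono) simp
  also have "\<dots> = Lp_norm M p (\<lambda>x. ennreal c * f x)"
    using c by (simp add: mult.assoc[symmetric] ennreal_mult[symmetric])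
  finally show "ennreal c * Lp_norm M p f \<le> Lp_norm M p (\<lambda>x. ennreal c * f x)" .
qed

text \<open>Normalisation without division by a possibly vanishing norm. The hypothesis covers every
  admissible multiple, not just one: if b = 0, arbitrarily large multiples of a stay bounded by C,
  which forces a = 0.\<close>

lemma scaling_le:
  assumes "\<And>c. c > 0 \<Longrightarrow> ennreal c * b \<le> 1 \<Longrightarrow> ennreal c * a \<le> ennreal C" and "b < top" "0 \<le> C"
  shows "a \<le> ennreal C * b"
proof -
  obtain y where y: "b = ennreal y" "y \<ge> 0" using assms(2) by (cases b) auto
  show ?thesis
  proof (cases "y = 0")
    case True
    then have *: "ennreal c * a \<le> ennreal C" if "c > 0" for c using assms(1)[OF that] y by simp
    show ?thesis
    proof (cases a)
      case (real x)
      have "x = 0"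
      proof (rule ccontr)
        assume "x \<noteq> 0"
        then have "x > 0" using real by simp
        then show False using *[of "(C + 1) / x"] assms(3) real by (simp add: ennreal_mult[symmetric] add_nonneg_pos)
      qed
      then show ?thesis using real by simp
    next
      case top
      then show ?thesis using *[of 1] by (simp add: top_unique)
    qed
  next
    case False
    then have y0: "y > 0" using y by simp
    then have "ennreal (1 / y) * a \<le> ennreal C" using y by (intro assms(1)) (auto simp: ennreal_mult[symmetric])
    then have "ennreal y * (ennreal (1 / y) * a) \<le> ennreal y * ennreal C" by (rule mult_left_mono) simp
    moreover have "ennreal y * ennreal (1 / y) = 1" using y0 by (simp add: ennreal_mult[symmetric])
    ultimately show ?thesis by (simp add: mult.assoc[symmetric] y(1) mult.commute[of "ennreal C"])
  qed
qed

section \<open>Sequence norms and their embeddings\<close>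

abbreviation lq_norm :: "ereal \<Rightarrow> ('k \<Rightarrow> ennreal) \<Rightarrow> ennreal"
  where "lq_norm \<equiv> Lp_norm (count_space UNIV)"

text \<open>Counting measure has no non-empty null sets.\<close>

lemma esssup_count_space: "esssup (count_space UNIV) (f :: 'k \<Rightarrow> ennreal) = (SUP k. f k)"
proof (rule antisym)
  show "esssup (count_space UNIV) f \<le> (SUP k. f k)"
    by (intro esssup_I) (auto simp: AE_count_space intro: SUP_upper)
  show "(SUP k. f k) \<le> esssup (count_space UNIV) f"
    using esssup_AE[of f "count_space UNIV"] by (auto simp: AE_count_space intro: SUP_least)
qed

lemma le_lq_norm:
  assumes "0 < q"
  shows "a k \<le> lq_norm q a"
  using assms
proof (cases rule: ereal_cases_pos)
  case (2 r)
  have "ennreal_powr (a k) r \<le> (\<integral>\<^sup>+ k. ennreal_powr (a k) r \<partial>count_space UNIV)"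
    by (rule nn_integral_ge_point) auto
  then show ?thesis using 2 by (simp add: ennreal_powr_le_iff Lp_norm_ereal)
qed (auto simp: Lp_norm_infinity esssup_count_space intro: SUP_upper)

lemma lq_norm_mono: "0 < q \<Longrightarrow> (\<And>k. a k \<le> b k) \<Longrightarrow> lq_norm q a \<le> lq_norm q b"
  by (rule Lp_norm_mono) auto

lemma powr_exponent_antimono:
  assumes "a \<le> 1" "0 < r" "r \<le> s"
  shows "ennreal_powr a s \<le> ennreal_powr a r"
  using assms by (cases a) (auto intro!: ennreal_leI powr_mono' simp: top_unique)

text \<open>After normalisation every term is at most its l^r norm, hence at most 1, and there a
  larger exponent makes powers smaller.\<close>

lemma lq_norm_antimono:
  assumes r: "0 < r" and rq: "r \<le> q"
  shows "lq_norm q a \<le> lq_norm r a"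
proof (cases "lq_norm r a = top")
  case False
  have q: "0 < q" using r rq by order
  have "lq_norm q a \<le> ennreal 1 * lq_norm r a"
  proof (rule scaling_le)
    fix c :: real assume c: "c > 0" and le: "ennreal c * lq_norm r a \<le> 1"
    let ?b = "\<lambda>k. ennreal c * a k"
    have N: "lq_norm r ?b \<le> 1" using le c r by (simp add: Lp_norm_cmult)
    have b: "?b k \<le> 1" for k using order_trans[OF le_lq_norm[OF r, of ?b k] N] .
    have "lq_norm q ?b \<le> 1"
      using q
    proof (cases rule: ereal_cases_pos)
      case 1
      then show ?thesis using b by (simp add: Lp_norm_infinity esssup_count_space SUP_least)
    next
      case (2 q')
      with r rq obtain r' where r': "r = ereal r'" "0 < r'" "r' \<le> q'" by (cases r) auto
      have "(\<integral>\<^sup>+ k. ennreal_powr (?b k) q' \<partial>count_space UNIV) \<le> (\<integral>\<^sup>+ k. ennreal_powr (?b k) r' \<partial>count_space UNIV)"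
        using b r' by (intro nn_integral_mono powr_exponent_antimono) auto
      also have "\<dots> \<le> 1" using N unfolding r'(1) Lp_norm_ereal_le_iff[OF r'(2)] by simp
      finally show ?thesis unfolding 2(1) Lp_norm_ereal_le_iff[OF 2(2)] by simp
    qed
    then show "ennreal c * lq_norm q a \<le> ennreal 1" using c q by (simp add: Lp_norm_cmult)
  qed (use False in \<open>auto simp: less_top\<close>)
  then show ?thesis by simp
qed auto

text \<open>A substitute for Hoelder's inequality in the weighted sequence embedding.\<close>

lemma powr_mult_le_add:
  fixes a b :: real
  assumes "a \<ge> 0" "b \<ge> 0" "0 < r" "0 < u" "0 < t" "1 / r = 1 / u + 1 / t"
  shows "(a * b) powr r \<le> a powr u + b powr t"
proof -
  \<comment> \<open>If a^u is the larger summand, then b is at most a^(u/t), and the relation of the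
    exponents gives (1 + u/t) r = u. The other case is symmetric.\<close>
  have *: "(a * b) powr r \<le> a powr u" if "b powr t \<le> a powr u" "a \<ge> 0" "b \<ge> 0" "0 < u" "0 < t" "1 / r = 1 / u + 1 / t" for a b u t :: real
  proof -
    have "b = (b powr t) powr (1 / t)" using that by (simp add: powr_powr)
    also have "\<dots> \<le> (a powr u) powr (1 / t)" using that by (intro powr_mono2) auto
    finally have "b \<le> a powr (u / t)" by (simp add: powr_powr)
    then have "a * b \<le> a powr 1 * a powr (u / t)" using that by (simp add: mult_left_mono)
    also have "\<dots> = a powr (1 + u / t)" by (simp add: powr_add)
    also have "1 + u / t = u * (1 / r)" unfolding that(6) using that by (simp add: field_simps)
    finally have "(a * b) powr r \<le> (a powr (u * (1 / r))) powr r"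
      using that assms(3) by (intro powr_mono2) auto
    then show ?thesis using assms(3) by (simp add: powr_powr)
  qed
  show ?thesis
  proof (cases "b powr t \<le> a powr u")
    case True
    then show ?thesis using *[of b t a u] assms by (smt (verit) powr_ge_zero)
  next
    case False
    then show ?thesis using *[of a u b t] assms by (smt (verit) powr_ge_zero mult.commute add.commute)
  qed
qed

text \<open>Here t is the Hoelder exponent complementary to q. For a normalised sequence x and
  finite q = u, write x = (w x) (1/w) and apply \<open>powr_mult_le_add\<close> termwise: the r-th
  powers sum to at most 1 + s. For q infinite, t = r and x is at most 1/w pointwise.\<close>

lemma lq_norm_weighted:
  fixes w :: "'k \<Rightarrow> real" and r :: real
  assumes w: "\<And>k. w k > 0" and r: "0 < r" and t: "0 < t" and q: "0 < q"
    and rt: "ereal (1 / r) = ereal (1 / t) + 1 / q"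
    and S: "(\<integral>\<^sup>+ k. ennreal (w k powr - t) \<partial>count_space UNIV) < top"
  shows "\<exists>C\<ge>0. \<forall>a. lq_norm q (\<lambda>k. ennreal (w k) * a k) < top \<longrightarrow> lq_norm (ereal r) a \<le> ennreal C * lq_norm q (\<lambda>k. ennreal (w k) * a k)"
proof -
  obtain s where s: "(\<integral>\<^sup>+ k. ennreal (w k powr - t) \<partial>count_space UNIV) = ennreal s" "s \<ge> 0"
    using S by (cases "\<integral>\<^sup>+ k. ennreal (w k powr - t) \<partial>count_space UNIV") auto
  let ?C = "(1 + s) powr (1 / r)"
  show ?thesis
  proof (intro exI[of _ ?C] conjI allI impI)
    fix a assume fin: "lq_norm q (\<lambda>k. ennreal (w k) * a k) < top"
    show "lq_norm (ereal r) a \<le> ennreal ?C * lq_norm q (\<lambda>k. ennreal (w k) * a k)"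
    proof (rule scaling_le[OF _ fin])
      fix c :: real assume c: "c > 0" and le: "ennreal c * lq_norm q (\<lambda>k. ennreal (w k) * a k) \<le> 1"
      let ?b = "\<lambda>k. ennreal c * a k"
      have N: "lq_norm q (\<lambda>k. ennreal (w k) * ?b k) \<le> 1"
        using le Lp_norm_cmult[OF q, of "\<lambda>k. ennreal (w k) * a k" "count_space UNIV" c] c by (simp add: mult.left_commute)
      have wb: "ennreal (w k) * ?b k \<le> 1" for k
        using order_trans[OF le_lq_norm[OF q, of "\<lambda>k. ennreal (w k) * ?b k" k] N] .
      define x where "x = (\<lambda>k. enn2real (?b k))"
      have x: "?b k = ennreal (x k)" "x k \<ge> 0" for k
      proof -
        have "?b k \<noteq> top" using wb[of k] w[of k] by (auto simp: ennreal_mult_top top_unique)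
        then show "?b k = ennreal (x k)" "x k \<ge> 0" unfolding x_def by (auto simp: less_top)
      qed
      have "(\<integral>\<^sup>+ k. ennreal (x k powr r) \<partial>count_space UNIV) \<le> ennreal (1 + s)"
        using q
      proof (cases rule: ereal_cases_pos)
        case 1
        then have rt': "t = r" using rt r t by simp
        have "x k powr r \<le> w k powr - t" for k
        proof -
          have "w k * x k \<le> 1" using wb[of k] w[of k] x[of k] by (simp add: ennreal_mult[symmetric])
          then have "x k \<le> 1 / w k" using w[of k] by (simp add: field_simps)
          then have "x k powr r \<le> (1 / w k) powr r" using x(2) r by (intro powr_mono2) auto
          then show ?thesis using w[of k] rt' by (simp add: powr_divide powr_minus_divide)
        qed
        then have "(\<integral>\<^sup>+ k. ennreal (x k powr r) \<partial>count_space UNIV) \<le> ennreal s"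
          unfolding s(1)[symmetric] by (intro nn_integral_mono ennreal_leI)
        also have "\<dots> \<le> ennreal (1 + s)" by (intro ennreal_leI) simp
        finally show ?thesis .
      next
        case (2 u)
        have ur: "1 / r = 1 / u + 1 / t" using rt 2 by (simp add: one_ereal_def)
        have "x k powr r \<le> (w k * x k) powr u + w k powr - t" for k
        proof -
          have "x k powr r = ((w k * x k) * (1 / w k)) powr r" using w[of k] by simp
          also have "\<dots> \<le> (w k * x k) powr u + (1 / w k) powr t"
            using w[of k] x(2)[of k] 2 r t ur by (intro powr_mult_le_add) auto
          finally show ?thesis using w[of k] by (simp add: powr_divide powr_minus_divide)
        qed
        then have "(\<integral>\<^sup>+ k. ennreal (x k powr r) \<partial>count_space UNIV) \<le> (\<integral>\<^sup>+ k. ennreal ((w k * x k) powr u) + ennreal (w k powr - t) \<partial>count_space UNIV)"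
          by (intro nn_integral_mono) (auto simp flip: ennreal_plus intro!: ennreal_leI)
        also have "\<dots> = (\<integral>\<^sup>+ k. ennreal ((w k * x k) powr u) \<partial>count_space UNIV) + ennreal s"
          by (simp add: nn_integral_add s)
        also have "(\<integral>\<^sup>+ k. ennreal ((w k * x k) powr u) \<partial>count_space UNIV) \<le> 1"
        proof -
          have "ennreal_powr (ennreal (w k) * ?b k) u = ennreal ((w k * x k) powr u)" for k
            unfolding x(1) using w[of k] x(2)[of k] by (simp add: ennreal_mult[symmetric])
          then show ?thesis using N unfolding 2(1) Lp_norm_ereal_le_iff[OF 2(2)] by simp
        qed
        finally show ?thesis using s(2) by (simp add: add_right_mono)
      qed
      then have "lq_norm (ereal r) ?b \<le> ennreal ?C"
        unfolding Lp_norm_ereal_le_iff[OF r] x(1) using x(2) r s(2) by (simp add: powr_powr)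
      then show "ennreal c * lq_norm (ereal r) a \<le> ennreal ?C"
        using c r by (simp add: Lp_norm_cmult)
    qed auto
  qed auto
qed

section \<open>Mixed norms and the interchange of L^p and l^q\<close>

lemma borel_measurable_nn_integral_count_space:
  fixes f :: "'k::countable \<Rightarrow> 'a \<Rightarrow> ennreal"
  assumes [measurable]: "\<And>k. f k \<in> borel_measurable M"
  shows "(\<lambda>x. \<integral>\<^sup>+ k. f k x \<partial>count_space UNIV) \<in> borel_measurable M"
proof -
  interpret sigma_finite_measure "count_space (UNIV :: 'k set)"
    by (intro sigma_finite_measure_count_space_countable) auto
  have "(\<lambda>z. f (snd z) (fst z)) \<in> borel_measurable (M \<Otimes>\<^sub>M count_space (UNIV :: 'k set))"
    by (rule measurable_compose_countable'[where f = "\<lambda>k z. f k (fst z)" and g = snd and I = UNIV]) auto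
  then have "case_prod (\<lambda>x k. f k x) \<in> borel_measurable (M \<Otimes>\<^sub>M count_space (UNIV :: 'k set))"
    by (simp add: case_prod_beta')
  then show ?thesis by (rule borel_measurable_nn_integral)
qed

lemma lq_norm_measurable:
  fixes g :: "'k::countable \<Rightarrow> 'a \<Rightarrow> ennreal"
  assumes q: "0 < q" and [measurable]: "\<And>k. g k \<in> borel_measurable M"
  shows "(\<lambda>x. lq_norm q (\<lambda>k. g k x)) \<in> borel_measurable M"
  using q
proof (cases rule: ereal_cases_pos)
  case 1
  then show ?thesis by (auto simp: Lp_norm_infinity esssup_count_space intro!: borel_measurable_SUP)
next
  case (2 r)
  then show ?thesis
    by (auto simp: Lp_norm_ereal intro!: borel_measurable_nn_integral_count_space ennreal_powr_measurable)
qed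

text \<open>Either h lies below the threshold a L, or h / (a L) exceeds 1 and multiplying h by its
  power P - 1 only increases the value.\<close>

lemma le_scaled_powr:
  fixes a L P :: real
  assumes "a > 0" "L > 0" "P > 1"
  shows "h \<le> ennreal (a * L) + ennreal ((a * L) powr (1 - P)) * ennreal_powr h P"
proof (cases h)
  case (real x)
  show ?thesis
  proof (cases "x \<le> a * L")
    case True
    then have "h \<le> ennreal (a * L)" using real by (simp add: ennreal_leI)
    then show ?thesis by (rule add_increasing2[rotated]) simp
  next
    case False
    then have x: "x > a * L" "a * L > 0" using assms by auto
    have "1 \<le> (x / (a * L)) powr (P - 1)" using x assms by (intro ge_one_powr_ge_zero) auto
    then have "x * 1 \<le> x * (x / (a * L)) powr (P - 1)" using x by (intro mult_left_mono) auto
    also have "\<dots> = (a * L) powr - (P - 1) * (x * x powr (P - 1))"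
    proof -
      have "(x / z) powr (P - 1) = z powr - (P - 1) * x powr (P - 1)" if "z > 0" for z
        using that x powr_divide[of x z "P - 1"] powr_minus[of z "P - 1"] by (simp add: divide_inverse mult.commute)
      from this[OF x(2)] show ?thesis by simp
    qed
    also have "x * x powr (P - 1) = x powr P" using x by (simp add: powr_mult_base)
    finally have "x \<le> (a * L) powr (1 - P) * x powr P" by simp
    then have "h \<le> ennreal ((a * L) powr (1 - P)) * ennreal_powr h P"
      using real by (simp add: ennreal_mult[symmetric] ennreal_leI)
    then show ?thesis by (rule add_increasing[rotated]) simp
  qed
next
  case top
  then show ?thesis using assms by (simp add: ennreal_mult_top)
qed

text \<open>Minkowski's inequality up to the constant 2: for \<open>\<Sum>\<^sub>k a\<^sub>k \<le> 1\<close> and \<open>P > 1\<close>, the bound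
  \<open>h\<^sub>k \<le> a\<^sub>k L + (a\<^sub>k L)\<^bsup>1 - P\<^esup> h\<^sub>k\<^bsup>P\<^esup>\<close> is summed over \<open>k\<close> and \<open>L\<close> is chosen optimally.\<close>

lemma weak_minkowski_aux:
  fixes h :: "'k::countable \<Rightarrow> 'a \<Rightarrow> ennreal" and P :: real
  assumes P: "P > 1" and [measurable]: "\<And>k. h k \<in> borel_measurable M"
    and a: "\<And>k. (\<integral>\<^sup>+ x. ennreal_powr (h k x) P \<partial>M) \<le> ennreal_powr (a k) P"
    and sum: "(\<integral>\<^sup>+ k. a k \<partial>count_space UNIV) \<le> 1"
  shows "(\<integral>\<^sup>+ x. ennreal_powr (\<integral>\<^sup>+ k. h k x \<partial>count_space UNIV) P \<partial>M) \<le> ennreal (2 powr P)"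
proof -
  have a1: "a k \<le> 1" for k
    using order_trans[OF nn_integral_ge_point[of k UNIV a] sum] by simp
  define b where "b = (\<lambda>k. enn2real (a k))"
  have b: "a k = ennreal (b k)" "b k \<ge> 0" for k
  proof -
    have "a k \<noteq> top" using a1[of k] by (auto simp: top_unique)
    then show "a k = ennreal (b k)" "b k \<ge> 0" unfolding b_def by (auto simp: less_top)
  qed
  define c where "c = (\<lambda>k. ennreal (b k powr (1 - P)))"
  define \<Sigma> where "\<Sigma> = (\<lambda>x. \<integral>\<^sup>+ k. c k * ennreal_powr (h k x) P \<partial>count_space UNIV)"
  \<comment> \<open>For \<open>b k = 0\<close> the factor \<open>c k\<close> is 0, since 0 to any
    power is 0 here, so \<open>\<Sigma>\<close> does not see these terms. They have to be removed
    separately: their L^P norm vanishes.\<close>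
  have zero: "AE x in M. \<forall>k. b k = 0 \<longrightarrow> h k x = 0"
  proof (subst AE_all_countable, intro allI)
    fix k
    show "AE x in M. b k = 0 \<longrightarrow> h k x = 0"
    proof (cases "b k = 0")
      case True
      then have "(\<integral>\<^sup>+ x. ennreal_powr (h k x) P \<partial>M) = 0" using a[of k] b(1)[of k] by simp
      then show ?thesis by (subst (asm) nn_integral_0_iff_AE) auto
    qed auto
  qed
  have pt: "ennreal_powr (\<integral>\<^sup>+ k. h k x \<partial>count_space UNIV) P \<le> ennreal (2 powr P) * \<Sigma> x"
    if z: "\<forall>k. b k = 0 \<longrightarrow> h k x = 0" for x
  proof (cases "\<Sigma> x")
    case (real y)
    show ?thesis
    proof (cases "y = 0")
      case True
      have "h k x = 0" for k
      proof -
        have "c k * ennreal_powr (h k x) P \<le> \<Sigma> x"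
          unfolding \<Sigma>_def by (rule nn_integral_ge_point) auto
        then have "c k * ennreal_powr (h k x) P = 0" using True real by simp
        then show ?thesis using z b(2)[of k] by (auto simp: c_def ennreal_eq_0_iff powr_non_neg)
      qed
      then show ?thesis by simp
    next
      case False
      then have y: "y > 0" using real by simp
      \<comment> \<open>Balances the two summands: L^(1 - P) y equals L as well, so the total is at
        most 2 L.\<close>
      define L where "L = y powr (1 / P)"
      have L: "L > 0" using y by (simp add: L_def)
      have "h k x \<le> ennreal L * a k + ennreal (L powr (1 - P)) * (c k * ennreal_powr (h k x) P)" for k
      proof (cases "b k = 0")
        case True
        then show ?thesis using z by simp
      next
        case False
        then have bk: "b k > 0" using b(2)[of k] by simp
        have "ennreal (b k * L) = ennreal L * a k"
          using bk L by (simp add: b(1) ennreal_mult mult.commute)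
        moreover have "ennreal ((b k * L) powr (1 - P)) = ennreal (L powr (1 - P)) * c k"
          using bk L by (simp add: c_def ennreal_mult powr_mult mult.commute)
        ultimately show ?thesis using le_scaled_powr[OF bk L P, of "h k x"] by (simp only: mult.assoc)
      qed
      then have "(\<integral>\<^sup>+ k. h k x \<partial>count_space UNIV) \<le> (\<integral>\<^sup>+ k. ennreal L * a k + ennreal (L powr (1 - P)) * (c k * ennreal_powr (h k x) P) \<partial>count_space UNIV)"
        by (intro nn_integral_mono)
      also have "\<dots> = ennreal L * (\<integral>\<^sup>+ k. a k \<partial>count_space UNIV) + ennreal (L powr (1 - P)) * \<Sigma> x"
        by (simp add: nn_integral_add nn_integral_cmult \<Sigma>_def)
      also have "\<dots> \<le> ennreal L * 1 + ennreal (L powr (1 - P)) * ennreal (L powr P)"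
        using real y P by (intro add_mono mult_left_mono sum) (auto simp: L_def powr_powr)
      also have "\<dots> = ennreal (2 * L)"
        using L by (simp add: ennreal_mult[symmetric] powr_add[symmetric] flip: ennreal_plus)
      finally have "ennreal_powr (\<integral>\<^sup>+ k. h k x \<partial>count_space UNIV) P \<le> ennreal_powr (ennreal (2 * L)) P"
        using P by (intro ennreal_powr_mono) auto
      also have "\<dots> = ennreal (2 powr P) * \<Sigma> x"
      proof -
        have "(2 * L) powr P = 2 powr P * y" using L P y by (simp add: powr_mult L_def powr_powr)
        moreover have "ennreal_powr (ennreal (2 * L)) P = ennreal ((2 * L) powr P)"
          using L by (intro ennreal_powr_ennreal) simp
        moreover have "ennreal (2 powr P * y) = ennreal (2 powr P) * \<Sigma> x"
          using y by (simp only: real ennreal_mult powr_ge_zero)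
        ultimately show ?thesis by simp
      qed
      finally show ?thesis .
    qed
  qed (simp add: ennreal_mult_top)
  have [measurable]: "\<Sigma> \<in> borel_measurable M"
    unfolding \<Sigma>_def by (intro borel_measurable_nn_integral_count_space) measurable
  have "(\<integral>\<^sup>+ x. ennreal_powr (\<integral>\<^sup>+ k. h k x \<partial>count_space UNIV) P \<partial>M) \<le> (\<integral>\<^sup>+ x. ennreal (2 powr P) * \<Sigma> x \<partial>M)"
    using zero pt by (intro nn_integral_mono_AE) (auto elim!: eventually_mono)
  also have "\<dots> = ennreal (2 powr P) * (\<integral>\<^sup>+ x. \<Sigma> x \<partial>M)" by (simp add: nn_integral_cmult)
  also have "(\<integral>\<^sup>+ x. \<Sigma> x \<partial>M) = (\<integral>\<^sup>+ k. \<integral>\<^sup>+ x. c k * ennreal_powr (h k x) P \<partial>M \<partial>count_space UNIV)"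
    unfolding \<Sigma>_def by (intro nn_integral_count_space_nn_integral) auto
  also have "\<dots> \<le> (\<integral>\<^sup>+ k. a k \<partial>count_space UNIV)"
  proof (intro nn_integral_mono)
    fix k
    have "(\<integral>\<^sup>+ x. c k * ennreal_powr (h k x) P \<partial>M) \<le> c k * ennreal_powr (a k) P"
      by (simp add: nn_integral_cmult mult_left_mono a)
    also have "\<dots> = a k"
      using b(2)[of k] by (cases "b k = 0") (auto simp: c_def b(1) ennreal_mult[symmetric] powr_add[symmetric])
    finally show "(\<integral>\<^sup>+ x. c k * ennreal_powr (h k x) P \<partial>M) \<le> a k" .
  qed
  also note sum
  finally show ?thesis by (simp add: mult_left_mono)
qed

text \<open>Passing to q-th powers turns the inner norm into a sum and leaves the triangle
  inequality in L^(p/q). Its exponent exceeds 1 precisely because q < p. If p is infinite, a bound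
  almost everywhere suffices.\<close>

lemma weak_minkowski:
  fixes g :: "'k::countable \<Rightarrow> 'a \<Rightarrow> ennreal"
  assumes q: "0 < q" "q < p" and [measurable]: "\<And>k. g k \<in> borel_measurable M"
    and fin: "lq_norm q (\<lambda>k. Lp_norm M p (g k)) < top"
  shows "Lp_norm M p (\<lambda>x. lq_norm q (\<lambda>k. g k x)) \<le> ennreal (2 powr (1 / real_of_ereal q)) * lq_norm q (\<lambda>k. Lp_norm M p (g k))"
proof -
  obtain q' where q': "q = ereal q'" "0 < q'" using q by (cases q) auto
  have p: "0 < p" using q by order
  have meas: "(\<lambda>x. lq_norm q (\<lambda>k. g k x)) \<in> borel_measurable M"
    using q by (intro lq_norm_measurable) auto
  show ?thesis using p
  proof (cases rule: ereal_cases_pos)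
    case 1
    have "AE x in M. \<forall>k. g k x \<le> esssup M (g k)"
      by (subst AE_all_countable) (auto intro: esssup_AE)
    then have "AE x in M. lq_norm q (\<lambda>k. g k x) \<le> lq_norm q (\<lambda>k. Lp_norm M p (g k))"
      by eventually_elim (auto intro!: lq_norm_mono q simp: 1 Lp_norm_infinity)
    then have "Lp_norm M p (\<lambda>x. lq_norm q (\<lambda>k. g k x)) \<le> 1 * lq_norm q (\<lambda>k. Lp_norm M p (g k))"
      unfolding 1 Lp_norm_infinity using meas by (simp add: esssup_I)
    also have "\<dots> \<le> ennreal (2 powr (1 / real_of_ereal q)) * lq_norm q (\<lambda>k. Lp_norm M p (g k))"
      using q' by (intro mult_right_mono) (auto intro!: ge_one_powr_ge_zero)
    finally show ?thesis .
  next
    case (2 p')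
    define P where "P = p' / q'"
    have P: "P > 1" using q q' 2 by (simp add: P_def)
    show ?thesis
    proof (rule scaling_le[OF _ fin])
      fix c :: real assume c: "c > 0" and le: "ennreal c * lq_norm q (\<lambda>k. Lp_norm M p (g k)) \<le> 1"
      let ?g = "\<lambda>k x. ennreal c * g k x"
      have N: "lq_norm q (\<lambda>k. Lp_norm M p (?g k)) \<le> 1"
        using le c q p by (simp add: Lp_norm_cmult)
      let ?a = "\<lambda>k. ennreal_powr (Lp_norm M p (?g k)) q'"
      have "(\<integral>\<^sup>+ x. ennreal_powr (\<integral>\<^sup>+ k. ennreal_powr (?g k x) q' \<partial>count_space UNIV) P \<partial>M) \<le> ennreal (2 powr P)"
      proof (rule weak_minkowski_aux[OF P, where a = ?a])
        show "(\<integral>\<^sup>+ x. ennreal_powr (ennreal_powr (?g k x) q') P \<partial>M) \<le> ennreal_powr (?a k) P" for k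
          using q' 2 by (simp add: ennreal_powr_powr P_def Lp_norm_powr)
        show "(\<integral>\<^sup>+ k. ?a k \<partial>count_space UNIV) \<le> 1"
          using N unfolding q'(1) Lp_norm_ereal_le_iff[OF q'(2)] by simp
      qed measurable
      then have "Lp_norm M p (\<lambda>x. lq_norm q (\<lambda>k. ?g k x)) \<le> ennreal (2 powr (1 / q'))"
        unfolding 2(1) Lp_norm_ereal_le_iff[OF 2(2)] q'(1) Lp_norm_ereal[of _ q'] ennreal_powr_powr
        using q' 2 by (simp add: P_def powr_powr)
      then show "ennreal c * Lp_norm M p (\<lambda>x. lq_norm q (\<lambda>k. g k x)) \<le> ennreal (2 powr (1 / real_of_ereal q))"
        using c q p meas q' by (simp add: Lp_norm_cmult)
    qed auto
  qed
qed

text \<open>For p at most q, the inner l^q norm is first enlarged to the l^p norm, after which both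
  norms carry the same exponent and can be interchanged. Otherwise this is
  \<open>weak_minkowski\<close>.\<close>

lemma Lp_norm_lq_norm_le:
  fixes g :: "'k::countable \<Rightarrow> 'a \<Rightarrow> ennreal"
  assumes p: "0 < p" and q: "0 < q" and g [measurable]: "\<And>k. g k \<in> borel_measurable M"
    and fin: "lq_norm (min p q) (\<lambda>k. Lp_norm M p (g k)) < top"
  shows "Lp_norm M p (\<lambda>x. lq_norm q (\<lambda>k. g k x)) \<le>
    ennreal (2 powr (1 / real_of_ereal (min p q))) * lq_norm (min p q) (\<lambda>k. Lp_norm M p (g k))"
proof (cases "q < p")
  case True
  then have "min p q = q" by simp
  then show ?thesis using weak_minkowski[OF q True g] fin by simp
next
  case False
  then have pq: "p \<le> q" "min p q = p" by auto
  have "Lp_norm M p (\<lambda>x. lq_norm q (\<lambda>k. g k x)) \<le> Lp_norm M p (\<lambda>x. lq_norm p (\<lambda>k. g k x))"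
    using p q pq by (intro Lp_norm_mono lq_norm_measurable lq_norm_antimono) auto
  also have "\<dots> \<le> lq_norm p (\<lambda>k. Lp_norm M p (g k))"
    using p
  proof (cases rule: ereal_cases_pos)
    case 1
    have "AE x in M. \<forall>k. g k x \<le> esssup M (g k)"
      by (subst AE_all_countable) (auto intro: esssup_AE)
    then have "AE x in M. lq_norm p (\<lambda>k. g k x) \<le> lq_norm p (\<lambda>k. Lp_norm M p (g k))"
    proof eventually_elim
      case (elim x)
      then show ?case by (intro lq_norm_mono p) (simp add: 1 Lp_norm_infinity)
    qed
    then show ?thesis using lq_norm_measurable[OF p g] unfolding 1 Lp_norm_infinity by (intro esssup_I) auto
  next
    case (2 r)
    show ?thesis
      unfolding 2(1) Lp_norm_ereal_le_iff[OF 2(2)] Lp_norm_powr[OF 2(2)]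
      by (subst nn_integral_count_space_nn_integral) auto
  qed
  also have "\<dots> \<le> ennreal (2 powr (1 / real_of_ereal p)) * lq_norm p (\<lambda>k. Lp_norm M p (g k))"
  proof -
    have "0 \<le> real_of_ereal p" using p by (cases p) auto
    then have "1 \<le> ennreal (2 powr (1 / real_of_ereal p))" by (auto intro!: ge_one_powr_ge_zero)
    then show ?thesis using mult_right_mono[of 1 "ennreal (2 powr (1 / real_of_ereal p))"] by simp
  qed
  finally show ?thesis unfolding pq(2) .
qed

text \<open>Split |f|^p = |f|^(p - p1) |f|^p1 and bound the first factor pointwise. With C at least
  1 the same constant serves every larger exponent, including p = p1.\<close>

lemma Lp_norm_increase_exponent:
  assumes p: "0 < p1" "p1 \<le> p" and [measurable]: "f \<in> borel_measurable M"
    and C: "1 \<le> C" and le: "\<And>x. f x \<le> ennreal C * Lp_norm M p1 f" and fin: "Lp_norm M p1 f < top"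
  shows "Lp_norm M p f \<le> ennreal C * Lp_norm M p1 f"
proof -
  have p0: "0 < p" using p by order
  show ?thesis using p0
  proof (cases rule: ereal_cases_pos)
    case 1
    then show ?thesis using le by (auto simp: Lp_norm_infinity intro!: esssup_I)
  next
    case (2 p')
    then obtain p1' where p1': "p1 = ereal p1'" "0 < p1'" "p1' \<le> p'" using p by (cases p1) auto
    show ?thesis
    proof (cases "p1' = p'")
      case True
      then have "Lp_norm M p f = 1 * Lp_norm M p1 f" using 2 p1' by simp
      also have "\<dots> \<le> ennreal C * Lp_norm M p1 f" using C by (intro mult_right_mono) auto
      finally show ?thesis .
    next
      case False
      then have d: "p' - p1' > 0" using p1' by simp
      let ?N = "Lp_norm M p1 f"
      have "(\<integral>\<^sup>+ x. ennreal_powr (f x) p' \<partial>M) \<le> (\<integral>\<^sup>+ x. ennreal_powr (ennreal C * ?N) (p' - p1') * ennreal_powr (f x) p1' \<partial>M)"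
      proof (intro nn_integral_mono)
        fix x
        have "ennreal_powr (f x) p' = ennreal_powr (f x) (p' - p1') * ennreal_powr (f x) p1'"
          using ennreal_powr_add[OF d p1'(2), of "f x"] by simp
        also have "\<dots> \<le> ennreal_powr (ennreal C * ?N) (p' - p1') * ennreal_powr (f x) p1'"
          using d by (intro mult_right_mono ennreal_powr_mono le) auto
        finally show "ennreal_powr (f x) p' \<le> ennreal_powr (ennreal C * ?N) (p' - p1') * ennreal_powr (f x) p1'" .
      qed
      also have "\<dots> = ennreal_powr (ennreal C * ?N) (p' - p1') * ennreal_powr ?N p1'"
        by (simp add: nn_integral_cmult p1'(1) Lp_norm_powr[OF p1'(2)])
      also have "\<dots> \<le> ennreal_powr (ennreal C * ?N) (p' - p1') * ennreal_powr (ennreal C * ?N) p1'"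
      proof (intro mult_left_mono ennreal_powr_mono)
        show "?N \<le> ennreal C * ?N" using C mult_right_mono[of 1 "ennreal C" ?N] by simp
      qed (use p1' in auto)
      also have "\<dots> = ennreal_powr (ennreal C * ?N) p'"
        using ennreal_powr_add[OF d p1'(2), of "ennreal C * ?N"] by simp
      finally show ?thesis unfolding 2(1) Lp_norm_ereal_le_iff[OF 2(2)] .
    qed
  qed
qed

subsection \<open>Lattice sums\<close>

lemma card_vec_box: "finite A \<Longrightarrow> card {v::'a^'n::finite. \<forall>i. v $ i \<in> A} = card A ^ CARD('n)"
proof -
  assume "finite A"
  have "bij_betw vec_nth {v::'a^'n. \<forall>i. v $ i \<in> A} (PiE UNIV (\<lambda>_. A))"
    by (rule bij_betwI[where g = vec_lambda]) auto
  then have "card {v::'a^'n. \<forall>i. v $ i \<in> A} = card (PiE (UNIV::'n set) (\<lambda>_. A))"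
    by (rule bij_betw_same_card)
  then show ?thesis by (simp add: card_PiE)
qed

abbreviation lattice_weight :: "int^'n::finite \<Rightarrow> real"
  where "lattice_weight k \<equiv> japanese_bracket (lattice_pt k)"

lemma japanese_bracket_ge_1: "1 \<le> japanese_bracket x"
  by (simp add: japanese_bracket_def)

lemma japanese_bracket_pos: "0 < japanese_bracket x"
  using japanese_bracket_ge_1[of x] by linarith

lemma norm_le_japanese_bracket: "norm x \<le> japanese_bracket x"
  unfolding japanese_bracket_def by (rule real_le_rsqrt) simp

lemma japanese_bracket_le: "japanese_bracket x \<le> 1 + norm x"
  unfolding japanese_bracket_def by (rule real_le_lsqrt) (auto simp: power2_eq_square algebra_simps)

lemma ex_dyadic:
  fixes x :: real
  assumes "1 \<le> x"
  shows "\<exists>j::nat. 2 ^ j \<le> x \<and> x < 2 ^ Suc j"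
proof -
  define j where "j = nat \<lfloor>log 2 x\<rfloor>"
  have "0 \<le> log 2 x" using assms by simp
  then have "real j \<le> log 2 x" "log 2 x < real (Suc j)" unfolding j_def by (auto, linarith)
  then show ?thesis using assms by (intro exI[of _ j]) (auto simp: le_log_iff log_less_iff powr_realpow simp del: of_nat_Suc power_Suc)
qed

text \<open>Dyadic decomposition. At most (6 2^j)^d lattice points have weight up to 2^(j+1), since
  2 2^(j+1) + 1 is at most 6 2^j. The majorising series is geometric with ratio 2^(d - a) <
  1.\<close>

lemma lattice_sum_finite:
  assumes a: "a > real CARD('n::finite)"
  shows "(\<integral>\<^sup>+ k. ennreal (lattice_weight (k::int^'n) powr - a) \<partial>count_space UNIV) < top"
proof -
  let ?d = "CARD('n)"
  let ?E = "\<lambda>j. {k::int^'n. lattice_weight k \<le> 2 ^ Suc j}"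
  have card: "finite (?E j)" "real (card (?E j)) \<le> (6 * 2 ^ j) ^ ?d" for j
  proof -
    let ?B = "{- (2 ^ Suc j) .. 2 ^ Suc j :: int}"
    have sub: "?E j \<subseteq> {k. \<forall>i. k $ i \<in> ?B}"
    proof (intro subsetI CollectI allI)
      fix k :: "int^'n" and i assume "k \<in> ?E j"
      then have "\<bar>lattice_pt k $ i\<bar> \<le> 2 ^ Suc j"
        using component_le_norm_cart[of "lattice_pt k" i] norm_le_japanese_bracket[of "lattice_pt k"] by simp
      then have "real_of_int \<bar>k $ i\<bar> \<le> real_of_int (2 ^ Suc j)" by (simp add: lattice_pt_def)
      then have "\<bar>k $ i\<bar> \<le> 2 ^ Suc j" by (simp only: of_int_le_iff)
      then show "k $ i \<in> ?B" by auto
    qed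
    have fin: "finite {k::int^'n. \<forall>i. k $ i \<in> ?B}" by (rule finite_vec_box) simp
    show "finite (?E j)" using sub fin by (rule finite_subset)
    have "card (?E j) \<le> card ?B ^ ?d"
      using card_mono[OF fin sub] by (simp only: card_vec_box finite_atLeastAtMost_int)
    also have "\<dots> \<le> (6 * 2 ^ j) ^ ?d"
    proof (rule power_mono)
      have "int (card ?B) \<le> int (6 * 2 ^ j)"
      proof -
        have "(0::int) < 2 ^ j" by simp
        then have "4 * 2 ^ j + 1 \<le> (6 * 2 ^ j :: int)" by linarith
        then show ?thesis by (simp add: nat_le_iff)
      qed
      then show "card ?B \<le> 6 * 2 ^ j" by (simp only: of_nat_le_iff)
    qed simp
    finally have "real (card (?E j)) \<le> real ((6 * 2 ^ j) ^ ?d)" by (simp only: of_nat_le_iff)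
    then show "real (card (?E j)) \<le> (6 * 2 ^ j) ^ ?d" by simp
  qed
  have "ennreal (lattice_weight k powr - a) \<le> (\<Sum>j. ennreal ((2 ^ j) powr - a) * indicator (?E j) k)" for k :: "int^'n"
  proof -
    obtain j where j: "2 ^ j \<le> lattice_weight k" "lattice_weight k < 2 ^ Suc j"
      using ex_dyadic[OF japanese_bracket_ge_1] by blast
    let ?F = "\<lambda>j. ennreal ((2 ^ j) powr - a) * indicator (?E j) k"
    have "lattice_weight k powr - a \<le> (2 ^ j) powr - a"
      using j a by (intro powr_mono2') auto
    then have "ennreal (lattice_weight k powr - a) \<le> ?F j" using j by (simp add: ennreal_leI)
    also have "?F j \<le> suminf ?F"
    proof -
      have "sum ?F {j} \<le> suminf ?F" by (intro sum_le_suminf summableI) auto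
      then show ?thesis by (simp only: sum.insert_if sum.empty finite.emptyI empty_iff if_False add_0_right)
    qed
    finally show ?thesis .
  qed
  then have "(\<integral>\<^sup>+ k. ennreal (lattice_weight (k::int^'n) powr - a) \<partial>count_space UNIV)
    \<le> (\<integral>\<^sup>+ k. (\<Sum>j. ennreal ((2 ^ j) powr - a) * indicator (?E j) k) \<partial>count_space UNIV)"
    by (intro nn_integral_mono)
  also have "\<dots> = (\<Sum>j. ennreal ((2 ^ j) powr - a) * of_nat (card (?E j)))"
    by (subst nn_integral_suminf) (auto simp: nn_integral_cmult_indicator emeasure_count_space card(1)[unfolded power_Suc])
  also have "\<dots> \<le> (\<Sum>j. ennreal (6 ^ ?d * (2 powr (real ?d - a)) ^ j))"
  proof (intro suminf_le allI summableI)
    fix j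
    have "(2 ^ j) powr - a * real (card (?E j)) \<le> (2 ^ j) powr - a * (6 * 2 ^ j) ^ ?d"
      by (intro mult_left_mono card) auto
    also have "\<dots> = 6 ^ ?d * ((2 ^ j) powr - a * (2 ^ j) powr real ?d)"
      by (simp add: power_mult_distrib powr_realpow)
    also have "\<dots> = 6 ^ ?d * (2 powr (real ?d - a)) ^ j"
    proof -
      have "(2 ^ j) powr - a * (2 ^ j) powr real ?d = (2 powr real j) powr (real ?d - a)"
        by (simp only: powr_add[symmetric] uminus_add_conv_diff powr_realpow[of 2 j, simplified])
      also have "\<dots> = (2 powr (real ?d - a)) powr real j" by (simp add: powr_powr mult.commute)
      also have "\<dots> = (2 powr (real ?d - a)) ^ j" by (simp add: powr_realpow)
      finally show ?thesis by simp
    qed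
    finally show "ennreal ((2 ^ j) powr - a) * of_nat (card (?E j)) \<le> ennreal (6 ^ ?d * (2 powr (real ?d - a)) ^ j)"
      by (simp add: ennreal_of_nat_eq_real_of_nat ennreal_mult[symmetric] ennreal_leI)
  qed
  also have "\<dots> = ennreal (\<Sum>j. 6 ^ ?d * (2 powr (real ?d - a)) ^ j)"
  proof (rule suminf_ennreal2)
    have "2 powr (real ?d - a) < 1" using a by (simp add: powr_less_one)
    then show "summable (\<lambda>j. 6 ^ ?d * (2 powr (real ?d - a)) ^ j)"
      by (intro summable_mult summable_geometric) simp
  qed auto
  finally show ?thesis using ennreal_less_top order_le_less_trans by blast
qed

text \<open>The disjoint cubes [2^j, 2^(j+1))^d each hold 2^(j d) points of weight at most (1 + 2d)
  2^j. Every cube therefore contributes at least the same constant \<open>c\<close>, even at the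
  endpoint a = d.\<close>

lemma lattice_sum_unbounded:
  assumes a: "a \<le> real CARD('n::finite)"
  shows "\<exists>A :: (int^'n) set. finite A \<and> M \<le> (\<Sum>k\<in>A. lattice_weight k powr - a)"
proof -
  let ?d = "CARD('n)"
  let ?I = "\<lambda>j. {2 ^ j ..< 2 ^ Suc j :: int}"
  let ?E = "\<lambda>j. {k::int^'n. \<forall>i. k $ i \<in> ?I j}"
  define c where "c = (1 + 2 * real ?d) powr - real ?d"
  have c: "c > 0" by (simp add: c_def)
  have fin: "finite (?E j)" for j by (rule finite_vec_box) simp
  have E: "c \<le> (\<Sum>k\<in>?E j. lattice_weight k powr - a)" for j
  proof -
    have "(2 ^ j) powr - real ?d * c \<le> lattice_weight k powr - a" if k: "k \<in> ?E j" for k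
    proof -
      have "norm (lattice_pt k) \<le> (\<Sum>i\<in>UNIV. \<bar>lattice_pt k $ i\<bar>)" by (rule norm_le_l1_cart)
      also have "\<dots> \<le> (\<Sum>i\<in>(UNIV::'n set). 2 * 2 ^ j)"
      proof (rule sum_mono)
        fix i
        have "2 ^ j \<le> k $ i" "k $ i < 2 * 2 ^ j" using k by auto
        moreover have "(0::int) \<le> 2 ^ j" by simp
        ultimately have "0 \<le> k $ i" "k $ i \<le> 2 * 2 ^ j" by linarith+
        then have "real_of_int (k $ i) \<le> real_of_int (2 * 2 ^ j)" by (simp only: of_int_le_iff)
        then show "\<bar>lattice_pt k $ i\<bar> \<le> 2 * 2 ^ j" using \<open>0 \<le> k $ i\<close> by (simp add: lattice_pt_def)
      qed
      also have "\<dots> = 2 * real ?d * 2 ^ j" by simp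
      finally have "lattice_weight k \<le> 1 + 2 * real ?d * 2 ^ j"
        using japanese_bracket_le[of "lattice_pt k"] by linarith
      also have "\<dots> \<le> (1 + 2 * real ?d) * 2 ^ j" by (simp add: algebra_simps)
      finally have le: "lattice_weight k \<le> (1 + 2 * real ?d) * 2 ^ j" .
      have "(2 ^ j) powr - real ?d * c = ((1 + 2 * real ?d) * 2 ^ j) powr - real ?d"
        by (simp add: c_def powr_mult)
      also have "\<dots> \<le> lattice_weight k powr - real ?d"
        using le japanese_bracket_pos[of "lattice_pt k"] by (intro powr_mono2') auto
      also have "\<dots> \<le> lattice_weight k powr - a"
        using a japanese_bracket_ge_1[of "lattice_pt k"] by (intro powr_mono) auto
      finally show ?thesis .
    qed
    then have "(\<Sum>k\<in>?E j. (2 ^ j) powr - real ?d * c) \<le> (\<Sum>k\<in>?E j. lattice_weight k powr - a)"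
      by (rule sum_mono)
    moreover have "(\<Sum>k\<in>?E j. (2 ^ j) powr - real ?d * c) = c"
    proof -
      have "card (?E j) = (2 ^ j) ^ ?d" by (subst card_vec_box) (auto simp: nat_power_eq)
      then have "real (card (?E j)) = (2 ^ j) powr real ?d" by (simp add: powr_realpow)
      then show ?thesis by (simp add: powr_add[symmetric] flip: mult.assoc)
    qed
    ultimately show ?thesis by (simp only:)
  qed
  have disj: "?E i \<inter> ?E j = {}" if "i \<noteq> j" for i j
  proof -
    have lt: "?E i \<inter> ?E j = {}" if "i < j" for i j
    proof (rule ccontr)
      assume "?E i \<inter> ?E j \<noteq> {}"
      then obtain k :: "int^'n" where k: "k \<in> ?E i" "k \<in> ?E j" by blast
      have "(2::int) ^ Suc i \<le> 2 ^ j" using that by (intro power_increasing) auto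
      \<comment> \<open>\<open>undefined\<close> serves as an arbitrary coordinate; any one of them
        separates the two cubes.\<close>
      moreover have "2 ^ j \<le> k $ undefined" "k $ undefined < 2 ^ Suc i" using k by auto
      ultimately show False by linarith
    qed
    from that have "i < j \<or> j < i" by linarith
    then show ?thesis
    proof
      assume "j < i"
      from lt[OF this] show ?thesis by (subst Int_commute)
    qed (rule lt)
  qed
  obtain n where n: "M \<le> real n * c" using c by (metis ex_less_of_nat_mult less_imp_le)
  let ?A = "\<Union>j<n. ?E j"
  have "real n * c = (\<Sum>j<n. c)" by simp
  also have "\<dots> \<le> (\<Sum>j<n. \<Sum>k\<in>?E j. lattice_weight k powr - a)" by (intro sum_mono E)
  also have "\<dots> = (\<Sum>k\<in>?A. lattice_weight k powr - a)"
    by (intro sum.UNION_disjoint[symmetric]) (use fin disj in auto)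
  finally have "M \<le> (\<Sum>k\<in>?A. lattice_weight k powr - a)" using n by linarith
  then show ?thesis using fin by (intro exI[of _ ?A]) auto
qed

subsection \<open>The decomposition operators\<close>

lemma partition_schwartz: "uniform_partition \<sigma> \<Longrightarrow> \<sigma> \<in> schwartz"
  unfolding uniform_partition_def by (rule schwartz_compact_support[where r = "3/4"]) auto

lemma lattice_pt_0 [simp]: "lattice_pt 0 = 0"
  by (simp add: lattice_pt_def vec_eq_iff)

lemma lattice_pt_nth [simp]: "lattice_pt k $ i = of_int (k $ i)"
  by (simp add: lattice_pt_def)

lemma partition_sum:
  fixes \<sigma> :: "real^'n::finite \<Rightarrow> complex"
  assumes \<sigma>: "uniform_partition \<sigma>" and "finite A"
    and A: "\<And>k. k \<notin> A \<Longrightarrow> \<exists>i. \<bar>\<xi> $ i - of_int (k $ i)\<bar> > 3/4"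
  shows "(\<Sum>k\<in>A. \<sigma> (\<xi> - lattice_pt k)) = 1"
proof -
  have zero: "\<sigma> (\<xi> - lattice_pt k) = 0" if "k \<notin> A" for k
    using A[OF that] \<sigma> unfolding uniform_partition_def by auto
  have "((\<lambda>k. \<sigma> (\<xi> - lattice_pt k)) has_sum 1) UNIV"
    using \<sigma> unfolding uniform_partition_def by blast
  then have "((\<lambda>k. \<sigma> (\<xi> - lattice_pt k)) has_sum 1) A"
    by (subst (asm) has_sum_cong_neutral[where T = A]) (auto simp: zero)
  then show ?thesis using has_sum_finite[OF \<open>finite A\<close>] has_sum_unique by blast
qed

text \<open>Rests on 1 - 3/16 > 3/4: within 3/16 of a lattice point in every coordinate, all other
  translates of the partition function vanish. Only one summand remains there, and the partition of
  unity forces it to be 1.\<close>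

lemma partition_other:
  fixes \<sigma> :: "real^'n::finite \<Rightarrow> complex" and \<xi> :: "real^'n"
  assumes \<sigma>: "uniform_partition \<sigma>" and \<xi>: "\<And>i. \<bar>\<xi> $ i - of_int (k $ i)\<bar> \<le> 3/16" and l: "l \<noteq> k"
  shows "\<exists>i. \<bar>\<xi> $ i - of_int (l $ i)\<bar> > 3/4"
proof -
  obtain i where "l $ i \<noteq> k $ i" using l by (auto simp: vec_eq_iff)
  then have "1 \<le> \<bar>k $ i - l $ i\<bar>" by linarith
  then have "1 \<le> \<bar>real_of_int (k $ i) - real_of_int (l $ i)\<bar>" by linarith
  then show ?thesis using \<xi>[of i] by (intro exI[of _ i]) linarith
qed

lemma partition_one:
  fixes \<sigma> :: "real^'n::finite \<Rightarrow> complex" and \<xi> :: "real^'n"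
  assumes \<sigma>: "uniform_partition \<sigma>" and \<xi>: "\<And>i. \<bar>\<xi> $ i - of_int (k $ i)\<bar> \<le> 3/16"
  shows "\<sigma> (\<xi> - lattice_pt l) = (if l = k then 1 else 0)"
proof (cases "l = k")
  case True
  then show ?thesis using partition_sum[OF \<sigma>, of "{k}" \<xi>] partition_other[OF \<sigma> \<xi>] by auto
next
  case False
  then show ?thesis using partition_other[OF \<sigma> \<xi> False] \<sigma> unfolding uniform_partition_def by auto
qed

text \<open>The sum over the 3^d translates nearest the origin. It equals 1 wherever no coordinate
  exceeds 3/4 in modulus, so it acts as a smooth cut-off that reproduces the partition
  function.\<close>

definition fat_partition :: "(real^'n::finite \<Rightarrow> complex) \<Rightarrow> real^'n \<Rightarrow> complex"
  where "fat_partition \<sigma> \<xi> = (\<Sum>k | \<forall>i. k $ i \<in> {-1..1}. \<sigma> (\<xi> - lattice_pt k))"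

lemma fat_partition_schwartz: "uniform_partition \<sigma> \<Longrightarrow> fat_partition \<sigma> \<in> schwartz"
  unfolding fat_partition_def
  by (intro schwartz_sum schwartz_translate partition_schwartz)

lemma fat_partition_mult:
  fixes \<sigma> :: "real^'n::finite \<Rightarrow> complex"
  assumes \<sigma>: "uniform_partition \<sigma>"
  shows "\<sigma> \<xi> * fat_partition \<sigma> \<xi> = \<sigma> \<xi>"
proof (cases "\<exists>i. \<bar>\<xi> $ i\<bar> > 3/4")
  case True
  then show ?thesis using \<sigma> unfolding uniform_partition_def by auto
next
  case False
  have "fat_partition \<sigma> \<xi> = 1"
    unfolding fat_partition_def
  proof (rule partition_sum[OF \<sigma>])
    show "finite {k::int^'n. \<forall>i. k $ i \<in> {-1..1}}" by (rule finite_vec_box) simp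
    fix k :: "int^'n" assume "k \<notin> {k. \<forall>i. k $ i \<in> {-1..1}}"
    then obtain i where "k $ i \<notin> {-1..1}" by auto
    then have "2 \<le> \<bar>k $ i\<bar>" by auto
    then have "2 \<le> \<bar>real_of_int (k $ i)\<bar>" by linarith
    moreover have "\<bar>\<xi> $ i\<bar> \<le> 3/4" using False by (meson not_le)
    ultimately show "\<exists>i. \<bar>\<xi> $ i - of_int (k $ i)\<bar> > 3/4" by (intro exI[of _ i]) linarith
  qed
  then show ?thesis by simp
qed

text \<open>The partition function may take complex values. Its squared modulus is non-negative and
  still a Schwartz function, being a product with the conjugate.\<close>

definition bump :: "(real^'n::finite \<Rightarrow> complex) \<Rightarrow> real^'n \<Rightarrow> real"
  where "bump \<sigma> x = (norm (\<sigma> x))\<^sup>2"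

lemma bump_props:
  fixes \<sigma> :: "real^'n::finite \<Rightarrow> complex"
  assumes \<sigma>: "uniform_partition \<sigma>"
  shows "(\<lambda>x. of_real (bump \<sigma> x)) \<in> schwartz" and "bump \<sigma> x \<ge> 0" and "bump \<sigma> 0 > 0"
    and bump_support: "\<bar>x $ i\<bar> > 3/4 \<Longrightarrow> bump \<sigma> x = 0"
    and "norm x > real CARD('n) \<Longrightarrow> bump \<sigma> x = 0"
proof -
  have "(\<lambda>x. of_real (bump \<sigma> x)) = (\<lambda>x. \<sigma> x * cnj (\<sigma> x))"
    by (simp only: bump_def complex_norm_square)
  then show "(\<lambda>x. of_real (bump \<sigma> x)) \<in> schwartz"
    using schwartz_mult[OF partition_schwartz[OF \<sigma>] schwartz_cnj[OF partition_schwartz[OF \<sigma>]]] by simp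
  show "bump \<sigma> x \<ge> 0" by (simp add: bump_def)
  show "bump \<sigma> 0 > 0" using partition_one[OF \<sigma>, of 0 0 0] by (simp add: bump_def)
  show sup: "bump \<sigma> x = 0" if "\<bar>x $ i\<bar> > 3/4" for x i
    using \<sigma> that unfolding uniform_partition_def bump_def by auto
  assume n: "norm x > real CARD('n)"
  have "\<exists>i. \<bar>x $ i\<bar> > 3/4"
  proof (rule ccontr)
    assume "\<not> ?thesis"
    then have "(\<Sum>i\<in>UNIV. \<bar>x $ i\<bar>) \<le> (\<Sum>i\<in>(UNIV::'n set). 3/4)"
      by (intro sum_mono) (meson not_le)
    then show False using n norm_le_l1_cart[of x] by simp
  qed
  then show "bump \<sigma> x = 0" using sup by blast
qed

text \<open>By \<open>tempered_conv\<close> the box operator is integration against this function,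
  and \<open>tempered_kernel_slowly_lipschitz\<close> makes it continuous, so the definite
  description is resolved for every tempered \<open>f\<close>.\<close>

lemma function_of_box:
  fixes \<sigma> :: "real^'n::finite \<Rightarrow> complex"
  assumes \<sigma>: "uniform_partition \<sigma>" and f: "f \<in> tempered"
  shows "function_of (box_op \<sigma> k f) = (\<lambda>x. f (fourier_kernel (\<lambda>\<xi>. \<sigma> (\<xi> - lattice_pt k)) x))"
proof -
  note S = partition_schwartz[OF \<sigma>]
  let ?m = "\<lambda>\<xi>. \<sigma> (\<xi> - lattice_pt k)"
  have m: "?m \<in> schwartz" by (intro schwartz_translate S)
  obtain N B where G: "slowly_lipschitz N B (\<lambda>x. f (fourier_kernel ?m x))"
    using tempered_kernel_slowly_lipschitz[OF f m] by blast
  show ?thesis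
  proof (rule function_of_eqI[OF _ _ _ bump_props(1,2,3,5)[OF \<sigma>]])
    show c: "continuous_on UNIV (\<lambda>x. f (fourier_kernel ?m x))" by (rule slowly_lipschitz_continuous[OF G])
    fix \<phi> :: "real^'n \<Rightarrow> complex" assume \<phi>: "\<phi> \<in> schwartz"
    show "integrable lborel (\<lambda>x. f (fourier_kernel ?m x) * \<phi> x)"
      using borel_measurable_continuous_onI[OF c] slowly_lipschitz_poly_growth[OF G] \<phi>
      by (rule schwartz_integrable_poly)
    show "box_op \<sigma> k f \<phi> = (LINT x|lborel. f (fourier_kernel ?m x) * \<phi> x)"
      unfolding distr_box[OF f S \<phi>] tempered_conv[OF f m \<phi>] by (simp add: mult.commute)
  qed
qed

lemma box_reproducing:
  fixes \<sigma> :: "real^'n::finite \<Rightarrow> complex" and k :: "int^'n"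
  assumes \<sigma>: "uniform_partition \<sigma>" and f: "f \<in> tempered"
  defines "g \<equiv> function_of (box_op \<sigma> k f)"
  shows "continuous_on UNIV g" and "poly_growth g"
    and "ennreal (norm (g x)) \<le> (\<integral>\<^sup>+ y. ennreal (norm (inv_fourier (fat_partition \<sigma>) (x - y)) * norm (g y)) \<partial>lborel)"
proof -
  let ?m = "\<lambda>\<xi>. \<sigma> (\<xi> - lattice_pt k)" and ?h = "\<lambda>\<xi>. fat_partition \<sigma> (\<xi> - lattice_pt k)"
  have m: "?m \<in> schwartz" "?h \<in> schwartz"
    by (intro schwartz_translate partition_schwartz fat_partition_schwartz \<sigma>)+
  have g: "g = (\<lambda>x. f (fourier_kernel ?m x))" unfolding g_def by (rule function_of_box[OF \<sigma> f])
  obtain N B where G: "slowly_lipschitz N B g"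
    using tempered_kernel_slowly_lipschitz[OF f m(1)] unfolding g by blast
  show c: "continuous_on UNIV g" and pg: "poly_growth g"
    using slowly_lipschitz_continuous[OF G] slowly_lipschitz_poly_growth[OF G] by auto
  have "g x = (LINT y|lborel. inv_fourier ?h (x - y) * g y)"
    unfolding g by (rule kernel_reproducing[OF f m]) (simp add: fat_partition_mult[OF \<sigma>])
  moreover have "integrable lborel (\<lambda>y. inv_fourier ?h (x - y) * g y)"
    using schwartz_integrable_poly[OF borel_measurable_continuous_onI[OF c] pg, of "\<lambda>y. inv_fourier ?h (x - y)"]
      schwartz_reflect[OF schwartz_inv_fourier[OF m(2)]] by (simp add: mult.commute)
  ultimately have "ennreal (norm (g x)) \<le> (\<integral>\<^sup>+ y. ennreal (norm (inv_fourier ?h (x - y) * g y)) \<partial>lborel)"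
    using integral_norm_bound_ennreal by metis
  \<comment> \<open>Shifting the symbol by a lattice point multiplies the kernel by a character,
    which the modulus removes.\<close>
  also have "\<dots> = (\<integral>\<^sup>+ y. ennreal (norm (inv_fourier (fat_partition \<sigma>) (x - y)) * norm (g y)) \<partial>lborel)"
    by (simp add: inv_fourier_translate[OF fat_partition_schwartz[OF \<sigma>]] norm_mult)
  finally show "ennreal (norm (g x)) \<le> (\<integral>\<^sup>+ y. ennreal (norm (inv_fourier (fat_partition \<sigma>) (x - y)) * norm (g y)) \<partial>lborel)" .
qed

subsection \<open>Bernstein's inequality\<close>

text \<open>For \<open>r < 1\<close> the maximal function \<open>sup\<^sub>y |g y| / (1 + |x - y|)\<^bsup>N\<^esup>\<close> is finite for large \<open>N\<close>
  and can be absorbed. The resulting constant depends on \<open>N\<close>, so the lemma is applied twice: once to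
  see that \<open>g\<close> is bounded, and once more with \<open>N = 0\<close>.\<close>

lemma bernstein_small_exponent:
  fixes g \<kappa> :: "real^'n::finite \<Rightarrow> complex"
  assumes r: "0 < r" "r < 1" and g [measurable]: "g \<in> borel_measurable borel"
    and growth: "\<And>x. norm (g x) \<le> B * (1 + norm x) ^ N"
    and \<kappa>: "\<And>x. norm (\<kappa> x) \<le> D / (1 + norm x) ^ N"
    and rep: "\<And>x. ennreal (norm (g x)) \<le> (\<integral>\<^sup>+ y. ennreal (norm (\<kappa> (x - y)) * norm (g y)) \<partial>lborel)"
    and int: "(\<integral>\<^sup>+ y. ennreal (norm (g y) powr r) \<partial>lborel) \<le> 1"
  shows "norm (g x) \<le> D powr (1 / r)"
proof -
  define w where "w = (\<lambda>z::real^'n. (1 + norm z) ^ N)"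
  have w1: "1 \<le> w z" for z by (simp add: w_def)
  have w0: "0 < w z" for z using w1[of z] by linarith
  have wm: "w (x + y) \<le> w x * w y" for x y
    unfolding w_def power_mult_distrib[symmetric] by (intro power_mono one_plus_norm_le_mult) auto
  have D0: "0 \<le> D" using order_trans[OF norm_ge_zero \<kappa>[of 0]] by simp
  have B0: "0 \<le> B" using order_trans[OF norm_ge_zero growth[of 0]] by simp
  define v where "v = (\<lambda>y. norm (g y) / w (x - y))"
  have bdd: "bdd_above (range v)"
  proof (rule bdd_aboveI2)
    fix y
    have "norm (g y) \<le> B * w y" using growth by (simp add: w_def)
    also have "\<dots> \<le> B * (w x * w (y - x))" using wm[of x "y - x"] B0 by (intro mult_left_mono) auto
    also have "w (y - x) = w (x - y)" by (simp add: w_def norm_minus_commute)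
    finally show "v y \<le> B * w x" using w0[of "x - y"] by (simp add: v_def divide_le_eq mult.assoc)
  qed
  define A where "A = (SUP y. v y)"
  have vA: "v y \<le> A" for y unfolding A_def by (intro cSUP_upper bdd) auto
  have A0: "0 \<le> A" using order_trans[OF _ vA[of 0]] w0[of "x - 0"] by (simp add: v_def)
  have gA: "norm (g y) \<le> A * w (x - y)" for y
    using vA[of y] w0[of "x - y"] by (simp add: v_def divide_le_eq)
  \<comment> \<open>Split |g z| = |g z|^(1-r) |g z|^r. The first factor is controlled by
    \<open>A\<close> and the weight, which the kernel's decay absorbs; the second has integral at
    most 1. The resulting bound A <= A^(1-r) D can be divided out because polynomial growth makes
    \<open>A\<close> finite.\<close>
  have "v y \<le> A powr (1 - r) * D" for y
  proof -
    have "norm (\<kappa> (y - z)) * norm (g z) \<le> (A powr (1 - r) * D * w (x - y)) * norm (g z) powr r" for z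
    proof -
      have "norm (g z) = norm (g z) powr (1 - r) * norm (g z) powr r" by (simp flip: powr_add)
      moreover have "norm (g z) powr (1 - r) \<le> A powr (1 - r) * w (x - z)"
      proof -
        have "norm (g z) powr (1 - r) \<le> (A * w (x - z)) powr (1 - r)" using gA r by (intro powr_mono2) auto
        also have "\<dots> = A powr (1 - r) * w (x - z) powr (1 - r)" using A0 w0[of "x - z"] by (simp add: powr_mult)
        also have "\<dots> \<le> A powr (1 - r) * w (x - z) powr 1"
          using r w1 by (intro mult_left_mono powr_mono) auto
        also have "w (x - z) powr 1 = w (x - z)" using w0[of "x - z"] by simp
        finally show ?thesis .
      qed
      moreover have "norm (\<kappa> (y - z)) * w (x - z) \<le> D * w (x - y)"
      proof -
        have "norm (\<kappa> (y - z)) * w (x - z) \<le> D / w (y - z) * (w (x - y) * w (y - z))"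
          using \<kappa>[of "y - z"] wm[of "x - y" "y - z"] D0 w0[of "y - z"] w0[of "x - z"]
          by (intro mult_mono) (auto simp: w_def)
        also have "\<dots> = D * w (x - y)" using w0[of "y - z"] by simp
        finally show ?thesis .
      qed
      ultimately have "norm (\<kappa> (y - z)) * norm (g z) \<le> norm (\<kappa> (y - z)) * (A powr (1 - r) * w (x - z) * norm (g z) powr r)"
        by (intro mult_left_mono) (metis mult_right_mono powr_ge_zero, simp)
      also have "\<dots> = A powr (1 - r) * (norm (\<kappa> (y - z)) * w (x - z)) * norm (g z) powr r" by (simp add: mult_ac)
      also have "\<dots> \<le> A powr (1 - r) * (D * w (x - y)) * norm (g z) powr r"
        using \<open>norm (\<kappa> (y - z)) * w (x - z) \<le> D * w (x - y)\<close> by (intro mult_right_mono mult_left_mono) auto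
      finally show ?thesis by (simp add: mult_ac)
    qed
    then have "ennreal (norm (g y)) \<le> (\<integral>\<^sup>+ z. ennreal (A powr (1 - r) * D * w (x - y)) * ennreal (norm (g z) powr r) \<partial>lborel)"
      using D0 w0[of "x - y"]
      by (intro order_trans[OF rep] nn_integral_mono) (auto simp: ennreal_mult[symmetric] intro!: ennreal_leI)
    also have "\<dots> \<le> ennreal (A powr (1 - r) * D * w (x - y)) * 1"
      by (subst nn_integral_cmult, measurable) (intro mult_left_mono int, simp)
    finally have "norm (g y) \<le> A powr (1 - r) * D * w (x - y)"
      using D0 w0[of "x - y"] by simp
    then show ?thesis using w0[of "x - y"] by (simp add: v_def divide_le_eq)
  qed
  then have AD: "A \<le> A powr (1 - r) * D" unfolding A_def by (intro cSUP_least) auto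
  have "A \<le> D powr (1 / r)"
  proof (cases "A = 0")
    case False
    then have "A > 0" using A0 by simp
    have "A powr r * A powr (1 - r) \<le> D * A powr (1 - r)"
      using AD \<open>A > 0\<close> by (simp add: powr_add[symmetric] mult.commute)
    then have "A powr r \<le> D" using \<open>A > 0\<close> by simp
    then have "(A powr r) powr (1 / r) \<le> D powr (1 / r)" using r by (intro powr_mono2) auto
    then show ?thesis using r \<open>A > 0\<close> by (simp add: powr_powr)
  qed simp
  moreover have "norm (g x) \<le> A" using vA[of x] by (simp add: v_def w_def)
  ultimately show ?thesis by linarith
qed

text \<open>The constant depends on the kernel and on p only. For p infinite it is governed by the
  L^1 norm of the kernel. For finite r at least 1 and normalised h, the bound |kappa| |h| <= |kappa|
  + K |h|^r replaces Hoelder's inequality, and smaller r are covered by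
  \<open>bernstein_small_exponent\<close>.\<close>

lemma bernstein:
  fixes \<kappa> :: "real^'n::finite \<Rightarrow> complex"
  assumes \<kappa>: "\<kappa> \<in> schwartz" and p: "0 < p"
  shows "\<exists>C\<ge>1. \<forall>g. continuous_on UNIV g \<longrightarrow> poly_growth g \<longrightarrow>
    (\<forall>x. ennreal (norm (g x)) \<le> (\<integral>\<^sup>+ y. ennreal (norm (\<kappa> (x - y)) * norm (g y)) \<partial>lborel)) \<longrightarrow>
    Lp_norm lborel p (\<lambda>x. ennreal (norm (g x))) < top \<longrightarrow>
    (\<forall>x. ennreal (norm (g x)) \<le> ennreal C * Lp_norm lborel p (\<lambda>x. ennreal (norm (g x))))"
proof -
  have [measurable]: "\<kappa> \<in> borel_measurable borel" using \<kappa> schwartz_measurable by blast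
  obtain K0 where K0: "\<And>x. norm (\<kappa> x) \<le> K0"
    using schwartz_bounded[OF \<kappa>, of 0] by auto
  define K where "K = max K0 1"
  have K: "K > 0" "norm (\<kappa> x) \<le> K" for x
    using K0[of x] by (auto simp: K_def)
  define I where "I = (LINT x|lborel. norm (\<kappa> x))"
  have I0: "I \<ge> 0" by (simp add: I_def)
  have intk: "(\<integral>\<^sup>+ y. ennreal (norm (\<kappa> (x - y))) \<partial>lborel) = ennreal I" for x
  proof -
    have "(\<integral>\<^sup>+ y. ennreal (norm (\<kappa> (x - y))) \<partial>lborel) = (\<integral>\<^sup>+ y. ennreal (norm (\<kappa> y)) \<partial>lborel)"
      using lborel_nn_integral_affine[of "-1" "\<lambda>y. ennreal (norm (\<kappa> y))" x] by simp
    also have "\<dots> = ennreal I"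
      unfolding I_def by (intro nn_integral_eq_integral integrable_norm schwartz_integrable \<kappa>) auto
    finally show ?thesis .
  qed
  show ?thesis using p
  proof (cases rule: ereal_cases_pos)
    case 1
    show ?thesis
    proof (intro exI[of _ "max 1 I"] conjI allI impI)
      fix g :: "real^'n \<Rightarrow> complex" and x
      assume c: "continuous_on UNIV g"
        and rep: "\<forall>x. ennreal (norm (g x)) \<le> (\<integral>\<^sup>+ y. ennreal (norm (\<kappa> (x - y)) * norm (g y)) \<partial>lborel)"
      have [measurable]: "g \<in> borel_measurable borel" using c by (rule borel_measurable_continuous_onI)
      let ?E = "Lp_norm lborel p (\<lambda>x. ennreal (norm (g x)))"
      have "AE y in lborel. ennreal (norm (g y)) \<le> ?E" unfolding 1 Lp_norm_infinity by (rule esssup_AE)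
      then have "(\<integral>\<^sup>+ y. ennreal (norm (\<kappa> (x - y)) * norm (g y)) \<partial>lborel) \<le> (\<integral>\<^sup>+ y. ennreal (norm (\<kappa> (x - y))) * ?E \<partial>lborel)"
        by (intro nn_integral_mono_AE) (auto elim!: eventually_mono simp: ennreal_mult intro!: mult_left_mono)
      also have "\<dots> = ennreal I * ?E" by (subst nn_integral_multc) (auto simp: intk)
      also have "\<dots> \<le> ennreal (max 1 I) * ?E" by (intro mult_right_mono ennreal_leI) auto
      finally show "ennreal (norm (g x)) \<le> ennreal (max 1 I) * ?E" using rep order_trans by blast
    qed simp
  next
    case (2 r)
    let ?C = "max 1 (max (I + K) (K powr (1 / r)))"
    show ?thesis
    proof (intro exI[of _ ?C] conjI allI impI)
      fix g :: "real^'n \<Rightarrow> complex" and x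
      assume c: "continuous_on UNIV g" and pg: "poly_growth g"
        and rep: "\<forall>x. ennreal (norm (g x)) \<le> (\<integral>\<^sup>+ y. ennreal (norm (\<kappa> (x - y)) * norm (g y)) \<partial>lborel)"
        and fin: "Lp_norm lborel p (\<lambda>x. ennreal (norm (g x))) < top"
      have [measurable]: "g \<in> borel_measurable borel" using c by (rule borel_measurable_continuous_onI)
      show "ennreal (norm (g x)) \<le> ennreal ?C * Lp_norm lborel p (\<lambda>x. ennreal (norm (g x)))"
      proof (rule scaling_le[OF _ fin])
        fix t :: real assume t: "t > 0" and le: "ennreal t * Lp_norm lborel p (\<lambda>x. ennreal (norm (g x))) \<le> 1"
        define h where "h = (\<lambda>x. of_real t * g x)"
        have nh: "norm (h x) = t * norm (g x)" for x using t by (simp add: h_def norm_mult)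
        have hm [measurable]: "h \<in> borel_measurable borel" unfolding h_def by measurable
        have "Lp_norm lborel p (\<lambda>x. ennreal (norm (h x))) \<le> 1"
          using le t Lp_norm_cmult[OF p, of "\<lambda>x. ennreal (norm (g x))" lborel t] by (simp add: nh ennreal_mult)
        then have int: "(\<integral>\<^sup>+ y. ennreal (norm (h y) powr r) \<partial>lborel) \<le> 1"
          unfolding 2(1) Lp_norm_ereal_le_iff[OF 2(2)] by simp
        have reph: "ennreal (norm (h x)) \<le> (\<integral>\<^sup>+ y. ennreal (norm (\<kappa> (x - y)) * norm (h y)) \<partial>lborel)" for x
        proof -
          have "ennreal (norm (h x)) \<le> ennreal t * (\<integral>\<^sup>+ y. ennreal (norm (\<kappa> (x - y)) * norm (g y)) \<partial>lborel)"
            using rep t by (simp add: nh ennreal_mult mult_left_mono)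
          also have "\<dots> = (\<integral>\<^sup>+ y. ennreal t * ennreal (norm (\<kappa> (x - y)) * norm (g y)) \<partial>lborel)"
            by (intro nn_integral_cmult[symmetric]) measurable
          also have "\<dots> = (\<integral>\<^sup>+ y. ennreal (norm (\<kappa> (x - y)) * norm (h y)) \<partial>lborel)"
            using t by (simp add: nh ennreal_mult[symmetric] mult_ac)
          finally show ?thesis .
        qed
        have "norm (h x) \<le> ?C"
        proof (cases "r < 1")
          case True
          obtain B N where B: "\<And>x. norm (h x) \<le> B * (1 + norm x) ^ N"
          proof -
            obtain B N where "\<And>x. norm (g x) \<le> B * (1 + norm x) ^ N" using pg unfolding poly_growth_def by blast
            then have "norm (h x) \<le> t * B * (1 + norm x) ^ N" for x using t by (simp add: nh mult.assoc mult_left_mono)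
            then show ?thesis using that by blast
          qed
          obtain D where "\<And>x. norm (\<kappa> x) \<le> D / (1 + norm x) ^ N" using schwartz_decay[OF \<kappa>] by metis
          then have "norm (h x) \<le> D powr (1 / r)" for x
            by (intro bernstein_small_exponent[OF 2(2) True hm B _ reph int])
          then have "norm (h x) \<le> D powr (1 / r) * (1 + norm x) ^ 0" for x by simp
          then have "norm (h x) \<le> K powr (1 / r)"
            by (rule bernstein_small_exponent[OF 2(2) True hm _ _ reph int]) (simp add: K)
          then show ?thesis by simp
        next
          case False
          have "norm (\<kappa> (x - y)) * norm (h y) \<le> norm (\<kappa> (x - y)) + K * norm (h y) powr r" for y
          proof (cases "norm (h y) \<le> 1")
            case True
            then have "norm (\<kappa> (x - y)) * norm (h y) \<le> norm (\<kappa> (x - y)) * 1" by (intro mult_left_mono) auto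
            then show ?thesis using K(1) by (simp add: add_increasing2)
          next
            case F: False
            then have "norm (h y) powr 1 \<le> norm (h y) powr r" using False by (intro powr_mono) auto
            then have "norm (\<kappa> (x - y)) * norm (h y) \<le> K * norm (h y) powr r"
              using F K by (intro mult_mono) auto
            then show ?thesis by (simp add: add_increasing)
          qed
          then have "ennreal (norm (h x)) \<le> (\<integral>\<^sup>+ y. ennreal (norm (\<kappa> (x - y))) + ennreal K * ennreal (norm (h y) powr r) \<partial>lborel)"
            using K(1) by (intro order_trans[OF reph] nn_integral_mono) (auto simp: ennreal_mult[symmetric] simp flip: ennreal_plus intro!: ennreal_leI)
          also have "\<dots> = ennreal I + ennreal K * (\<integral>\<^sup>+ y. ennreal (norm (h y) powr r) \<partial>lborel)"
            by (subst nn_integral_add) (auto simp: intk nn_integral_cmult)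
          also have "\<dots> \<le> ennreal I + ennreal K * 1" by (intro add_left_mono mult_left_mono int) auto
          also have "\<dots> = ennreal (I + K)" using I0 K(1) by simp
          finally have "norm (h x) \<le> I + K" using I0 K(1) by (simp add: ennreal_le_iff del: ennreal_plus)
          then show ?thesis by simp
        qed
        then show "ennreal t * ennreal (norm (g x)) \<le> ennreal ?C"
          using t by (simp add: ennreal_mult[symmetric] nh[symmetric] ennreal_leI del: max.bounded_iff)
      qed simp
    qed simp
  qed
qed

subsection \<open>Sufficiency\<close>

text \<open>For q1 > r let 1/t = 1/r - 1/q1. The condition on s then says exactly s t > d, that is,
  summability of the weights to the power -t.\<close>

lemma sequence_embedding:
  fixes p q1 :: ereal
  assumes r: "0 < r" and q1: "0 < q1"
    and cond: "(q1 \<le> r \<and> s \<ge> 0) \<or> (q1 > r \<and> ereal s + ereal (real CARD('n)) / q1 > ereal (real CARD('n)) / r)"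
  shows "\<exists>C\<ge>0. \<forall>a. lq_norm q1 (\<lambda>k::int^'n::finite. ennreal (lattice_weight k powr s) * a k) < top \<longrightarrow>
    lq_norm r a \<le> ennreal C * lq_norm q1 (\<lambda>k. ennreal (lattice_weight k powr s) * a k)"
  using cond
proof
  assume c: "q1 \<le> r \<and> s \<ge> 0"
  show ?thesis
  proof (intro exI[of _ 1] conjI allI impI)
    fix a :: "int^'n \<Rightarrow> ennreal"
    have "a k \<le> ennreal (lattice_weight k powr s) * a k" for k
    proof -
      have "1 \<le> lattice_weight k powr s" using c japanese_bracket_ge_1 by (intro ge_one_powr_ge_zero) auto
      then show ?thesis using mult_right_mono[of 1 "ennreal (lattice_weight k powr s)" "a k"] by simp
    qed
    then have "lq_norm q1 a \<le> lq_norm q1 (\<lambda>k. ennreal (lattice_weight k powr s) * a k)"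
      by (intro lq_norm_mono q1)
    then show "lq_norm r a \<le> ennreal 1 * lq_norm q1 (\<lambda>k. ennreal (lattice_weight k powr s) * a k)"
      using lq_norm_antimono[OF q1, of r a] c by simp
  qed simp
next
  assume c: "q1 > r \<and> ereal s + ereal (real CARD('n)) / q1 > ereal (real CARD('n)) / r"
  then obtain r' where r': "r = ereal r'" "0 < r'" using r by (cases r) auto
  define d where "d = real CARD('n)"
  have "\<exists>t>0. ereal (1 / r') = ereal (1 / t) + 1 / q1 \<and> s * t > d"
    using q1
  proof (cases rule: ereal_cases_pos)
    case 1
    then have "s > d / r'" using c r' by (simp add: d_def)
    then show ?thesis using 1 r' by (intro exI[of _ r']) (auto simp: field_simps)
  next
    case (2 u)
    have ru: "r' < u" using c r' 2 by simp
    have s: "s + d / u > d / r'" using c r' 2 by (simp add: d_def)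
    define t where "t = 1 / (1 / r' - 1 / u)"
    have pos: "1 / r' - 1 / u > 0" using ru r' 2 by (simp add: field_simps)
    then have t: "t > 0" "1 / t = 1 / r' - 1 / u" by (auto simp: t_def)
    have "s > d * (1 / t)" using s unfolding t(2) by (simp add: algebra_simps)
    then have "s * t > d" using t(1) by (simp add: field_simps)
    then show ?thesis using t 2 by (intro exI[of _ t]) (auto simp: one_ereal_def)
  qed
  then obtain t where t: "t > 0" "ereal (1 / r') = ereal (1 / t) + 1 / q1" "s * t > d" by blast
  have "(\<integral>\<^sup>+ k. ennreal ((lattice_weight (k::int^'n) powr s) powr - t) \<partial>count_space UNIV) < top"
    using lattice_sum_finite[where 'n = 'n, of "s * t"] t(3) by (simp add: powr_powr d_def)
  moreover have "0 < lattice_weight k powr s" for k :: "int^'n"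
    using japanese_bracket_pos[of "lattice_pt k"] by simp
  ultimately show ?thesis
    unfolding r'(1) by (intro lq_norm_weighted[OF _ r'(2) t(1) q1 t(2)])
qed

lemma embedding_sufficient:
  fixes \<sigma> :: "real^'n::finite \<Rightarrow> complex"
  assumes \<sigma>: "uniform_partition \<sigma>" and pos: "0 < p" "0 < p1" "0 < q" "0 < q1" and pp: "p1 \<le> p"
    and cond: "(q1 \<le> min p q \<and> s \<ge> 0) \<or> (q1 > min p q \<and> ereal s + ereal (real CARD('n)) / q1 > ereal (real CARD('n)) / min p q)"
  shows "continuously_embedded
      (modulation_space \<sigma> p1 q1 s) (modulation_norm \<sigma> p1 q1 s)
      (wiener_amalgam_space \<sigma> p q 0) (wiener_amalgam_norm \<sigma> p q 0)"
proof -
  let ?r = "min p q"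
  have r: "0 < ?r" using pos by simp
  let ?\<kappa> = "inv_fourier (fat_partition \<sigma>)"
  have \<kappa>: "?\<kappa> \<in> schwartz" by (intro schwartz_inv_fourier fat_partition_schwartz \<sigma>)
  obtain C1 where C1: "C1 \<ge> 1" "\<And>g x. continuous_on UNIV g \<Longrightarrow> poly_growth g \<Longrightarrow>
    (\<And>x. ennreal (norm (g x)) \<le> (\<integral>\<^sup>+ y. ennreal (norm (?\<kappa> (x - y)) * norm (g y)) \<partial>lborel)) \<Longrightarrow>
    Lp_norm lborel p1 (\<lambda>x. ennreal (norm (g x))) < top \<Longrightarrow>
    ennreal (norm (g x)) \<le> ennreal C1 * Lp_norm lborel p1 (\<lambda>x. ennreal (norm (g x)))"
    using bernstein[OF \<kappa> pos(2)] by blast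
  obtain C2 where C2: "C2 \<ge> 0" "\<And>a. lq_norm q1 (\<lambda>k::int^'n. ennreal (lattice_weight k powr s) * a k) < top \<Longrightarrow>
    lq_norm ?r a \<le> ennreal C2 * lq_norm q1 (\<lambda>k. ennreal (lattice_weight k powr s) * a k)"
    using sequence_embedding[OF r pos(4) cond] by blast
  define C3 where "C3 = 2 powr (1 / real_of_ereal ?r)"
  have main: "wiener_amalgam_norm \<sigma> p q 0 f \<le> ennreal (C3 * (C1 * C2)) * modulation_norm \<sigma> p1 q1 s f"
    if f: "f \<in> tempered" and fin: "modulation_norm \<sigma> p1 q1 s f < top" for f
  proof -
    define g where "g = (\<lambda>k x. ennreal (norm (function_of (box_op \<sigma> k f) x)))"
    have gm [measurable]: "g k \<in> borel_measurable lborel" for k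
      using borel_measurable_continuous_onI[OF box_reproducing(1)[OF \<sigma> f, of k]] unfolding g_def by measurable
    have M: "modulation_norm \<sigma> p1 q1 s f = lq_norm q1 (\<lambda>k. ennreal (lattice_weight k powr s) * Lp_norm lborel p1 (g k))"
      by (simp add: modulation_norm_def g_def)
    have W: "wiener_amalgam_norm \<sigma> p q 0 f = Lp_norm lborel p (\<lambda>x. lq_norm q (\<lambda>k. g k x))"
    proof -
      have "lattice_weight k powr 0 = 1" for k :: "int^'n" using japanese_bracket_pos[of "lattice_pt k"] by simp
      then show ?thesis by (simp add: wiener_amalgam_norm_def g_def)
    qed
    have fk: "Lp_norm lborel p1 (g k) < top" for k
    proof -
      have "ennreal (lattice_weight k powr s) * Lp_norm lborel p1 (g k) < top"
        using order_le_less_trans[OF le_lq_norm[OF pos(4)] fin[unfolded M]] .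
      then show ?thesis using japanese_bracket_pos[of "lattice_pt k"] by (auto simp: ennreal_mult_less_top)
    qed
    have "Lp_norm lborel p (g k) \<le> ennreal C1 * Lp_norm lborel p1 (g k)" for k
      using box_reproducing[OF \<sigma> f] fk[of k] unfolding g_def
      by (intro Lp_norm_increase_exponent[OF pos(2) pp gm[unfolded g_def] C1(1)] C1(2)) auto
    then have "lq_norm ?r (\<lambda>k. Lp_norm lborel p (g k)) \<le> lq_norm ?r (\<lambda>k. ennreal C1 * Lp_norm lborel p1 (g k))"
      by (intro lq_norm_mono r)
    also have "\<dots> = ennreal C1 * lq_norm ?r (\<lambda>k. Lp_norm lborel p1 (g k))"
      using C1(1) by (intro Lp_norm_cmult r) auto
    also have "\<dots> \<le> ennreal C1 * (ennreal C2 * modulation_norm \<sigma> p1 q1 s f)"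
      unfolding M using fin[unfolded M] by (intro mult_left_mono C2(2)) auto
    finally have 1: "lq_norm ?r (\<lambda>k. Lp_norm lborel p (g k)) \<le> ennreal (C1 * C2) * modulation_norm \<sigma> p1 q1 s f"
      using C1(1) C2(1) by (simp add: ennreal_mult mult.assoc)
    then have fin2: "lq_norm ?r (\<lambda>k. Lp_norm lborel p (g k)) < top"
      using fin by (intro order_le_less_trans[OF 1]) (auto simp: ennreal_mult_less_top)
    have "wiener_amalgam_norm \<sigma> p q 0 f \<le> ennreal C3 * lq_norm ?r (\<lambda>k. Lp_norm lborel p (g k))"
      unfolding W C3_def by (intro Lp_norm_lq_norm_le pos gm fin2)
    also have "\<dots> \<le> ennreal C3 * (ennreal (C1 * C2) * modulation_norm \<sigma> p1 q1 s f)"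
      by (intro mult_left_mono 1) auto
    also have "\<dots> = ennreal (C3 * (C1 * C2)) * modulation_norm \<sigma> p1 q1 s f"
      using C1(1) C2(1) by (simp add: ennreal_mult C3_def mult.assoc)
    finally show ?thesis .
  qed
  show ?thesis
    unfolding continuously_embedded_def
  proof (intro conjI exI[of _ "C3 * (C1 * C2)"] ballI subsetI)
    fix f assume "f \<in> modulation_space \<sigma> p1 q1 s"
    then have f: "f \<in> tempered" "modulation_norm \<sigma> p1 q1 s f < top" by (auto simp: modulation_space_def)
    from main[OF f] show le: "wiener_amalgam_norm \<sigma> p q 0 f \<le> ennreal (C3 * (C1 * C2)) * modulation_norm \<sigma> p1 q1 s f" .
    have "wiener_amalgam_norm \<sigma> p q 0 f < top"
      using f(2) by (intro order_le_less_trans[OF le]) (auto simp: ennreal_mult_less_top)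
    then show "f \<in> wiener_amalgam_space \<sigma> p q 0" using f by (simp add: wiener_amalgam_space_def)
  qed
qed

subsection \<open>Test functions\<close>

lemma Lp_norm_eq_0_imp_AE:
  assumes p: "0 < p" and [measurable]: "f \<in> borel_measurable M" and 0: "Lp_norm M p f = 0"
  shows "AE x in M. f x = 0"
  using p
proof (cases rule: ereal_cases_pos)
  case 1
  then show ?thesis using 0 esssup_AE[of f M] by (auto simp: Lp_norm_infinity elim: eventually_mono)
next
  case (2 r)
  then have "(\<integral>\<^sup>+ x. ennreal_powr (f x) r \<partial>M) = 0" using 0 by (simp add: Lp_norm_ereal)
  then show ?thesis by (subst (asm) nn_integral_0_iff_AE) auto
qed

lemma Lp_norm_zero: "0 < p \<Longrightarrow> Lp_norm M p (\<lambda>x. 0) = 0"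
proof (cases rule: ereal_cases_pos, assumption)
  assume "p = \<infinity>"
  moreover have "esssup M (\<lambda>x. 0 :: ennreal) \<le> 0" by (rule esssup_I) auto
  ultimately show ?thesis by (simp add: Lp_norm_infinity)
qed (simp add: Lp_norm_ereal)

lemma Lp_norm_ball_pos:
  assumes p: "0 < p" and d: "\<delta> > 0"
  shows "0 < Lp_norm lborel p (indicator (ball (a::'a::euclidean_space) \<delta>))"
proof (rule ccontr)
  assume "\<not> ?thesis"
  then have "Lp_norm lborel p (indicator (ball a \<delta>)) = 0" by simp
  then have "AE x in lborel. indicator (ball a \<delta>) x = (0::ennreal)"
    by (intro Lp_norm_eq_0_imp_AE[OF p] borel_measurable_indicator) auto
  then have "AE x in lborel. x \<notin> ball a \<delta>"
    by (auto elim!: eventually_mono simp: indicator_def split: if_splits)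
  then have "ball a \<delta> \<in> null_sets lborel"
    by (subst (asm) AE_iff_null_sets[symmetric]) auto
  then show False using d emeasure_ball[of \<delta> a] unit_ball_vol_pos[of "real DIM('a)"] by (auto simp: null_sets_def)
qed

lemma Lp_norm_schwartz_finite:
  fixes f :: "real^'n::finite \<Rightarrow> complex"
  assumes f: "f \<in> schwartz" and p: "0 < p"
  shows "Lp_norm lborel p (\<lambda>x. ennreal (norm (f x))) < top"
proof -
  have [measurable]: "f \<in> borel_measurable borel" using f schwartz_measurable by blast
  show ?thesis using p
  proof (cases rule: ereal_cases_pos)
    case 1
    obtain C where "\<And>x. norm (f x) \<le> C" using schwartz_bounded[OF f, of 0] by auto
    then have "Lp_norm lborel p (\<lambda>x. ennreal (norm (f x))) \<le> ennreal C"
      unfolding 1 Lp_norm_infinity by (intro esssup_I) (auto intro: ennreal_leI)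
    then show ?thesis using ennreal_less_top order_le_less_trans by blast
  next
    case (2 r)
    let ?D = "DIM(real^'n) + 2"
    \<comment> \<open>The decay order is chosen so that m r is at least d + 2; the r-th power is
      then integrable even for small r.\<close>
    define m where "m = nat \<lceil>real ?D / r\<rceil>"
    have "real ?D / r \<le> real m" unfolding m_def by (rule real_nat_ceiling_ge)
    then have mr: "real ?D \<le> real m * r" using 2 by (simp add: field_simps)
    obtain C where C: "C > 0" "\<And>x. norm (f x) \<le> C / (1 + norm x) ^ m" using schwartz_decay[OF f] by metis
    have "norm (f x) powr r \<le> C powr r * (1 / (1 + norm x) ^ ?D)" for x
    proof -
      have w: "1 \<le> 1 + norm x" "0 < 1 + norm x" by (auto simp: add_pos_nonneg)
      have "norm (f x) powr r \<le> (C / (1 + norm x) ^ m) powr r" using C(2) 2 by (intro powr_mono2) auto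
      also have "\<dots> = C powr r / (1 + norm x) powr (real m * r)"
        using w C(1) by (simp add: powr_divide powr_powr flip: powr_realpow)
      also have "\<dots> \<le> C powr r / (1 + norm x) powr real ?D"
        using w mr C(1) by (intro divide_left_mono powr_mono) auto
      also have "(1 + norm x) powr real ?D = (1 + norm x) ^ ?D" using w(2) by (rule powr_realpow)
      finally show ?thesis by simp
    qed
    then have "(\<integral>\<^sup>+ x. ennreal (norm (f x) powr r) \<partial>lborel) \<le> (\<integral>\<^sup>+ x. ennreal (C powr r) * ennreal (1 / (1 + norm (x::real^'n)) ^ ?D) \<partial>lborel)"
      by (intro nn_integral_mono) (auto simp: ennreal_mult[symmetric] intro!: ennreal_leI)
    also have "\<dots> = ennreal (C powr r) * (\<integral>\<^sup>+ x. ennreal (1 / (1 + norm (x::real^'n)) ^ ?D) \<partial>lborel)"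
      by (intro nn_integral_cmult) auto
    also have "\<dots> < top" using nn_integral_decay_finite[where 'a = "real^'n", of ?D] by (simp add: ennreal_mult_less_top)
    finally show ?thesis unfolding 2(1) by (simp add: Lp_norm_ereal)
  qed
qed

lemma Lp_norm_translate:
  fixes f :: "'a::euclidean_space \<Rightarrow> ennreal"
  assumes p: "0 < p" and [measurable]: "f \<in> borel_measurable borel"
  shows "Lp_norm lborel p (\<lambda>x. f (x - a)) \<le> Lp_norm lborel p f"
  using p
proof (cases rule: ereal_cases_pos)
  case 1
  have "AE x in distr lborel borel (\<lambda>x. - a + x). f x \<le> esssup lborel f"
    unfolding lborel_distr_plus by (rule esssup_AE)
  then have "AE x in lborel. f (- a + x) \<le> esssup lborel f" by (subst (asm) AE_distr_iff) auto
  then show ?thesis unfolding 1 Lp_norm_infinity by (intro esssup_I) auto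
next
  case (2 r)
  have "(\<integral>\<^sup>+ x. ennreal_powr (f (x - a)) r \<partial>lborel) = (\<integral>\<^sup>+ x. ennreal_powr (f x) r \<partial>lborel)"
    using lborel_nn_integral_affine[of 1 "\<lambda>x. ennreal_powr (f x) r" "- a"] by simp
  then show ?thesis by (simp add: 2 Lp_norm_ereal)
qed

section \<open>Test families with finitely many frequencies\<close>

definition finite_coeffs :: "'k set \<Rightarrow> ('k \<Rightarrow> real) \<Rightarrow> bool"
  where "finite_coeffs A c \<longleftrightarrow> finite A \<and> (\<forall>k. k \<notin> A \<longrightarrow> c k = 0) \<and> (\<forall>k. c k \<ge> 0)"

lemma finite_coeffsD:
  assumes "finite_coeffs A c"
  shows "finite A" and "k \<notin> A \<Longrightarrow> c k = 0" and "c k \<ge> 0"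
  using assms by (auto simp: finite_coeffs_def)

lemma finite_coeffs_weight:
  assumes "finite_coeffs A c" "\<And>k. w k \<ge> 0"
  shows "finite_coeffs A (\<lambda>k. w k * c k)"
  using assms by (auto simp: finite_coeffs_def)

text \<open>The half-side 3/16 is that of \<open>partition_one\<close>: a bump moved to a lattice
  point is seen by one box operator only, which leaves it unchanged.\<close>

definition narrow_bump :: "(real^'n::finite \<Rightarrow> real) \<Rightarrow> bool"
  where "narrow_bump b \<longleftrightarrow> (\<lambda>x. complex_of_real (b x)) \<in> schwartz \<and> (\<forall>x. b x \<ge> 0) \<and> b 0 > 0 \<and>
    (\<forall>x. (\<exists>i. \<bar>x $ i\<bar> > 3/16) \<longrightarrow> b x = 0)"

lemma ex_narrow_bump:
  fixes \<sigma> :: "real^'n::finite \<Rightarrow> complex"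
  assumes \<sigma>: "uniform_partition \<sigma>"
  shows "narrow_bump (\<lambda>x. bump \<sigma> (4 *\<^sub>R x))"
  unfolding narrow_bump_def
proof (intro conjI allI impI)
  show "(\<lambda>x. complex_of_real (bump \<sigma> (4 *\<^sub>R x))) \<in> schwartz"
    using schwartz_affine[OF bump_props(1)[OF \<sigma>], of 4 1 0] by simp
  show "bump \<sigma> (4 *\<^sub>R x) \<ge> 0" for x by (rule bump_props(2)[OF \<sigma>])
  show "bump \<sigma> (4 *\<^sub>R 0) > 0" using bump_props(3)[OF \<sigma>] by simp
  fix x :: "real^'n" assume "\<exists>i. \<bar>x $ i\<bar> > 3/16"
  then obtain i where "\<bar>x $ i\<bar> > 3/16" by blast
  then have "\<bar>(4 *\<^sub>R x) $ i\<bar> > 3/4" by (simp add: abs_mult)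
  then show "bump \<sigma> (4 *\<^sub>R x) = 0" by (rule bump_support[OF \<sigma>])
qed

definition profile :: "(real^'n::finite \<Rightarrow> real) \<Rightarrow> real^'n \<Rightarrow> complex"
  where "profile b = inv_fourier (\<lambda>\<xi>. complex_of_real (b \<xi>))"

text \<open>A shift in space is a modulation of the spectrum. Centring its phase at
  \<open>lattice_pt l\<close> makes the inverse transform the sum of c_l e(l.x) phi(x - y_l), where
  phi is \<open>profile b\<close>, with no additional phase.\<close>

definition test_spectrum ::
    "(real^'n::finite \<Rightarrow> real) \<Rightarrow> (int^'n) set \<Rightarrow> (int^'n \<Rightarrow> real) \<Rightarrow> (int^'n \<Rightarrow> real^'n) \<Rightarrow> real^'n \<Rightarrow> complex"
  where "test_spectrum b A c y \<xi> =
    (\<Sum>l\<in>A. complex_of_real (c l) * (cis (- 2 * pi * (y l \<bullet> (\<xi> - lattice_pt l))) * complex_of_real (b (\<xi> - lattice_pt l))))"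

lemma schwartz_bump_modulate:
  assumes "narrow_bump b"
  shows "(\<lambda>\<xi>. complex_of_real c * (cis (- 2 * pi * (y \<bullet> \<xi>)) * complex_of_real (b \<xi>))) \<in> schwartz"
proof -
  have "(\<lambda>\<xi>. complex_of_real (b \<xi>)) \<in> schwartz" using assms by (simp add: narrow_bump_def)
  from schwartz_scale[OF schwartz_modulate[OF this, of "(- 2 * pi) *\<^sub>R y"], of "complex_of_real c"]
  show ?thesis by (simp add: inner_commute)
qed

lemma schwartz_test_spectrum: "narrow_bump b \<Longrightarrow> test_spectrum b A c y \<in> schwartz"
  unfolding test_spectrum_def
  using schwartz_translate[OF schwartz_bump_modulate] by (intro schwartz_sum) fast

text \<open>On the support of the l-th bump, \<open>partition_one\<close> makes the symbol of the
  k-th box operator equal to 1 or 0. For k outside \<open>A\<close> both sides vanish because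
  \<open>c k\<close> does.\<close>

lemma test_box:
  fixes \<sigma> :: "real^'n::finite \<Rightarrow> complex"
  assumes \<sigma>: "uniform_partition \<sigma>" and b: "narrow_bump b" and c: "finite_coeffs A c"
  shows "\<sigma> (\<xi> - lattice_pt k) * test_spectrum b A c y \<xi> =
    complex_of_real (c k) * (cis (- 2 * pi * (y k \<bullet> (\<xi> - lattice_pt k))) * complex_of_real (b (\<xi> - lattice_pt k)))"
proof -
  let ?T = "\<lambda>l. complex_of_real (c l) * (cis (- 2 * pi * (y l \<bullet> (\<xi> - lattice_pt l))) * complex_of_real (b (\<xi> - lattice_pt l)))"
  have "\<sigma> (\<xi> - lattice_pt k) * ?T l = (if l = k then ?T k else 0)" for l
  proof (cases "b (\<xi> - lattice_pt l) = 0")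
    case False
    then have "\<bar>\<xi> $ i - of_int (l $ i)\<bar> \<le> 3/16" for i
      using b unfolding narrow_bump_def by (metis lattice_pt_nth not_le vector_minus_component)
    then show ?thesis using partition_one[OF \<sigma>, of \<xi> l k] by auto
  qed auto
  then have "\<sigma> (\<xi> - lattice_pt k) * test_spectrum b A c y \<xi> = (\<Sum>l\<in>A. if l = k then ?T k else 0)"
    unfolding test_spectrum_def sum_distrib_left by simp
  also have "\<dots> = ?T k" using finite_coeffsD[OF c] by (auto simp: sum.delta)
  finally show ?thesis .
qed

text \<open>The remaining modulation has modulus one and \<open>c k\<close> is non-negative, so both
  norms of the test distribution see only the coefficients and translates of one profile.\<close>

lemma test_function_of_box:
  fixes \<sigma> :: "real^'n::finite \<Rightarrow> complex"
  assumes \<sigma>: "uniform_partition \<sigma>" and b: "narrow_bump b" and c: "finite_coeffs A c"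
  shows "norm (function_of (box_op \<sigma> k (distr_of (inv_fourier (test_spectrum b A c y)))) x) = c k * norm (profile b (x - y k))"
proof -
  let ?h = "\<lambda>\<xi>. complex_of_real (c k) * (cis (- 2 * pi * (y k \<bullet> \<xi>)) * complex_of_real (b \<xi>))"
  let ?G = "inv_fourier (\<lambda>\<xi>. ?h (\<xi> - lattice_pt k))"
  have h: "?h \<in> schwartz" by (rule schwartz_bump_modulate[OF b])
  have G: "?G \<in> schwartz" by (intro schwartz_inv_fourier schwartz_translate[OF h])
  note \<Psi> = schwartz_test_spectrum[OF b, of A c y]
  have "function_of (box_op \<sigma> k (distr_of (inv_fourier (test_spectrum b A c y)))) = ?G"
  proof (rule function_of_eqI[OF _ _ _ bump_props(1,2,3,5)[OF \<sigma>]])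
    show "continuous_on UNIV ?G" by (rule schwartz_continuous[OF G])
    fix \<phi> :: "real^'n \<Rightarrow> complex" assume \<phi>: "\<phi> \<in> schwartz"
    show "integrable lborel (\<lambda>x. ?G x * \<phi> x)" by (rule schwartz_prod_integrable[OF G \<phi>])
    show "box_op \<sigma> k (distr_of (inv_fourier (test_spectrum b A c y))) \<phi> = (LINT x|lborel. ?G x * \<phi> x)"
      unfolding box_op_distr_of[OF \<Psi> partition_schwartz[OF \<sigma>] \<phi>] test_box[OF \<sigma> b c] ..
  qed
  moreover have "?G x = cis (2 * pi * (x \<bullet> lattice_pt k)) * inv_fourier ?h x"
    by (rule inv_fourier_translate[OF h])
  moreover have "inv_fourier ?h x = complex_of_real (c k) * profile b (x - y k)"
  proof -
    have "inv_fourier ?h x = (LINT \<xi>|lborel. complex_of_real (c k) * (cis (2 * pi * ((x - y k) \<bullet> \<xi>)) * complex_of_real (b \<xi>)))"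
      unfolding inv_fourier_def
    proof (intro Bochner_Integration.integral_cong refl)
      fix \<xi>
      have *: "cis (2 * pi * (x \<bullet> \<xi>)) * cis (- 2 * pi * (y k \<bullet> \<xi>)) = cis (2 * pi * ((x - y k) \<bullet> \<xi>))"
        by (simp add: cis_mult inner_diff_left algebra_simps)
      show "cis (2 * pi * (x \<bullet> \<xi>)) * ?h \<xi> = complex_of_real (c k) * (cis (2 * pi * ((x - y k) \<bullet> \<xi>)) * complex_of_real (b \<xi>))"
        unfolding *[symmetric] by (simp only: mult_ac)
    qed
    then show ?thesis by (simp add: profile_def inv_fourier_def)
  qed
  ultimately show ?thesis using finite_coeffsD(3)[OF c, of k] by (simp add: norm_mult)
qed

lemma profile_schwartz: "narrow_bump b \<Longrightarrow> profile b \<in> schwartz"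
  unfolding profile_def narrow_bump_def by (intro schwartz_inv_fourier) blast

text \<open>The profile at the origin is the integral of \<open>b\<close>, hence positive, and the
  profile is continuous. The bound 1/2 on the radius keeps the balls about distinct lattice points
  disjoint.\<close>

lemma profile_lower_bound:
  fixes b :: "real^'n::finite \<Rightarrow> real"
  assumes b: "narrow_bump b"
  obtains m \<delta> where "m > 0" "\<delta> > 0" "\<delta> \<le> 1/2" "\<And>x. norm x < \<delta> \<Longrightarrow> m \<le> norm (profile b x)"
proof -
  have S: "(\<lambda>x. complex_of_real (b x)) \<in> schwartz" "\<And>x. b x \<ge> 0" "b 0 > 0" using b by (auto simp: narrow_bump_def)
  have bi: "integrable lborel b"
    using schwartz_integrable[OF S(1)] by (simp add: complex_of_real_integrable_eq)
  have "continuous_on UNIV b" using continuous_on_Re[OF schwartz_continuous[OF S(1)]] by simp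
  then have I: "(LINT x|lborel. b x) > 0" by (rule continuous_integral_pos[OF _ bi S(2,3)])
  have "profile b 0 = complex_of_real (LINT x|lborel. b x)" by (simp add: profile_def inv_fourier_def)
  then have p0: "norm (profile b 0) > 0" using I by simp
  have "isCont (profile b) 0"
    using schwartz_continuous[OF profile_schwartz[OF b], of UNIV] by (simp add: continuous_on_eq_continuous_at)
  then obtain d where d: "d > 0" "\<And>x. dist x 0 < d \<Longrightarrow> dist (profile b x) (profile b 0) < norm (profile b 0) / 2"
    unfolding continuous_at_eps_delta using p0 by (metis half_gt_zero)
  show ?thesis
  proof (rule that[of "norm (profile b 0) / 2" "min d (1/2)"])
    fix x :: "real^'n" assume "norm x < min d (1/2)"
    then have "norm (profile b x - profile b 0) < norm (profile b 0) / 2" using d(2)[of x] by (simp add: dist_norm)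
    then show "norm (profile b 0) / 2 \<le> norm (profile b x)"
      using norm_triangle_ineq2[of "profile b 0" "profile b x"] by (simp add: norm_minus_commute)
  qed (use p0 d in auto)
qed

lemma modulation_norm_test:
  fixes \<sigma> :: "real^'n::finite \<Rightarrow> complex"
  assumes \<sigma>: "uniform_partition \<sigma>" and b: "narrow_bump b" and c: "finite_coeffs A c" and pos: "0 < p1" "0 < q1"
    and B: "Lp_norm lborel p1 (\<lambda>x. ennreal (norm (profile b x))) \<le> ennreal B" "B > 0"
  shows "modulation_norm \<sigma> p1 q1 s (distr_of (inv_fourier (test_spectrum b A c y))) \<le>
    ennreal B * lq_norm q1 (\<lambda>k. ennreal (lattice_weight k powr s * c k))"
proof -
  have [measurable]: "profile b \<in> borel_measurable borel"
    using profile_schwartz[OF b] schwartz_measurable by blast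
  have "Lp_norm lborel p1 (\<lambda>x. ennreal (c k * norm (profile b (x - y k)))) \<le> ennreal B * ennreal (c k)" for k
  proof (cases "c k = 0")
    case True
    then show ?thesis using pos(1) by (simp add: Lp_norm_zero)
  next
    case False
    then have ck: "c k > 0" using finite_coeffsD(3)[OF c, of k] by simp
    have "Lp_norm lborel p1 (\<lambda>x. ennreal (c k * norm (profile b (x - y k)))) = ennreal (c k) * Lp_norm lborel p1 (\<lambda>x. ennreal (norm (profile b (x - y k))))"
      using ck by (subst Lp_norm_cmult[OF pos(1) _ ck, symmetric]) (auto simp: ennreal_mult)
    also have "\<dots> \<le> ennreal (c k) * Lp_norm lborel p1 (\<lambda>x. ennreal (norm (profile b x)))"
      using Lp_norm_translate[OF pos(1), of "\<lambda>x. ennreal (norm (profile b x))" "y k"] by (intro mult_left_mono) auto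
    also have "\<dots> \<le> ennreal (c k) * ennreal B" by (intro mult_left_mono B) auto
    finally show ?thesis by (simp add: mult.commute)
  qed
  then have "modulation_norm \<sigma> p1 q1 s (distr_of (inv_fourier (test_spectrum b A c y))) \<le>
    lq_norm q1 (\<lambda>k. ennreal (lattice_weight k powr s) * (ennreal B * ennreal (c k)))"
    unfolding modulation_norm_def test_function_of_box[OF \<sigma> b c]
    by (intro lq_norm_mono pos mult_left_mono) auto
  also have "\<dots> = lq_norm q1 (\<lambda>k. ennreal B * ennreal (lattice_weight k powr s * c k))"
    using finite_coeffsD(3)[OF c] by (simp add: ennreal_mult mult.left_commute)
  also have "\<dots> = ennreal B * lq_norm q1 (\<lambda>k. ennreal (lattice_weight k powr s * c k))"
    by (intro Lp_norm_cmult pos B) auto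
  finally show ?thesis .
qed

lemma wiener_amalgam_norm_test:
  fixes \<sigma> :: "real^'n::finite \<Rightarrow> complex"
  assumes \<sigma>: "uniform_partition \<sigma>" and b: "narrow_bump b" and c: "finite_coeffs A c"
  shows "wiener_amalgam_norm \<sigma> p q 0 (distr_of (inv_fourier (test_spectrum b A c y))) =
    Lp_norm lborel p (\<lambda>x. lq_norm q (\<lambda>k. ennreal (c k * norm (profile b (x - y k)))))"
proof -
  have "lattice_weight k powr 0 = 1" for k :: "int^'n" using japanese_bracket_pos[of "lattice_pt k"] by simp
  then show ?thesis unfolding wiener_amalgam_norm_def test_function_of_box[OF \<sigma> b c] by simp
qed

lemma lq_norm_finite_support:
  assumes c: "finite_coeffs A c" and r: "0 < r"
  shows "lq_norm (ereal r) (\<lambda>k. ennreal (c k)) = ennreal ((\<Sum>k\<in>A. c k powr r) powr (1 / r))"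
proof -
  have "(\<integral>\<^sup>+ k. ennreal_powr (ennreal (c k)) r \<partial>count_space UNIV) = (\<Sum>k\<in>A. ennreal (c k powr r))"
    using finite_coeffsD[OF c] by (subst nn_integral_count_space'[of A]) auto
  also have "\<dots> = ennreal (\<Sum>k\<in>A. c k powr r)" by (intro sum_ennreal) auto
  finally show ?thesis by (simp add: Lp_norm_ereal sum_nonneg)
qed

lemma lq_norm_finite_support_less_top:
  assumes c: "finite_coeffs A c" and q: "0 < q"
  shows "lq_norm q (\<lambda>k. ennreal (c k)) < top"
  using q
proof (cases rule: ereal_cases_pos)
  case 1
  have "ennreal (c k) \<le> ennreal (\<Sum>k\<in>A. c k)" for k
    using member_le_sum[of k A c] finite_coeffsD[OF c] by (cases "k \<in> A") (auto intro!: ennreal_leI sum_nonneg)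
  then have "lq_norm q (\<lambda>k. ennreal (c k)) \<le> ennreal (\<Sum>k\<in>A. c k)"
    unfolding 1 Lp_norm_infinity esssup_count_space by (intro SUP_least)
  then show ?thesis using ennreal_less_top order_le_less_trans by blast
next
  case (2 r)
  show ?thesis unfolding 2(1) lq_norm_finite_support[OF c 2(2)] by simp
qed

subsection \<open>Necessity\<close>

text \<open>One constant for all bumps, coefficients and shifts: the sequence inequality varies
  \<open>c\<close> and \<open>y\<close>, the dilation argument varies \<open>b\<close>.\<close>

lemma embedded_test_inequality:
  fixes \<sigma> :: "real^'n::finite \<Rightarrow> complex"
  assumes \<sigma>: "uniform_partition \<sigma>" and pos: "0 < p" "0 < p1" "0 < q" "0 < q1"
    and emb: "continuously_embedded
      (modulation_space \<sigma> p1 q1 s) (modulation_norm \<sigma> p1 q1 s)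
      (wiener_amalgam_space \<sigma> p q 0) (wiener_amalgam_norm \<sigma> p q 0)"
  obtains C where "C > 0" "\<And>(b :: real^'n \<Rightarrow> real) A (c :: int^'n \<Rightarrow> real) y B. narrow_bump b \<Longrightarrow> finite_coeffs A c \<Longrightarrow>
    Lp_norm lborel p1 (\<lambda>x. ennreal (norm (profile b x))) \<le> ennreal B \<Longrightarrow> B > 0 \<Longrightarrow>
    Lp_norm lborel p (\<lambda>x. lq_norm q (\<lambda>k. ennreal (c k * norm (profile b (x - y k))))) \<le>
    ennreal C * (ennreal B * lq_norm q1 (\<lambda>k. ennreal (lattice_weight k powr s * c k)))"
proof -
  obtain C0 where C0: "\<And>f. f \<in> modulation_space \<sigma> p1 q1 s \<Longrightarrow> wiener_amalgam_norm \<sigma> p q 0 f \<le> ennreal C0 * modulation_norm \<sigma> p1 q1 s f"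
    using emb unfolding continuously_embedded_def by blast
  \<comment> \<open>The embedding constant may be any real number; a positive one is required
    here.\<close>
  let ?C = "max C0 1"
  show ?thesis
  proof (rule that[of ?C])
    fix b :: "real^'n \<Rightarrow> real" and A and c :: "int^'n \<Rightarrow> real" and y B
    assume b: "narrow_bump b" and c: "finite_coeffs A c"
      and B: "Lp_norm lborel p1 (\<lambda>x. ennreal (norm (profile b x))) \<le> ennreal B" "B > 0"
    let ?f = "distr_of (inv_fourier (test_spectrum b A c y))"
    have M: "modulation_norm \<sigma> p1 q1 s ?f \<le> ennreal B * lq_norm q1 (\<lambda>k. ennreal (lattice_weight k powr s * c k))"
      by (rule modulation_norm_test[OF \<sigma> b c pos(2,4) B])
    also have "\<dots> < top"
      using lq_norm_finite_support_less_top[OF finite_coeffs_weight[OF c, of "\<lambda>k. lattice_weight k powr s"] pos(4)]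
      by (simp add: ennreal_mult_less_top)
    finally have "?f \<in> modulation_space \<sigma> p1 q1 s"
      using distr_of_tempered[OF schwartz_inv_fourier[OF schwartz_test_spectrum[OF b]]] by (simp add: modulation_space_def)
    then have "wiener_amalgam_norm \<sigma> p q 0 ?f \<le> ennreal C0 * modulation_norm \<sigma> p1 q1 s ?f" by (rule C0)
    also have "\<dots> \<le> ennreal ?C * (ennreal B * lq_norm q1 (\<lambda>k. ennreal (lattice_weight k powr s * c k)))"
      using M by (intro mult_mono ennreal_leI) auto
    finally show "Lp_norm lborel p (\<lambda>x. lq_norm q (\<lambda>k. ennreal (c k * norm (profile b (x - y k))))) \<le>
      ennreal ?C * (ennreal B * lq_norm q1 (\<lambda>k. ennreal (lattice_weight k powr s * c k)))"
      unfolding wiener_amalgam_norm_test[OF \<sigma> b c] .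
  qed simp
qed

text \<open>All profiles lie on top of each other, so at each point of the ball the inner norm is at
  least m times the full l^q norm of \<open>c\<close>.\<close>

lemma wiener_test_lower_bound_q:
  assumes \<phi>: "\<And>x::'a::euclidean_space. norm x < \<delta> \<Longrightarrow> m \<le> norm (\<phi> x :: complex)" and m: "m > 0" and d: "\<delta> > 0"
    and [measurable]: "\<phi> \<in> borel_measurable borel" and pos: "0 < p" "0 < q" and c: "\<And>k. c k \<ge> 0"
    and fin: "lq_norm q (\<lambda>k::'k::countable. ennreal (c k)) < top"
  shows "lq_norm q (\<lambda>k::'k. ennreal (c k)) * (ennreal m * Lp_norm lborel p (indicator (ball (0::'a) \<delta>))) \<le>
    Lp_norm lborel p (\<lambda>x. lq_norm q (\<lambda>k. ennreal (c k * norm (\<phi> x))))"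
proof -
  let ?L = "lq_norm q (\<lambda>k::'k. ennreal (c k))"
  show ?thesis
  proof (cases "?L = 0")
    case False
    then obtain t where t: "?L = ennreal t" "t > 0" using fin by (cases ?L) (auto simp: less_le)
    have "?L * (ennreal m * Lp_norm lborel p (indicator (ball (0::'a) \<delta>))) = Lp_norm lborel p (\<lambda>x. ennreal (t * m) * indicator (ball (0::'a) \<delta>) x)"
      unfolding t(1) using t(2) m by (subst Lp_norm_cmult[OF pos(1)]) (auto simp: ennreal_mult mult.assoc intro!: borel_measurable_indicator)
    also have "\<dots> \<le> Lp_norm lborel p (\<lambda>x. lq_norm q (\<lambda>k. ennreal (c k * norm (\<phi> x))))"
    proof (rule Lp_norm_mono[OF pos(1)])
      fix x :: 'a
      show "ennreal (t * m) * indicator (ball 0 \<delta>) x \<le> lq_norm q (\<lambda>k. ennreal (c k * norm (\<phi> x)))"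
      proof (cases "x \<in> ball 0 \<delta>")
        case True
        then have le: "m \<le> norm (\<phi> x)" using \<phi> by simp
        have "m * c k \<le> c k * norm (\<phi> x)" for k
          using mult_right_mono[OF le c[of k]] by (simp only: mult.commute[of "c k"])
        then have "lq_norm q (\<lambda>k. ennreal m * ennreal (c k)) \<le> lq_norm q (\<lambda>k. ennreal (c k * norm (\<phi> x)))"
          using m c by (intro lq_norm_mono pos) (auto simp: ennreal_mult[symmetric] intro!: ennreal_leI)
        moreover have "lq_norm q (\<lambda>k. ennreal m * ennreal (c k)) = ennreal (t * m)"
          using t m by (subst Lp_norm_cmult[OF pos(2) _ m]) (auto simp: ennreal_mult mult.commute)
        ultimately show ?thesis using True by simp
      qed simp
    qed (intro borel_measurable_times_ennreal borel_measurable_const borel_measurable_indicator, simp)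
    finally show ?thesis .
  qed simp
qed

text \<open>The balls about the lattice points are disjoint. On the k-th ball only the k-th term of
  the inner norm is kept, which bounds the integral below by a multiple of the sum of c_k^r,
  whatever q is.\<close>

lemma wiener_test_lower_bound_p:
  fixes \<phi> :: "real^'n::finite \<Rightarrow> complex"
  assumes \<phi>: "\<And>x. norm x < \<delta> \<Longrightarrow> m \<le> norm (\<phi> x)" and m: "m > 0" and d: "\<delta> > 0" "\<delta> \<le> 1/2"
    and r: "0 < r" and q: "0 < q" and c: "finite_coeffs A c"
  shows "lq_norm (ereal r) (\<lambda>k::int^'n. ennreal (c k)) * (ennreal m * Lp_norm lborel (ereal r) (indicator (ball (0::real^'n) \<delta>))) \<le>
    Lp_norm lborel (ereal r) (\<lambda>x. lq_norm q (\<lambda>k. ennreal (c k * norm (\<phi> (x - lattice_pt k)))))"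
proof -
  define V where "V = emeasure lborel (ball (0::real^'n) \<delta>)"
  have V: "emeasure lborel (ball a \<delta>) = V" for a :: "real^'n" using d by (simp add: V_def emeasure_ball)
  let ?L = "lq_norm (ereal r) (\<lambda>k::int^'n. ennreal (c k))" and ?I = "Lp_norm lborel (ereal r) (indicator (ball (0::real^'n) \<delta>))"
  have I: "ennreal_powr ?I r = V"
  proof -
    have "ennreal_powr (indicator (ball (0::real^'n) \<delta>) x) r = indicator (ball 0 \<delta>) x" for x by (simp add: indicator_def)
    then show ?thesis unfolding Lp_norm_powr[OF r] by (simp add: V_def)
  qed
  have L: "ennreal_powr ?L r = (\<Sum>k\<in>A. ennreal (c k powr r))"
    unfolding Lp_norm_powr[OF r] using finite_coeffsD[OF c] by (subst nn_integral_count_space'[of A]) auto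
  have far: "\<delta> \<le> norm (x - lattice_pt l)" if h: "norm (x - lattice_pt k) < \<delta>" "l \<noteq> k" for x :: "real^'n" and k l
  proof -
    obtain i where "l $ i \<noteq> k $ i" using h(2) by (auto simp: vec_eq_iff)
    then have "1 \<le> \<bar>k $ i - l $ i\<bar>" by linarith
    then have "1 \<le> \<bar>real_of_int (k $ i) - real_of_int (l $ i)\<bar>" by linarith
    moreover have "\<bar>x $ i - of_int (k $ i)\<bar> < \<delta>" "\<bar>x $ i - of_int (l $ i)\<bar> \<le> norm (x - lattice_pt l)"
      using component_le_norm_cart[of "x - lattice_pt k" i] component_le_norm_cart[of "x - lattice_pt l" i] h(1) by auto
    ultimately show ?thesis using d(2) by linarith
  qed
  have "ennreal_powr (?L * (ennreal m * ?I)) r = (\<Sum>k\<in>A. ennreal (c k powr r)) * (ennreal (m powr r) * V)"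
    using m by (simp add: ennreal_powr_mult[OF r] I L)
  also have "\<dots> = (\<Sum>k\<in>A. ennreal ((c k * m) powr r) * emeasure lborel (ball (lattice_pt k :: real^'n) \<delta>))"
    using m finite_coeffsD(3)[OF c] by (simp add: V sum_distrib_right powr_mult ennreal_mult mult.assoc del: sum_ennreal)
  also have "\<dots> = (\<integral>\<^sup>+ x. (\<Sum>k\<in>A. ennreal ((c k * m) powr r) * indicator (ball (lattice_pt k :: real^'n) \<delta>) x) \<partial>lborel)"
  proof -
    have "(\<integral>\<^sup>+ x. (\<Sum>k\<in>A. ennreal ((c k * m) powr r) * indicator (ball (lattice_pt k :: real^'n) \<delta>) x) \<partial>lborel)
      = (\<Sum>k\<in>A. \<integral>\<^sup>+ x. ennreal ((c k * m) powr r) * indicator (ball (lattice_pt k :: real^'n) \<delta>) x \<partial>lborel)"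
      by (intro nn_integral_sum borel_measurable_times_ennreal borel_measurable_const borel_measurable_indicator) simp
    also have "\<dots> = (\<Sum>k\<in>A. ennreal ((c k * m) powr r) * emeasure lborel (ball (lattice_pt k :: real^'n) \<delta>))"
      by (intro sum.cong refl nn_integral_cmult_indicator) simp
    finally show ?thesis by (rule sym)
  qed
  also have "\<dots> \<le> (\<integral>\<^sup>+ x. ennreal_powr (lq_norm q (\<lambda>k. ennreal (c k * norm (\<phi> (x - lattice_pt k))))) r \<partial>lborel)"
  proof (rule nn_integral_mono)
    fix x :: "real^'n"
    let ?R = "ennreal_powr (lq_norm q (\<lambda>k. ennreal (c k * norm (\<phi> (x - lattice_pt k))))) r"
    let ?F = "\<lambda>k. ennreal ((c k * m) powr r) * indicator (ball (lattice_pt k :: real^'n) \<delta>) x"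
    show "(\<Sum>k\<in>A. ?F k) \<le> ?R"
    proof (cases "\<exists>k\<in>A. x \<in> ball (lattice_pt k) \<delta>")
      case True
      then obtain k where k: "k \<in> A" "norm (x - lattice_pt k) < \<delta>" by (auto simp: dist_norm norm_minus_commute)
      have "(\<Sum>l\<in>A. ?F l) = (\<Sum>l\<in>{k}. ?F l)"
        using far[OF k(2)] k(1) finite_coeffsD(1)[OF c]
        by (intro sum.mono_neutral_right) (auto simp: indicator_def dist_norm norm_minus_commute not_less[symmetric])
      also have "\<dots> = ?F k" by (simp only: sum.insert_if sum.empty finite.emptyI empty_iff if_False add_0_right)
      also have "\<dots> \<le> ennreal ((c k * m) powr r)" by (auto simp: indicator_def)
      also have "\<dots> \<le> ennreal_powr (ennreal (c k * norm (\<phi> (x - lattice_pt k)))) r"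
        using \<phi>[OF k(2)] m finite_coeffsD(3)[OF c, of k] r by (auto intro!: ennreal_leI powr_mono2 mult_left_mono)
      also have "\<dots> \<le> ?R"
        using r le_lq_norm[OF q, of "\<lambda>k. ennreal (c k * norm (\<phi> (x - lattice_pt k)))" k] by (intro ennreal_powr_mono) auto
      finally show ?thesis .
    next
      case False
      then have "(\<Sum>k\<in>A. ?F k) = 0" by (intro sum.neutral) auto
      then show ?thesis by (simp only: zero_le)
    qed
  qed
  finally have "ennreal_powr (?L * (ennreal m * ?I)) r \<le> ennreal_powr (Lp_norm lborel (ereal r) (\<lambda>x. lq_norm q (\<lambda>k. ennreal (c k * norm (\<phi> (x - lattice_pt k)))))) r"
    unfolding Lp_norm_powr[OF r] .
  then show ?thesis using r unfolding ennreal_powr_le_iff[OF r] by (simp add: ennreal_powr_powr)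
qed

section \<open>From the embedding to an inequality between sequence norms\<close>

lemma ex_real_below: "0 < (K::ennreal) \<Longrightarrow> \<exists>\<kappa>>0. ennreal \<kappa> \<le> K"
  by (cases K) (auto intro: exI[of _ 1])

lemma embedded_sequence_inequality:
  fixes \<sigma> :: "real^'n::finite \<Rightarrow> complex"
  assumes \<sigma>: "uniform_partition \<sigma>" and pos: "0 < p" "0 < p1" "0 < q" "0 < q1"
    and emb: "continuously_embedded
      (modulation_space \<sigma> p1 q1 s) (modulation_norm \<sigma> p1 q1 s)
      (wiener_amalgam_space \<sigma> p q 0) (wiener_amalgam_norm \<sigma> p q 0)"
  obtains C where "C > 0" "\<And>A c. finite_coeffs A c \<Longrightarrow>
    lq_norm (min p q) (\<lambda>k::int^'n. ennreal (c k)) \<le> ennreal C * lq_norm q1 (\<lambda>k. ennreal (lattice_weight k powr s * c k))"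
proof -
  obtain C where C: "C > 0" "\<And>(b :: real^'n \<Rightarrow> real) A (c :: int^'n \<Rightarrow> real) y B. narrow_bump b \<Longrightarrow> finite_coeffs A c \<Longrightarrow>
    Lp_norm lborel p1 (\<lambda>x. ennreal (norm (profile b x))) \<le> ennreal B \<Longrightarrow> B > 0 \<Longrightarrow>
    Lp_norm lborel p (\<lambda>x. lq_norm q (\<lambda>k. ennreal (c k * norm (profile b (x - y k))))) \<le>
    ennreal C * (ennreal B * lq_norm q1 (\<lambda>k. ennreal (lattice_weight k powr s * c k)))"
    by (rule embedded_test_inequality[OF \<sigma> pos emb]) blast
  define b where "b = (\<lambda>x. bump \<sigma> (4 *\<^sub>R x))"
  have b: "narrow_bump b" unfolding b_def by (rule ex_narrow_bump[OF \<sigma>])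
  have meas [measurable]: "profile b \<in> borel_measurable borel"
    using profile_schwartz[OF b] schwartz_measurable by blast
  obtain m \<delta> where m: "m > 0" "\<delta> > 0" "\<delta> \<le> 1/2" "\<And>x. norm x < \<delta> \<Longrightarrow> m \<le> norm (profile b x)"
    using profile_lower_bound[OF b] by blast
  obtain B0 where "Lp_norm lborel p1 (\<lambda>x. ennreal (norm (profile b x))) = ennreal B0" "B0 \<ge> 0"
    using Lp_norm_schwartz_finite[OF profile_schwartz[OF b] pos(2)]
    by (cases "Lp_norm lborel p1 (\<lambda>x. ennreal (norm (profile b x)))") auto
  then have B: "Lp_norm lborel p1 (\<lambda>x. ennreal (norm (profile b x))) \<le> ennreal (B0 + 1)" "B0 + 1 > 0"
    by (auto intro!: ennreal_leI simp del: ennreal_plus)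
  let ?K = "ennreal m * Lp_norm lborel p (indicator (ball (0::real^'n) \<delta>))"
  have "0 < ?K" using Lp_norm_ball_pos[OF pos(1) m(2), of "0::real^'n"] m(1) by (simp add: ennreal_zero_less_mult_iff)
  \<comment> \<open>A real lower bound in place of the extended one, so that it can be divided
    out.\<close>
  then obtain \<kappa> where \<kappa>: "\<kappa> > 0" "ennreal \<kappa> \<le> ?K" using ex_real_below by blast
  show ?thesis
  proof (rule that[of "1 / \<kappa> * (C * (B0 + 1))"])
    show "0 < 1 / \<kappa> * (C * (B0 + 1))" using \<kappa> C(1) B(2) by simp
    fix A and c :: "int^'n \<Rightarrow> real"
    assume c: "finite_coeffs A c"
    let ?L = "lq_norm (min p q) (\<lambda>k. ennreal (c k))"
    let ?R = "lq_norm q1 (\<lambda>k. ennreal (lattice_weight k powr s * c k))"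
    have "?L * ?K \<le> ennreal C * (ennreal (B0 + 1) * ?R)"
    \<comment> \<open>In the first case p is finite, as the family spread over the lattice requires.
      In the second the minimum is q, and all profiles are centred at the origin.\<close>
    proof (cases "p < q")
      case True
      then obtain r where r: "p = ereal r" "r > 0" "min p q = ereal r" using pos(1) by (cases p) auto
      have "?L * ?K \<le> Lp_norm lborel p (\<lambda>x. lq_norm q (\<lambda>k. ennreal (c k * norm (profile b (x - lattice_pt k)))))"
        unfolding r(3) unfolding r(1) by (rule wiener_test_lower_bound_p[OF m(4,1,2,3) r(2) pos(3) c])
      also have "\<dots> \<le> ennreal C * (ennreal (B0 + 1) * ?R)"
        by (rule C(2)[OF b c B])
      finally show ?thesis .
    next
      case False
      then have mq: "min p q = q" by simp
      have "?L * ?K \<le> Lp_norm lborel p (\<lambda>x. lq_norm q (\<lambda>k. ennreal (c k * norm (profile b x))))"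
        unfolding mq using lq_norm_finite_support_less_top[OF c pos(3)]
        by (intro wiener_test_lower_bound_q[OF m(4,1,2) meas pos(1,3) finite_coeffsD(3)[OF c]])
      also have "\<dots> \<le> ennreal C * (ennreal (B0 + 1) * ?R)"
        using C(2)[OF b c B, of "\<lambda>_. 0"] by simp
      finally show ?thesis .
    qed
    then have "?L * ennreal \<kappa> \<le> ennreal C * (ennreal (B0 + 1) * ?R)"
      using mult_left_mono[OF \<kappa>(2), of ?L] by (auto intro: order_trans)
    then have "ennreal (1 / \<kappa>) * (?L * ennreal \<kappa>) \<le> ennreal (1 / \<kappa>) * (ennreal C * (ennreal (B0 + 1) * ?R))"
      by (rule mult_left_mono) simp
    moreover have "ennreal (1 / \<kappa>) * (?L * ennreal \<kappa>) = ?L"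
    proof -
      have "ennreal (1 / \<kappa>) * ennreal \<kappa> = 1" using \<kappa>(1) by (simp flip: ennreal_mult)
      moreover have "ennreal (1 / \<kappa>) * (?L * ennreal \<kappa>) = ?L * (ennreal (1 / \<kappa>) * ennreal \<kappa>)"
        by (rule mult.left_commute)
      ultimately show ?thesis by (simp only: mult_1_right)
    qed
    moreover have "ennreal (1 / \<kappa>) * (ennreal C * (ennreal (B0 + 1) * ?R)) = ennreal (1 / \<kappa> * (C * (B0 + 1))) * ?R"
      using \<kappa>(1) C(1) B(2) by (simp only: ennreal_mult mult.assoc less_imp_le mult_nonneg_nonneg divide_nonneg_nonneg zero_le_one)
    ultimately show "?L \<le> ennreal (1 / \<kappa> * (C * (B0 + 1))) * ?R" by simp
  qed
qed

section \<open>Sharpness of the weighted sequence embedding\<close>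

lemma lq_norm_single:
  assumes q: "0 < q" and t: "0 \<le> t"
  shows "lq_norm q (\<lambda>k. ennreal (if k = k0 then t else 0)) \<le> ennreal t"
  using q
proof (cases rule: ereal_cases_pos)
  case 1
  then show ?thesis by (auto simp: Lp_norm_infinity esssup_count_space intro: SUP_least)
next
  case (2 r)
  have "lq_norm (ereal r) (\<lambda>k. ennreal (if k = k0 then t else 0)) = ennreal ((\<Sum>k\<in>{k0}. (if k = k0 then t else 0) powr r) powr (1 / r))"
    by (rule lq_norm_finite_support) (use t 2 in \<open>auto simp: finite_coeffs_def\<close>)
  then show ?thesis using t 2 by (simp add: powr_powr)
qed

text \<open>For q1 at most r, a single unit coefficient far from the origin rules out s < 0. For q1
  > r, the extremal sequence of Hoelder's inequality makes the two sides powers of one lattice sum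
  S. The inequality then bounds S, which diverges unless s t > d.\<close>

lemma sequence_embedding_necessary:
  assumes r: "0 < r" and q1: "0 < q1" and C: "C > 0"
    and ineq: "\<And>A c. finite_coeffs A c \<Longrightarrow>
      lq_norm r (\<lambda>k::int^'n::finite. ennreal (c k)) \<le> ennreal C * lq_norm q1 (\<lambda>k. ennreal (lattice_weight k powr s * c k))"
  shows "(q1 \<le> r \<and> s \<ge> 0) \<or> (q1 > r \<and> ereal s + ereal (real CARD('n)) / q1 > ereal (real CARD('n)) / r)"
proof (cases "q1 \<le> r")
  case True
  have "s \<ge> 0"
  proof (rule ccontr)
    assume "\<not> s \<ge> 0"
    then have s: "s < 0" by simp
    \<comment> \<open>Solves C x^s = 1/2, so a lattice point of weight at least x contradicts the
      lower bound 1.\<close>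
    define x where "x = (2 * C) powr (- 1 / s)"
    obtain n :: nat where n: "x \<le> real n" using real_arch_simple by blast
    have x: "x > 0" using C by (simp add: x_def)
    define k where "k = ((\<chi> i. int n) :: int^'n)"
    let ?c = "\<lambda>l. if l = k then 1 else (0::real)"
    have "1 \<le> lq_norm r (\<lambda>l. ennreal (?c l))" using le_lq_norm[OF r, of "\<lambda>l. ennreal (?c l)" k] by simp
    also have "\<dots> \<le> ennreal C * lq_norm q1 (\<lambda>l. ennreal (lattice_weight l powr s * ?c l))"
      by (rule ineq[of "{k}"]) (auto simp: finite_coeffs_def)
    also have "(\<lambda>l. ennreal (lattice_weight l powr s * ?c l)) = (\<lambda>l. ennreal (if l = k then lattice_weight k powr s else 0))"
      by auto
    also have "ennreal C * lq_norm q1 \<dots> \<le> ennreal C * ennreal (lattice_weight k powr s)"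
      by (intro mult_left_mono lq_norm_single q1) auto
    finally have 1: "1 \<le> C * lattice_weight k powr s" using C by (simp add: ennreal_mult[symmetric])
    have "\<bar>lattice_pt k $ undefined\<bar> \<le> lattice_weight k"
      using component_le_norm_cart[of "lattice_pt k"] norm_le_japanese_bracket[of "lattice_pt k"] by (rule order_trans)
    then have "x \<le> lattice_weight k" using n by (simp add: k_def)
    then have "lattice_weight k powr s \<le> x powr s" using s x by (intro powr_mono2') auto
    also have "x powr s = 1 / (2 * C)"
    proof -
      have "- 1 / s * s = - 1" using s by simp
      then have "x powr s = (2 * C) powr - 1" by (simp only: x_def powr_powr)
      then show ?thesis using C by (simp add: powr_minus_divide)
    qed
    finally have "C * lattice_weight k powr s \<le> C * (1 / (2 * C))" using C by (intro mult_left_mono) auto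
    then show False using 1 C by simp
  qed
  then show ?thesis using True by simp
next
  case False
  then obtain r' where r': "r = ereal r'" "r' > 0" using r by (cases r; cases q1) auto
  define d where "d = real CARD('n)"
  \<comment> \<open>\<open>iq\<close> is the reciprocal of q1 as a real number, 0 for q1 infinite,
    which lets most of the argument treat both cases together.\<close>
  have "\<exists>t iq. t > 0 \<and> 1 / r' = 1 / t + iq \<and> ereal d / q1 = ereal (d * iq) \<and>
    (q1 = \<infinity> \<and> iq = 0 \<or> (\<exists>u>0. q1 = ereal u \<and> iq = 1 / u))"
    using q1
  proof (cases rule: ereal_cases_pos)
    case 1
    then show ?thesis using r' by (intro exI[of _ r'] exI[of _ 0]) auto
  next
    case (2 u)
    then have "1 / r' - 1 / u > 0" using False r' by (simp add: field_simps)
    then show ?thesis using 2 by (intro exI[of _ "1 / (1 / r' - 1 / u)"] exI[of _ "1 / u"]) auto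
  qed
  then obtain t iq where t: "t > 0" "1 / r' = 1 / t + iq" "ereal d / q1 = ereal (d * iq)"
    and iq: "q1 = \<infinity> \<and> iq = 0 \<or> (\<exists>u>0. q1 = ereal u \<and> iq = 1 / u)" by blast
  have "s + d * iq > d / r'"
  proof (rule ccontr)
    assume "\<not> ?thesis"
    then have "s \<le> d * (1 / r') - d * iq" by simp
    also have "\<dots> = d / t" unfolding t(2) by (simp add: algebra_simps)
    finally have st: "s * t \<le> real CARD('n)" using t(1) by (simp add: d_def field_simps)
    \<comment> \<open>The threshold is read off from the final bound S^(1/t) <= C, which fails as
      soon as S exceeds C^t.\<close>
    obtain A :: "(int^'n) set" where A: "finite A" "C powr t + 1 \<le> (\<Sum>k\<in>A. lattice_weight k powr - (s * t))"
      using lattice_sum_unbounded[OF st] by blast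
    define S where "S = (\<Sum>k\<in>A. lattice_weight k powr - (s * t))"
    have S: "S > C powr t" "S > 0" using A(2) powr_ge_zero[of C t] unfolding S_def by linarith+
    \<comment> \<open>The exponent is chosen so that the r'-th power of c and, for finite q1 = u,
      the u-th power of the weighted c are both the weight to the power -(s t). For q1 infinite the
      weighted sequence is at most 1.\<close>
    define c where "c = (\<lambda>k. if k \<in> A then lattice_weight k powr - (s * t / r') else 0)"
    have c: "finite_coeffs A c" using A(1) by (auto simp: c_def finite_coeffs_def)
    have L: "lq_norm r (\<lambda>k. ennreal (c k)) = ennreal (S powr (1 / r'))"
    proof -
      have "(\<Sum>k\<in>A. c k powr r') = S" unfolding S_def using r'(2) by (intro sum.cong) (auto simp: c_def powr_powr)
      then show ?thesis unfolding r'(1) using lq_norm_finite_support[OF c r'(2)] by simp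
    qed
    have R: "lq_norm q1 (\<lambda>k. ennreal (lattice_weight k powr s * c k)) \<le> ennreal (S powr iq)"
      using iq
    proof
      assume i: "q1 = \<infinity> \<and> iq = 0"
      then have tr: "t = r'" using t by simp
      have "lattice_weight k powr s * c k \<le> 1" for k :: "int^'n"
        using r'(2) japanese_bracket_pos[of "lattice_pt k"] by (simp add: c_def tr powr_add[symmetric])
      then show ?thesis using i S by (auto simp: Lp_norm_infinity esssup_count_space intro!: SUP_least)
    next
      assume "\<exists>u>0. q1 = ereal u \<and> iq = 1 / u"
      then obtain u where u: "u > 0" "q1 = ereal u" "iq = 1 / u" by blast
      have e: "(s - s * t / r') * u = - (s * t)"
      proof -
        have "(s - s * t / r') * u = s * u - s * t * u * (1 / r')" by (simp add: algebra_simps)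
        also have "\<dots> = - (s * t)" unfolding t(2) u(3) using t(1) u(1) by (simp add: field_simps)
        finally show ?thesis .
      qed
      have "(lattice_weight k powr s * c k) powr u = lattice_weight k powr - (s * t)" if "k \<in> A" for k
      proof -
        have "lattice_weight k powr s * c k = lattice_weight k powr (s - s * t / r')"
          using that by (simp add: c_def powr_add[symmetric])
        then show ?thesis by (simp only: powr_powr e)
      qed
      then have "(\<Sum>k\<in>A. (lattice_weight k powr s * c k) powr u) = S" unfolding S_def by (intro sum.cong) auto
      then have "lq_norm (ereal u) (\<lambda>k. ennreal (lattice_weight k powr s * c k)) = ennreal (S powr (1 / u))"
        using lq_norm_finite_support[OF finite_coeffs_weight[OF c, of "\<lambda>k. lattice_weight k powr s"] u(1)] by simp
      then show ?thesis unfolding u(2,3) by simp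
    qed
    have "ennreal (S powr (1 / r')) \<le> ennreal C * ennreal (S powr iq)"
      unfolding L[symmetric] using ineq[OF c] mult_left_mono[OF R, of "ennreal C"] by (auto intro: order_trans)
    then have "S powr (1 / t + iq) \<le> C * S powr iq" unfolding t(2) using C by (simp add: ennreal_mult[symmetric])
    then have "S powr (1 / t) \<le> C" using S(2) by (simp add: powr_add)
    then have "(S powr (1 / t)) powr t \<le> C powr t" using t(1) by (intro powr_mono2) auto
    then show False using S t(1) by (simp add: powr_powr)
  qed
  then have "ereal s + ereal d / q1 > ereal d / r" using t(3) r' by simp
  then show ?thesis using False by (simp add: d_def)
qed

section \<open>Dilations and the relation between p1 and p\<close>

lemma narrow_bump_dilate:
  assumes b: "narrow_bump b" and n: "n \<ge> 1"
  shows "narrow_bump (\<lambda>\<xi>. b (n *\<^sub>R \<xi>))"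
  unfolding narrow_bump_def
proof (intro conjI allI impI)
  show "(\<lambda>x. complex_of_real (b (n *\<^sub>R x))) \<in> schwartz"
    using schwartz_affine[of "\<lambda>x. complex_of_real (b x)" n 1 0] b n by (simp add: narrow_bump_def)
  show "b (n *\<^sub>R x) \<ge> 0" for x using b by (simp add: narrow_bump_def)
  show "b (n *\<^sub>R 0) > 0" using b by (simp add: narrow_bump_def)
  fix x :: "real^'a" assume "\<exists>i. \<bar>x $ i\<bar> > 3/16"
  then obtain i where i: "\<bar>x $ i\<bar> > 3/16" by blast
  have "1 * \<bar>x $ i\<bar> \<le> n * \<bar>x $ i\<bar>" using n by (intro mult_right_mono) auto
  then have "\<bar>(n *\<^sub>R x) $ i\<bar> > 3/16" using i n by (simp add: abs_mult)
  then show "b (n *\<^sub>R x) = 0" using b unfolding narrow_bump_def by blast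
qed

lemma profile_dilate:
  fixes b :: "real^'n::finite \<Rightarrow> real"
  assumes b: "narrow_bump b" and n: "n > 0"
  shows "norm (profile (\<lambda>\<xi>. b (n *\<^sub>R \<xi>)) x) = n powr - real CARD('n) * norm (profile b ((1 / n) *\<^sub>R x))"
proof -
  have "(\<lambda>x. complex_of_real (b x)) \<in> schwartz" using b by (simp add: narrow_bump_def)
  then have [measurable]: "(\<lambda>x. complex_of_real (b x)) \<in> borel_measurable borel" by (rule schwartz_measurable)
  have [measurable]: "(\<lambda>\<xi>. complex_of_real (b (n *\<^sub>R \<xi>))) \<in> borel_measurable borel"
    by (rule measurable_compose[of "\<lambda>\<xi>. n *\<^sub>R \<xi>" borel borel "\<lambda>x. complex_of_real (b x)"]) measurable
  have "profile (\<lambda>\<xi>. b (n *\<^sub>R \<xi>)) x = \<bar>1 / n\<bar> ^ CARD('n) *\<^sub>R (LINT \<xi>|lborel. cis (2 * pi * (x \<bullet> (0 + (1 / n) *\<^sub>R \<xi>))) * complex_of_real (b (n *\<^sub>R (0 + (1 / n) *\<^sub>R \<xi>))))"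
    unfolding profile_def inv_fourier_def using n
    by (subst lborel_integral_affine[of "1 / n" _ 0]) auto
  also have "\<dots> = (1 / n) ^ CARD('n) *\<^sub>R profile b ((1 / n) *\<^sub>R x)"
    using n by (simp add: profile_def inv_fourier_def)
  finally show ?thesis using n by (simp add: powr_minus powr_realpow power_one_over inverse_eq_divide)
qed

lemma Lp_norm_dilate_ereal:
  fixes f :: "'a::euclidean_space \<Rightarrow> ennreal"
  assumes r: "0 < r" and n: "n > 0" and [measurable]: "f \<in> borel_measurable borel"
  shows "Lp_norm lborel (ereal r) (\<lambda>x. f ((1 / n) *\<^sub>R x)) = ennreal (n powr (real DIM('a) / r)) * Lp_norm lborel (ereal r) f"
proof -
  have "(\<integral>\<^sup>+ x. ennreal_powr (f ((1 / n) *\<^sub>R x)) r \<partial>lborel) = ennreal (\<bar>n\<bar> ^ DIM('a)) * (\<integral>\<^sup>+ x. ennreal_powr (f ((1 / n) *\<^sub>R (0 + n *\<^sub>R x))) r \<partial>lborel)"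
    using n by (intro lborel_nn_integral_affine) auto
  also have "\<dots> = ennreal (n powr real DIM('a)) * (\<integral>\<^sup>+ x. ennreal_powr (f x) r \<partial>lborel)"
    using n by (simp add: powr_realpow)
  finally show ?thesis using r n by (simp add: Lp_norm_ereal ennreal_powr_mult powr_powr)
qed

text \<open>With the reciprocal exponent as a real number, p infinite becomes the case
  \<open>iq = 0\<close>, where the pointwise bound by \<open>B\<close> is used.\<close>

lemma Lp_norm_dilate_le:
  fixes f :: "'a::euclidean_space \<Rightarrow> complex"
  assumes p: "0 < p" and n: "n > 0" and [measurable]: "f \<in> borel_measurable borel"
    and B: "Lp_norm lborel p (\<lambda>x. ennreal (norm (f x))) \<le> ennreal B" "\<And>x. norm (f x) \<le> B"
    and iq: "1 / p = ereal iq"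
  shows "Lp_norm lborel p (\<lambda>x. ennreal (norm (f ((1 / n) *\<^sub>R x)))) \<le> ennreal (n powr (real DIM('a) * iq) * B)"
  using p
proof (cases rule: ereal_cases_pos)
  case 1
  then have "iq = 0" using iq by simp
  then show ?thesis using B(2) n unfolding 1 Lp_norm_infinity by (intro esssup_I) (auto intro: ennreal_leI)
next
  case (2 r)
  then have "iq = 1 / r" using iq by (simp add: one_ereal_def)
  then show ?thesis using B(1) n order_trans[OF norm_ge_zero B(2)[of 0]] unfolding 2(1)
    by (subst Lp_norm_dilate_ereal[OF 2(2), of n "\<lambda>x. ennreal (norm (f x))"]) (auto simp: ennreal_mult intro!: mult_left_mono)
qed

text \<open>One frequency only. Shrinking the spectrum by n multiplies the L^p norm of the profile
  by n^(d/p - d), and likewise for p1, so the embedding bounds n^(d/p - d/p1). Only n at least 1 is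
  used, which keeps the spectrum in the narrow cube: spreading in space is tested, concentration is
  not.\<close>

lemma embedding_exponent_le:
  fixes \<sigma> :: "real^'n::finite \<Rightarrow> complex"
  assumes \<sigma>: "uniform_partition \<sigma>" and pos: "0 < p" "0 < p1" "0 < q" "0 < q1"
    and emb: "continuously_embedded
      (modulation_space \<sigma> p1 q1 s) (modulation_norm \<sigma> p1 q1 s)
      (wiener_amalgam_space \<sigma> p q 0) (wiener_amalgam_norm \<sigma> p q 0)"
  shows "p1 \<le> p"
proof (rule ccontr)
  assume "\<not> p1 \<le> p"
  then have lt: "p < p1" by simp
  then obtain r where r: "p = ereal r" "r > 0" using pos(1) by (cases p) auto
  obtain iq where iq: "1 / p1 = ereal iq" "iq < 1 / r"
    using pos(2)
  proof (cases rule: ereal_cases_pos)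
    case 1
    then show ?thesis using that[of 0] r by simp
  next
    case (2 u)
    then show ?thesis using that[of "1 / u"] r lt by (simp add: one_ereal_def frac_less2)
  qed
  obtain C where C: "C > 0" "\<And>(b :: real^'n \<Rightarrow> real) A (c :: int^'n \<Rightarrow> real) y B. narrow_bump b \<Longrightarrow> finite_coeffs A c \<Longrightarrow>
    Lp_norm lborel p1 (\<lambda>x. ennreal (norm (profile b x))) \<le> ennreal B \<Longrightarrow> B > 0 \<Longrightarrow>
    Lp_norm lborel p (\<lambda>x. lq_norm q (\<lambda>k. ennreal (c k * norm (profile b (x - y k))))) \<le>
    ennreal C * (ennreal B * lq_norm q1 (\<lambda>k. ennreal (lattice_weight k powr s * c k)))"
    by (rule embedded_test_inequality[OF \<sigma> pos emb]) blast
  define b where "b = (\<lambda>x. bump \<sigma> (4 *\<^sub>R x))"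
  have b: "narrow_bump b" unfolding b_def by (rule ex_narrow_bump[OF \<sigma>])
  have meas [measurable]: "profile b \<in> borel_measurable borel"
    using profile_schwartz[OF b] schwartz_measurable by blast
  obtain B0 where B0: "Lp_norm lborel p1 (\<lambda>x. ennreal (norm (profile b x))) = ennreal B0" "B0 \<ge> 0"
    using Lp_norm_schwartz_finite[OF profile_schwartz[OF b] pos(2)]
    by (cases "Lp_norm lborel p1 (\<lambda>x. ennreal (norm (profile b x)))") auto
  obtain B1 where B1: "\<And>x. norm (profile b x) \<le> B1" using schwartz_bounded[OF profile_schwartz[OF b], of 0] by auto
  define B where "B = max B0 (max B1 1)"
  have B: "Lp_norm lborel p1 (\<lambda>x. ennreal (norm (profile b x))) \<le> ennreal B" "norm (profile b x) \<le> B" "B > 0" for x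
    unfolding B0(1) using B1[of x] by (auto simp: B_def intro!: ennreal_leI)
  have "0 < Lp_norm lborel p (\<lambda>x. ennreal (norm (profile b x)))"
  proof -
    obtain m \<delta> where m: "m > 0" "\<delta> > 0" "\<And>x. norm x < \<delta> \<Longrightarrow> m \<le> norm (profile b x)"
      using profile_lower_bound[OF b] by metis
    have "0 < ennreal m * Lp_norm lborel p (indicator (ball (0::real^'n) \<delta>))"
      using Lp_norm_ball_pos[OF pos(1) m(2), of "0::real^'n"] m(1) by (simp add: ennreal_zero_less_mult_iff)
    also have "\<dots> = Lp_norm lborel p (\<lambda>x. ennreal m * indicator (ball (0::real^'n) \<delta>) x)"
      by (intro Lp_norm_cmult[symmetric] pos m borel_measurable_indicator) auto
    also have "\<dots> \<le> Lp_norm lborel p (\<lambda>x. ennreal (norm (profile b x)))"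
      by (intro Lp_norm_mono pos borel_measurable_times_ennreal borel_measurable_indicator)
         (auto simp: indicator_def m(3) intro!: ennreal_leI)
    finally show ?thesis .
  qed
  then obtain \<kappa> where \<kappa>: "\<kappa> > 0" "ennreal \<kappa> \<le> Lp_norm lborel p (\<lambda>x. ennreal (norm (profile b x)))"
    using ex_real_below by blast
  let ?d = "real CARD('n)"
  let ?e = "?d / r - ?d * iq"
  have e: "?e > 0" using iq(2) mult_strict_left_mono[of iq "1 / r" ?d] by simp
  have bound: "n powr ?e * \<kappa> \<le> C * B" if n: "n \<ge> 1" for n :: real
  proof -
    let ?b = "\<lambda>\<xi>. b (n *\<^sub>R \<xi>)" and ?c = "\<lambda>k::int^'n. if k = 0 then 1 else (0::real)"
    have n0: "n > 0" using n by simp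
    have bn: "narrow_bump ?b" by (rule narrow_bump_dilate[OF b n])
    have [measurable]: "profile ?b \<in> borel_measurable borel"
      using profile_schwartz[OF bn] schwartz_measurable by blast
    have dil: "Lp_norm lborel p' (\<lambda>x. ennreal (norm (profile ?b x))) = ennreal (n powr - ?d) * Lp_norm lborel p' (\<lambda>x. ennreal (norm (profile b ((1 / n) *\<^sub>R x))))"
      if "0 < p'" for p'
      using n0 that by (subst Lp_norm_cmult[symmetric]) (auto simp: profile_dilate[OF b n0] ennreal_mult)
    have up: "Lp_norm lborel p1 (\<lambda>x. ennreal (norm (profile ?b x))) \<le> ennreal (n powr - ?d * (n powr (?d * iq) * B))"
    proof -
      have "Lp_norm lborel p1 (\<lambda>x. ennreal (norm (profile b ((1 / n) *\<^sub>R x)))) \<le> ennreal (n powr (?d * iq) * B)"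
        using Lp_norm_dilate_le[OF pos(2) n0 meas B(1,2) iq(1)] by simp
      then show ?thesis unfolding dil[OF pos(2)] using B(3) by (simp add: ennreal_mult mult_left_mono)
    qed
    have "ennreal (n powr - ?d * (n powr (?d / r) * \<kappa>)) \<le> Lp_norm lborel p (\<lambda>x. ennreal (norm (profile ?b x)))"
      unfolding dil[OF pos(1)] unfolding r(1)
      using Lp_norm_dilate_ereal[OF r(2) n0, of "\<lambda>x. ennreal (norm (profile b x))"] \<kappa> r(1)
      by (simp add: ennreal_mult mult_left_mono)
    also have "\<dots> \<le> Lp_norm lborel p (\<lambda>x. lq_norm q (\<lambda>k. ennreal (?c k * norm (profile ?b (x - 0)))))"
    proof (intro Lp_norm_mono pos)
      show "ennreal (norm (profile ?b x)) \<le> lq_norm q (\<lambda>k. ennreal (?c k * norm (profile ?b (x - 0))))" for x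
        using le_lq_norm[OF pos(3), of "\<lambda>k. ennreal (?c k * norm (profile ?b (x - 0)))" 0] by simp
    qed measurable
    also have "\<dots> \<le> ennreal C * (ennreal (n powr - ?d * (n powr (?d * iq) * B)) * lq_norm q1 (\<lambda>k. ennreal (lattice_weight k powr s * ?c k)))"
    proof -
      have "0 < n powr - ?d * (n powr (?d * iq) * B)" using n0 B(3) by simp
      moreover have "finite_coeffs {0} ?c" by (simp add: finite_coeffs_def)
      ultimately show ?thesis by (intro C(2)[OF bn _ up])
    qed
    also have "\<dots> \<le> ennreal C * (ennreal (n powr - ?d * (n powr (?d * iq) * B)) * 1)"
    proof (intro mult_left_mono)
      \<comment> \<open>At the origin the weight is 1, so \<open>s\<close> drops out.\<close>
      have "(\<lambda>k. ennreal (lattice_weight k powr s * ?c k)) = (\<lambda>k. ennreal (if k = 0 then 1 else 0))"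
        by (auto simp: japanese_bracket_def)
      then show "lq_norm q1 (\<lambda>k. ennreal (lattice_weight k powr s * ?c k)) \<le> 1"
        using lq_norm_single[OF pos(4), of 1 "0::int^'n"] by simp
    qed auto
    finally have "n powr - ?d * (n powr (?d / r) * \<kappa>) \<le> C * (n powr - ?d * (n powr (?d * iq) * B))"
      using C(1) B(3) by (simp add: ennreal_mult[symmetric])
    then have "n powr - ?d * (n powr (?d / r) * \<kappa>) \<le> n powr - ?d * (C * (n powr (?d * iq) * B))" by (simp add: mult.left_commute)
    then have "n powr (?d / r) * \<kappa> \<le> C * (n powr (?d * iq) * B)" using n0 by simp
    also have "n powr (?d / r) = n powr (?d * iq) * n powr ?e" using n0 by (simp flip: powr_add)
    finally have "n powr (?d * iq) * (n powr ?e * \<kappa>) \<le> n powr (?d * iq) * (C * B)" by (simp add: mult_ac)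
    then show ?thesis using n0 by simp
  qed
  \<comment> \<open>Chosen so that its power \<open>?e\<close> is at least C B / kappa + 1, while
    the maximum with 1 keeps the dilation admissible.\<close>
  define x where "x = max 1 ((C * B / \<kappa> + 1) powr (1 / ?e))"
  have "C * B / \<kappa> \<ge> 0" using C(1) B(3) \<kappa>(1) by simp
  then have "C * B / \<kappa> + 1 = ((C * B / \<kappa> + 1) powr (1 / ?e)) powr ?e" using e by (simp add: powr_powr)
  also have "\<dots> \<le> x powr ?e" using e by (intro powr_mono2) (auto simp: x_def)
  finally have "C * B / \<kappa> + 1 \<le> x powr ?e" .
  moreover have "x powr ?e \<le> C * B / \<kappa>" using bound[of x] \<kappa>(1) by (simp add: x_def field_simps)
  ultimately show False by simp
qed

theorem theorem9:
  fixes \<sigma> :: "real^'n::finite \<Rightarrow> complex"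
    and p p1 q q1 :: ereal
    and s :: real
  assumes "uniform_partition \<sigma>"
    and "0 < p" "0 < p1" "0 < q" "0 < q1"
  shows "continuously_embedded
      (modulation_space \<sigma> p1 q1 s) (modulation_norm \<sigma> p1 q1 s)
      (wiener_amalgam_space \<sigma> p q 0) (wiener_amalgam_norm \<sigma> p q 0)
    \<longleftrightarrow> p1 \<le> p \<and>
      ((q1 \<le> min p q \<and> s \<ge> 0) \<or>
       (q1 > min p q \<and>
        ereal s + ereal (real CARD('n)) / q1 > ereal (real CARD('n)) / min p q))"
proof
  assume emb: "continuously_embedded
      (modulation_space \<sigma> p1 q1 s) (modulation_norm \<sigma> p1 q1 s)
      (wiener_amalgam_space \<sigma> p q 0) (wiener_amalgam_norm \<sigma> p q 0)"
  obtain C where C: "C > 0" "\<And>A c. finite_coeffs A c \<Longrightarrow>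
    lq_norm (min p q) (\<lambda>k::int^'n. ennreal (c k)) \<le> ennreal C * lq_norm q1 (\<lambda>k. ennreal (lattice_weight k powr s * c k))"
    using embedded_sequence_inequality[OF assms emb] by blast
  have "0 < min p q" using assms by simp
  have "(q1 \<le> min p q \<and> s \<ge> 0) \<or>
       (q1 > min p q \<and> ereal s + ereal (real CARD('n)) / q1 > ereal (real CARD('n)) / min p q)"
    by (rule sequence_embedding_necessary[OF \<open>0 < min p q\<close> assms(5) C(1)]) (rule C(2))
  with embedding_exponent_le[OF assms emb]
  show "p1 \<le> p \<and>
      ((q1 \<le> min p q \<and> s \<ge> 0) \<or>
       (q1 > min p q \<and>
        ereal s + ereal (real CARD('n)) / q1 > ereal (real CARD('n)) / min p q))"
    by blast
next
  assume "p1 \<le> p \<and>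
      ((q1 \<le> min p q \<and> s \<ge> 0) \<or>
       (q1 > min p q \<and>
        ereal s + ereal (real CARD('n)) / q1 > ereal (real CARD('n)) / min p q))"
  then show "continuously_embedded
      (modulation_space \<sigma> p1 q1 s) (modulation_norm \<sigma> p1 q1 s)
      (wiener_amalgam_space \<sigma> p q 0) (wiener_amalgam_norm \<sigma> p q 0)"
    using embedding_sufficient[OF assms] by blast
qed

end
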